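(* Let $\mathcal H$ and $\mathcal K$ be complex Hilbert spaces of arbitrary dimensions, let $T\in\mathcal B(\mathcal H,\mathcal K)$ and let $T=U|T|$ be its polar decomposition. Then the following statements are equivalent. (1) $T\in\mathcal{AN}_{[\pi,k]}(\mathcal H,\mathcal K)$ for every $\pi\in\Pi$ and for every $k\in\mathbb N$. (2) $T\in\mathcal{AN}_{[\pi,k]}(\mathcal H,\mathcal K)$ for some $\pi\in\Pi$ and for some $k\in\mathbb N$. (3) $|T|$ is of the form $|T|=\alpha I+K+F$, where $\alpha\ge0$, $K$ is a positive compact operator and $F$ is a self-adjoint finite-rank operator.
   Context: For a positive $A\in\mathcal B(\mathcal H)$ define $\lambda_j(A)$ as follows. The essential spectrum $\sigma_e(A)$ is the set of points of $\sigma(A)$ that are accumulation points of $\sigma(A)$ or eigenvalues of infinite multiplicity. Let $\mu=\sup\sigma(A)$. If $\mu\in\sigma_e(A)$, put $\lambda_j(A)=\mu$ for $j=1,\dots,\operatorname{rank}(A)$. Otherwise $\mu$ is an eigenvalue of finite multiplicity $m$; put $\lambda_j(A)=\mu$ for $1\le j\le m$ and $\lambda_{m+j}(A)=\lambda_j(A_1)$ for $1\le j\le\operatorname{rank}(A_1)$, where $A_1=A-\mu P_{E_\mu}$ and $P_{E_\mu}$ is the orthogonal projection onto the eigenspace of $\mu$. If $\operatorname{rank}(A)<\infty$, put $\lambda_j(A)=0$ for $j>\operatorname{rank}(A)$. For $T\in\mathcal B(\mathcal H,\mathcal K)$, with $|T|=\sqrt{T^*T}$, the s-numbers are $s_j(T)=\lambda_j(|T|)$.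 $\Pi$ is the set of all nonincreasing sequences $\pi=(\pi_j)_{j\in\mathbb N}$ of positive numbers with $\pi_1=1$. The weighted Ky Fan $\pi,k$-norm is $\|T\|_{[\pi,k]}=\sum_{j=1}^k\pi_js_j(T)$. $T\in\mathcal B(\mathcal H,\mathcal K)$ is $[\pi,k]$-norming, written $T\in\mathcal N_{[\pi,k]}(\mathcal H,\mathcal K)$, if there are orthonormal $x_1,\dots,x_k\in\mathcal H$ with $\|T\|_{[\pi,k]}=\sum_{j=1}^k\pi_j\|Tx_j\|$; if $\dim\mathcal H=r<k$, the requirement is instead that there are orthonormal $x_1,\dots,x_r\in\mathcal H$ with $\|T\|_{[\pi,k]}=\sum_{j=1}^r\pi_j\|Tx_j\|$. $T$ is absolutely $[\pi,k]$-norming, written $T\in\mathcal{AN}_{[\pi,k]}(\mathcal H,\mathcal K)$, if for every nontrivial (nonzero; $\mathcal M=\mathcal H$ allowed) closed subspace $\mathcal M\subseteq\mathcal H$ the restriction $T|_{\mathcal M}:\mathcal M\to\mathcal K$ is $[\pi,k]$-norming. *)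

theory Defs
  imports "HOL-Analysis.Analysis"
begin

section \<open>Complex Hilbert spaces\<close>

text \<open>The inner product is linear in its first argument.\<close>

class complex_hilbert = banach +
  fixes scaleC :: "complex \<Rightarrow> 'a \<Rightarrow> 'a" (infixr \<open>*\<^sub>C\<close> 75)
    and cinner :: "'a \<Rightarrow> 'a \<Rightarrow> complex"
  assumes scaleC_add_right: "c *\<^sub>C (x + y) = c *\<^sub>C x + c *\<^sub>C y"
    and scaleC_add_left: "(c + d) *\<^sub>C x = c *\<^sub>C x + d *\<^sub>C x"
    and scaleC_scaleC: "c *\<^sub>C (d *\<^sub>C x) = (c * d) *\<^sub>C x"
    and scaleC_one: "1 *\<^sub>C x = x"
    and scaleC_of_real: "complex_of_real r *\<^sub>C x = r *\<^sub>R x"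
    and cinner_commute: "cinner x y = cnj (cinner y x)"
    and cinner_add_left: "cinner (x + y) z = cinner x z + cinner y z"
    and cinner_scaleC_left: "cinner (c *\<^sub>C x) y = c * cinner x y"
    and cinner_self: "cinner x x = complex_of_real ((norm x)\<^sup>2)"

instantiation complex :: complex_hilbert
begin

definition scaleC_complex :: "complex \<Rightarrow> complex \<Rightarrow> complex"
  where "scaleC_complex c x = c * x"

definition cinner_complex :: "complex \<Rightarrow> complex \<Rightarrow> complex"
  where "cinner_complex x y = x * cnj y"

instance
  by standard
    (simp_all add: scaleC_complex_def cinner_complex_def algebra_simps scaleR_conv_of_real
      complex_norm_square del: of_real_power)

end

global_interpretation cvec: vector_space "scaleC :: complex \<Rightarrow> 'a \<Rightarrow> 'a::complex_hilbert"
  defines csubspace = cvec.subspace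
    and cspan = cvec.span
    and cdim = cvec.dim
  by unfold_locales
    (simp_all add: scaleC_add_right scaleC_add_left scaleC_scaleC scaleC_one)

text \<open>\<^const>\<open>cdim\<close> is 0 on infinite-dimensional subspaces, so finiteness of the dimension
  has to be expressed separately.\<close>

definition cfinite_dim :: "'a::complex_hilbert set \<Rightarrow> bool"
  where "cfinite_dim S \<longleftrightarrow> (\<exists>B. finite B \<and> S \<subseteq> cspan B)"

definition closed_csubspace :: "'a::complex_hilbert set \<Rightarrow> bool"
  where "closed_csubspace M \<longleftrightarrow> csubspace M \<and> closed M"

definition corthonormal :: "(nat \<Rightarrow> 'a::complex_hilbert) \<Rightarrow> nat set \<Rightarrow> bool"
  where "corthonormal x J \<longleftrightarrow> (\<forall>i\<in>J. \<forall>j\<in>J. cinner (x i) (x j) = (if i = j then 1 else 0))"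


section \<open>Operators\<close>

text \<open>
  A closed subspace of a Hilbert space is itself a Hilbert space. In order to speak about the
  restriction of an operator to a closed subspace \<open>M\<close> as an operator with domain \<open>M\<close>, all
  notions below carry the domain \<open>M\<close> as an argument and depend only on the values on \<open>M\<close>; in
  particular an operator on \<open>M\<close> is a function mapping \<open>M\<close> into \<open>M\<close>, and spectrum, rank, etc.
  are those in the algebra of bounded operators on \<open>M\<close>. The whole space is \<open>M = UNIV\<close>.
\<close>

definition bounded_op :: "'a::complex_hilbert set \<Rightarrow> 'b::complex_hilbert set \<Rightarrow> ('a \<Rightarrow> 'b) \<Rightarrow> bool"
  where "bounded_op M N T \<longleftrightarrow>
    (\<forall>x\<in>M. T x \<in> N) \<and>
    (\<forall>x\<in>M. \<forall>y\<in>M. T (x + y) = T x + T y) \<and>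
    (\<forall>c. \<forall>x\<in>M. T (c *\<^sub>C x) = c *\<^sub>C T x) \<and>
    (\<exists>b. \<forall>x\<in>M. norm (T x) \<le> b * norm x)"

definition adjoint_op :: "'a::complex_hilbert set \<Rightarrow> ('a \<Rightarrow> 'b::complex_hilbert) \<Rightarrow> 'b \<Rightarrow> 'a"
  where "adjoint_op M T y = (THE z. z \<in> M \<and> (\<forall>x\<in>M. cinner (T x) y = cinner x z))"

definition positive_op :: "'a::complex_hilbert set \<Rightarrow> ('a \<Rightarrow> 'a) \<Rightarrow> bool"
  where "positive_op M A \<longleftrightarrow> bounded_op M M A \<and> (\<forall>x\<in>M. cinner (A x) x \<in> \<real>\<^sub>\<ge>\<^sub>0)"

text \<open>The positive square root of a positive operator \<open>A\<close> on \<open>M\<close>; membership in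
  \<^term>\<open>extensional M\<close> only fixes the irrelevant values outside of \<open>M\<close>.\<close>

definition sqrt_op :: "'a::complex_hilbert set \<Rightarrow> ('a \<Rightarrow> 'a) \<Rightarrow> 'a \<Rightarrow> 'a"
  where "sqrt_op M A =
    (THE B. B \<in> extensional M \<and> positive_op M B \<and> (\<forall>x\<in>M. B (B x) = A x))"

definition abs_op :: "'a::complex_hilbert set \<Rightarrow> ('a \<Rightarrow> 'b::complex_hilbert) \<Rightarrow> 'a \<Rightarrow> 'a"
  where "abs_op M T = sqrt_op M (\<lambda>x. adjoint_op M T (T x))"

definition proj_op :: "'a::complex_hilbert set \<Rightarrow> 'a \<Rightarrow> 'a"
  where "proj_op E x = (THE y. y \<in> E \<and> (\<forall>z\<in>E. cinner (x - y) z = 0))"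

definition self_adjoint_op :: "('a::complex_hilbert \<Rightarrow> 'a) \<Rightarrow> bool"
  where "self_adjoint_op A \<longleftrightarrow> bounded_op UNIV UNIV A \<and> adjoint_op UNIV A = A"

definition compact_op :: "('a::complex_hilbert \<Rightarrow> 'b::complex_hilbert) \<Rightarrow> bool"
  where "compact_op A \<longleftrightarrow> bounded_op UNIV UNIV A \<and> compact (closure (A ` cball 0 1))"

definition finite_rank_op :: "('a::complex_hilbert \<Rightarrow> 'b::complex_hilbert) \<Rightarrow> bool"
  where "finite_rank_op A \<longleftrightarrow> bounded_op UNIV UNIV A \<and> cfinite_dim (range A)"

text \<open>\<open>T = U |T|\<close> with a partial isometry \<open>U\<close> such that \<open>ker U = ker T\<close>.\<close>

definition polar_decomposition ::
  "('a::complex_hilbert \<Rightarrow> 'b::complex_hilbert) \<Rightarrow> ('a \<Rightarrow> 'b) \<Rightarrow> bool"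
  where "polar_decomposition T U \<longleftrightarrow>
    bounded_op UNIV UNIV U \<and>
    (\<forall>x. (\<forall>z. U z = 0 \<longrightarrow> cinner x z = 0) \<longrightarrow> norm (U x) = norm x) \<and>
    {x. U x = 0} = {x. T x = 0} \<and>
    T = U \<circ> abs_op UNIV T"


section \<open>Spectrum and s-numbers\<close>

definition spectrum_op :: "'a::complex_hilbert set \<Rightarrow> ('a \<Rightarrow> 'a) \<Rightarrow> complex set"
  where "spectrum_op M A = {z. \<not> (\<exists>S. bounded_op M M S \<and>
    (\<forall>x\<in>M. S (A x - z *\<^sub>C x) = x) \<and> (\<forall>x\<in>M. A (S x) - z *\<^sub>C S x = x))}"

definition eigenspace_op :: "'a::complex_hilbert set \<Rightarrow> ('a \<Rightarrow> 'a) \<Rightarrow> complex \<Rightarrow> 'a set"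
  where "eigenspace_op M A z = {x\<in>M. A x = z *\<^sub>C x}"

definition ess_spectrum_op :: "'a::complex_hilbert set \<Rightarrow> ('a \<Rightarrow> 'a) \<Rightarrow> complex set"
  where "ess_spectrum_op M A = {z \<in> spectrum_op M A.
    z islimpt spectrum_op M A \<or> \<not> cfinite_dim (eigenspace_op M A z)}"

text \<open>Only used for positive \<open>A\<close>, whose spectrum is a subset of the nonnegative reals.\<close>

definition sup_spectrum_op :: "'a::complex_hilbert set \<Rightarrow> ('a \<Rightarrow> 'a) \<Rightarrow> real"
  where "sup_spectrum_op M A = Sup {t. complex_of_real t \<in> spectrum_op M A}"

text \<open>
  The numbers \<open>\<lambda>\<^sub>j(A)\<close>, \<open>j \<ge> 1\<close>, of a positive operator \<open>A\<close> on \<open>M\<close>. The disjunct \<open>m = 0\<close> cannot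
  occur for positive \<open>A\<close> on closed \<open>M\<close> with \<open>1 \<le> j \<le> rank A\<close> and only serves to make the
  recursion terminate.
\<close>

function lambda_op :: "'a::complex_hilbert set \<Rightarrow> ('a \<Rightarrow> 'a) \<Rightarrow> nat \<Rightarrow> real"
  where "lambda_op M A j =
    (let \<mu> = sup_spectrum_op M A;
         E = eigenspace_op M A (complex_of_real \<mu>);
         m = cdim E
     in if cfinite_dim (A ` M) \<and> j > cdim (A ` M) then 0
        else if complex_of_real \<mu> \<in> ess_spectrum_op M A then \<mu>
        else if j \<le> m \<or> m = 0 then \<mu>
        else lambda_op M (\<lambda>x. A x - \<mu> *\<^sub>R proj_op E x) (j - m))"
  by pat_completeness auto
termination
  by (relation "Wellfounded.measure (\<lambda>(M, A, j). j)") auto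

declare lambda_op.simps [simp del]

definition s_number :: "'a::complex_hilbert set \<Rightarrow> ('a \<Rightarrow> 'b::complex_hilbert) \<Rightarrow> nat \<Rightarrow> real"
  where "s_number M T j = lambda_op M (abs_op M T) j"


section \<open>Weighted Ky Fan norms and norming operators\<close>

text \<open>Sequences are indexed from 1; the value at index 0 is ignored throughout.\<close>

definition weights :: "(nat \<Rightarrow> real) set"
  where "weights = {w. w 1 = 1 \<and> (\<forall>j\<ge>1. w j > 0) \<and> (\<forall>i\<ge>1. \<forall>j\<ge>i. w j \<le> w i)}"

definition ky_fan_norm ::
  "(nat \<Rightarrow> real) \<Rightarrow> nat \<Rightarrow> 'a::complex_hilbert set \<Rightarrow> ('a \<Rightarrow> 'b::complex_hilbert) \<Rightarrow> real"
  where "ky_fan_norm w k M T = (\<Sum>j=1..k. w j * s_number M T j)"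

definition norming ::
  "(nat \<Rightarrow> real) \<Rightarrow> nat \<Rightarrow> 'a::complex_hilbert set \<Rightarrow> ('a \<Rightarrow> 'b::complex_hilbert) \<Rightarrow> bool"
  where "norming w k M T \<longleftrightarrow>
    (let n = (if cfinite_dim M \<and> cdim M < k then cdim M else k)
     in \<exists>x. (\<forall>j\<in>{1..n}. x j \<in> M) \<and> corthonormal x {1..n} \<and>
          ky_fan_norm w k M T = (\<Sum>j=1..n. w j * norm (T (x j))))"

definition absolutely_norming ::
  "(nat \<Rightarrow> real) \<Rightarrow> nat \<Rightarrow> ('a::complex_hilbert \<Rightarrow> 'b::complex_hilbert) \<Rightarrow> bool"
  where "absolutely_norming w k T \<longleftrightarrow>
    (\<forall>M. closed_csubspace M \<and> M \<noteq> {0} \<longrightarrow> norming w k M T)"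

end

theory Submission
  imports Defs
begin

text \<open>All three statements are equivalent to \<open>T\<close> attaining its norm on every nonzero closed subspace \<open>M\<close>.
  If \<open>T\<close> is norming on \<open>M\<close> and has infinite rank there, either the top of the spectrum of the modulus of the restriction is an
  eigenvalue, or all s-numbers equal the norm, and then each of the orthonormal vectors attains it.
  Conversely, successive maximization yields orthonormal eigenvectors of the modulus whose eigenvalues
  are the s-numbers. If \<open>|T| = \<alpha> + K + F\<close>, then a maximizing sequence on \<open>M\<close> converges along a subsequence
  when the norm on \<open>M\<close> exceeds \<open>\<alpha>\<close>; otherwise a unit vector of \<open>M \<inter> ker F\<close> attains the norm, or \<open>M\<close> is
  finite-dimensional. For the last implication, \<open>\<alpha>\<close> is the limit of the successive maxima, \<open>K\<close> is
  \<open>|T| - \<alpha>\<close> on the closed span of the maximizers and \<open>F\<close> is \<open>|T| - \<alpha>\<close> on its complement.\<close>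

section \<open>Inner products\<close>

text \<open>Norm attainment is the right middle notion because it involves only the numbers
  \<open>norm (T y)\<close>. The modulus of the restriction to \<open>M\<close> is in general not
  the restriction of the modulus, but on \<open>M\<close> both give images of the same norm as
  \<open>T\<close>, so attainment passes freely among the three, while eigenvectors do not. It
  mentions neither the weights nor \<open>k\<close>, which is what makes "some" and "every"
  collapse. Everything spectral is reduced to maximizing \<open>norm (A y)\<close> over a unit
  sphere: for positive \<open>A\<close> a maximizer is an eigenvector and a near-maximizer an
  approximate eigenvector, so the top of the spectrum is the operator norm. The recursion behind the
  s-numbers is then matched with successive maximization, one distinct eigenvalue at a time. The
  delicate point is the finite rank of \<open>F\<close>. Vectors whose image norms stay below
  \<alpha> need not have image norms approaching \<alpha>, so by themselves they contradict nothing;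
  the infinitely many eigenvectors with eigenvalues at least \<alpha> serve to lift them.\<close>

lemma cinner_add_right: "cinner x (y + z) = cinner x y + cinner x z"
  by (metis cinner_add_left cinner_commute complex_cnj_add)

lemma cinner_scaleC_right: "cinner x (c *\<^sub>C y) = cnj c * cinner x y"
  by (metis cinner_commute cinner_scaleC_left complex_cnj_mult)

lemma cinner_scaleR_left: "cinner (r *\<^sub>R x) y = r *\<^sub>R cinner x y"
  by (metis cinner_scaleC_left scaleC_of_real scaleR_conv_of_real)

lemma cinner_scaleR_right: "cinner x (r *\<^sub>R y) = r *\<^sub>R cinner x y"
  by (metis cinner_scaleC_right scaleC_of_real scaleR_conv_of_real complex_cnj_complex_of_real)

lemma Re_cinner_commute: "Re (cinner x y) = Re (cinner y x)"
  by (metis cinner_commute complex_cnj(1) complex.sel(1) complex_surj)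

lemma norm_sq_add: "(norm (x + y))\<^sup>2 = (norm x)\<^sup>2 + (norm y)\<^sup>2 + 2 * Re (cinner x y)"
proof -
  have "complex_of_real ((norm (x + y))\<^sup>2) = cinner (x + y) (x + y)" by (simp only: cinner_self)
  also have "\<dots> = cinner x x + cinner y y + (cinner x y + cinner y x)"
    by (simp add: cinner_add_left cinner_add_right)
  finally have "Re (complex_of_real ((norm (x + y))\<^sup>2)) = Re \<dots>" by simp
  then show ?thesis by (simp add: cinner_self Re_cinner_commute[of y x] del: of_real_power)
qed

lemma norm_scaleC: "norm (c *\<^sub>C x) = cmod c * norm (x::'a::complex_hilbert)"
proof -
  have "complex_of_real ((norm (c *\<^sub>C x))\<^sup>2) = c * cnj c * complex_of_real ((norm x)\<^sup>2)"
    by (simp only: cinner_self[symmetric] cinner_scaleC_left cinner_scaleC_right) simp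
  also have "\<dots> = complex_of_real ((cmod c * norm x)\<^sup>2)"
    by (simp only: complex_norm_square[symmetric] power_mult_distrib of_real_mult of_real_power)
  finally have "(norm (c *\<^sub>C x))\<^sup>2 = (cmod c * norm x)\<^sup>2"
    using of_real_eq_iff by blast
  then show ?thesis by simp
qed

lemma scaleC_scaleR: "c *\<^sub>C (r *\<^sub>R x) = r *\<^sub>R (c *\<^sub>C (x::'a::complex_hilbert))"
  by (metis mult.commute scaleC_of_real scaleC_scaleC)

lemma scaleC_diff_right: "c *\<^sub>C (x - y) = c *\<^sub>C x - c *\<^sub>C (y::'a::complex_hilbert)"
  by (rule cvec.scale_right_diff_distrib)

lemma cauchy_schwarz: "cmod (cinner x y) \<le> norm x * norm y"
proof (cases "y = 0")
  case True
  have "cinner x 0 = 0" using cinner_scaleC_right[of x 0 0] by simp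
  then show ?thesis using True by simp
next
  case False
  \<comment> \<open>Minus the coefficient of the projection of \<open>x\<close> onto
    \<open>y\<close>: the vector whose squared norm is expanded below is orthogonal to
    \<open>y\<close>, and its nonnegativity is the inequality.\<close>
  let ?c = "- (cinner x y / complex_of_real ((norm y)\<^sup>2))"
  have ny: "(norm y)\<^sup>2 > 0" using False by simp
  have c: "cmod ?c = cmod (cinner x y) / (norm y)\<^sup>2"
    by (simp add: norm_divide norm_power)
  have re: "Re (cnj ?c * cinner x y) = - ((cmod (cinner x y))\<^sup>2 / (norm y)\<^sup>2)"
  proof -
    have "cnj ?c * cinner x y = - (cinner x y * cnj (cinner x y) / complex_of_real ((norm y)\<^sup>2))"
      by simp
    also have "\<dots> = complex_of_real (- ((cmod (cinner x y))\<^sup>2 / (norm y)\<^sup>2))"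
      by (simp only: complex_norm_square[symmetric] of_real_minus of_real_divide of_real_power)
    finally show ?thesis by (simp only: Re_complex_of_real)
  qed
  have "0 \<le> (norm (x + ?c *\<^sub>C y))\<^sup>2" by simp
  also have "\<dots> = (norm x)\<^sup>2 + (cmod (cinner x y))\<^sup>2 / (norm y)\<^sup>2
      - 2 * ((cmod (cinner x y))\<^sup>2 / (norm y)\<^sup>2)"
    unfolding norm_sq_add norm_scaleC cinner_scaleC_right re c
    using ny by (simp add: power_mult_distrib power_divide power2_eq_square)
  finally have "(cmod (cinner x y))\<^sup>2 / (norm y)\<^sup>2 \<le> (norm x)\<^sup>2" by linarith
  then have "(cmod (cinner x y))\<^sup>2 \<le> (norm x * norm y)\<^sup>2"
    using ny by (simp add: divide_le_eq power_mult_distrib)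
  then show ?thesis by (rule power2_le_imp_le) simp
qed

interpretation cinner: bounded_bilinear "cinner :: 'a::complex_hilbert \<Rightarrow> 'a \<Rightarrow> complex"
  by standard (auto simp: cinner_add_left cinner_add_right cinner_scaleR_left cinner_scaleR_right
      intro!: exI[of _ 1] cauchy_schwarz)

interpretation scaleC: bounded_bilinear "scaleC :: complex \<Rightarrow> 'a::complex_hilbert \<Rightarrow> 'a"
  apply standard
      apply (auto simp: scaleC_add_left scaleC_add_right scaleC_scaleR norm_scaleC intro!: exI[of _ 1])
  by (metis mult.commute scaleC_of_real scaleC_scaleC scaleR_conv_of_real)

lemma norm_sq_diff: "(norm (x - y))\<^sup>2 = (norm x)\<^sup>2 + (norm y)\<^sup>2 - 2 * Re (cinner x y)"
  using norm_sq_add[of x "- y"] by (simp add: cinner.minus_right)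

lemma parallelogram_law:
  "(norm (x + y))\<^sup>2 + (norm (x - y))\<^sup>2 = 2 * (norm x)\<^sup>2 + 2 * (norm (y::'a::complex_hilbert))\<^sup>2"
  by (simp add: norm_sq_add norm_sq_diff)

lemma pythagoras: "cinner x y = 0 \<Longrightarrow> (norm (x + y))\<^sup>2 = (norm x)\<^sup>2 + (norm y)\<^sup>2"
  by (simp add: norm_sq_add)

lemma Re_cinner_self: "Re (cinner x x) = (norm x)\<^sup>2"
  by (simp add: cinner_self del: of_real_power)

lemma cinner_self_eq_0 [simp]: "cinner x x = 0 \<longleftrightarrow> x = 0"
  by (simp add: cinner_self del: of_real_power)

lemma cinner_eq_0_commute: "cinner x y = 0 \<longleftrightarrow> cinner y x = 0"
  by (metis cinner_commute complex_cnj_zero)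

lemma Re_cinner_le: "Re (cinner x y) \<le> norm x * norm y"
  using complex_Re_le_cmod cauchy_schwarz order_trans by blast

section \<open>Subspaces and orthogonal projections\<close>

text \<open>Taken for arbitrary sets, so that finitely many chosen vectors can be used directly in
  place of their span.\<close>

definition ocompl :: "'a::complex_hilbert set \<Rightarrow> 'a set"
  where "ocompl S = {y. \<forall>s\<in>S. cinner y s = 0}"

lemma ocomplD: "y \<in> ocompl S \<Longrightarrow> s \<in> S \<Longrightarrow> cinner y s = 0"
  by (simp add: ocompl_def)

lemma csubspace_ocompl: "csubspace (ocompl S)"
  by (rule cvec.subspaceI) (simp_all add: ocompl_def cinner_add_left cinner_scaleC_left cinner.zero_left)

lemma closed_cinner_zero: "closed {y. cinner y s = 0}"
  by (intro closed_Collect_eq continuous_intros cinner.continuous_on)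

lemma closed_ocompl: "closed (ocompl S)"
proof -
  have "ocompl S = (\<Inter>s\<in>S. {y. cinner y s = 0})" by (auto simp: ocompl_def)
  then show ?thesis using closed_cinner_zero by auto
qed

lemma closed_csubspace_ocompl: "closed_csubspace (ocompl S)"
  by (simp add: closed_csubspace_def csubspace_ocompl closed_ocompl)

lemma closed_csubspace_Int:
  "closed_csubspace M \<Longrightarrow> closed_csubspace N \<Longrightarrow> closed_csubspace (M \<inter> N)"
  by (auto simp: closed_csubspace_def intro: cvec.subspace_inter)

lemma closed_csubspace_UNIV: "closed_csubspace UNIV"
  by (simp add: closed_csubspace_def)

lemma csubspace_closure: "csubspace S \<Longrightarrow> csubspace (closure (S::'a::complex_hilbert set))"
proof (rule cvec.subspaceI)
  assume S: "csubspace S"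
  show "0 \<in> closure S" using cvec.subspace_0[OF S] closure_subset by blast
  show "x + y \<in> closure S" if "x \<in> closure S" "y \<in> closure S" for x y
  proof -
    obtain f g where "\<forall>n. f n \<in> S" "f \<longlonglongrightarrow> x" "\<forall>n. g n \<in> S" "g \<longlonglongrightarrow> y"
      using \<open>x \<in> closure S\<close> \<open>y \<in> closure S\<close> unfolding closure_sequential by blast
    then have "\<forall>n. f n + g n \<in> S" "(\<lambda>n. f n + g n) \<longlonglongrightarrow> x + y"
      using cvec.subspace_add[OF S] by (auto intro: tendsto_add)
    then show ?thesis unfolding closure_sequential by (intro exI[of _ "\<lambda>n. f n + g n"]) auto
  qed
  show "c *\<^sub>C x \<in> closure S" if "x \<in> closure S" for c x
  proof -
    obtain f where "\<forall>n. f n \<in> S" "f \<longlonglongrightarrow> x"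
      using \<open>x \<in> closure S\<close> unfolding closure_sequential by blast
    then have "\<forall>n. c *\<^sub>C f n \<in> S" "(\<lambda>n. c *\<^sub>C f n) \<longlonglongrightarrow> c *\<^sub>C x"
      using cvec.subspace_scale[OF S] by (auto intro: scaleC.tendsto tendsto_const)
    then show ?thesis unfolding closure_sequential by (intro exI[of _ "\<lambda>n. c *\<^sub>C f n"]) auto
  qed
qed

lemma closed_csubspace_closure_cspan: "closed_csubspace (closure (cspan S))"
  by (simp add: closed_csubspace_def csubspace_closure)

lemma csubspace_closed_csubspace: "closed_csubspace M \<Longrightarrow> csubspace M"
  by (simp add: closed_csubspace_def)

lemma csubspace_scaleR: "csubspace M \<Longrightarrow> x \<in> M \<Longrightarrow> r *\<^sub>R x \<in> M"
  by (metis cvec.subspace_scale scaleC_of_real)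

lemma csubspace_sgn:
  assumes "csubspace M" "M \<noteq> {0}"
  obtains x where "x \<in> M" "norm x = 1"
proof -
  obtain y where "y \<in> M" "y \<noteq> 0" using assms cvec.subspace_0 by blast
  then show ?thesis using that[of "(1 / norm y) *\<^sub>R y"] csubspace_scaleR[OF assms(1)] by simp
qed

lemma closure_cspan_minimal:
  "closed_csubspace M \<Longrightarrow> S \<subseteq> M \<Longrightarrow> closure (cspan S) \<subseteq> M"
  by (simp add: closed_csubspace_def closure_minimal cvec.span_minimal)

lemma ocompl_closure_cspan: "ocompl (closure (cspan S)) = ocompl S"
proof
  have "S \<subseteq> closure (cspan S)" using cvec.span_superset closure_subset by blast
  then show "ocompl (closure (cspan S)) \<subseteq> ocompl S" by (auto simp: ocompl_def)
  show "ocompl S \<subseteq> ocompl (closure (cspan S))"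
  proof
    fix y assume "y \<in> ocompl S"
    \<comment> \<open>Orthogonality to \<open>y\<close> defines a closed subspace, so it extends
      from \<open>S\<close> to the closed span.\<close>
    then have "S \<subseteq> ocompl {y}" by (auto simp: ocompl_def cinner_eq_0_commute[of y])
    from closure_cspan_minimal[OF closed_csubspace_ocompl this]
    show "y \<in> ocompl (closure (cspan S))" by (auto simp: ocompl_def cinner_eq_0_commute[of y])
  qed
qed

text \<open>A minimizing sequence for the distance is Cauchy: midpoints stay in \<open>M\<close>, so
  the parallelogram law bounds the gap between two near-minimizers. If the residual of the limit had
  a component along some \<open>z\<close> in \<open>M\<close>, removing it would shorten the
  residual.\<close>

theorem projection_exists:
  fixes x :: "'a::complex_hilbert"
  assumes M: "closed_csubspace M"
  obtains y where "y \<in> M" "x - y \<in> ocompl M"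
proof -
  have sM: "csubspace M" and cM: "closed M" using M by (auto simp: closed_csubspace_def)
  define D where "D = (\<lambda>y. norm (x - y)) ` M"
  define d where "d = Inf D"
  have bdd: "bdd_below D" by (auto simp: D_def intro: bdd_belowI[of _ 0])
  have D0: "D \<noteq> {}" using cvec.subspace_0[OF sM] by (auto simp: D_def)
  have dle: "d \<le> norm (x - y)" if "y \<in> M" for y
    unfolding d_def using that bdd by (auto simp: D_def intro: cInf_lower)
  have d0: "0 \<le> d" unfolding d_def using D0 by (intro cInf_greatest) (auto simp: D_def)
  \<comment> \<open>The error is put on the squared distance because the parallelogram law is linear
    in squares.\<close>
  have "\<exists>y\<in>M. (norm (x - y))\<^sup>2 < d\<^sup>2 + 1 / real (Suc n)" for n
  proof -
    have "d < sqrt (d\<^sup>2 + 1 / real (Suc n))" using d0 by (intro real_less_rsqrt) simp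
    then obtain y where "y \<in> M" "norm (x - y) < sqrt (d\<^sup>2 + 1 / real (Suc n))"
      using cInf_lessD[OF D0] unfolding d_def by (auto simp: D_def)
    moreover have "(norm (x - y))\<^sup>2 < (sqrt (d\<^sup>2 + 1 / real (Suc n)))\<^sup>2"
      using calculation by (intro power_strict_mono) auto
    ultimately show ?thesis by auto
  qed
  then obtain f where fM: "\<And>n. f n \<in> M" and f: "\<And>n. (norm (x - f n))\<^sup>2 < d\<^sup>2 + 1 / real (Suc n)"
    by metis
  have diff: "(norm (f m - f n))\<^sup>2 \<le> 2 / real (Suc m) + 2 / real (Suc n)" for m n
  proof -
    let ?u = "x - f m" and ?v = "x - f n"
    have "(1/2) *\<^sub>R (f m + f n) \<in> M"
      using fM sM by (intro csubspace_scaleR cvec.subspace_add) auto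
    then have "d \<le> norm (x - (1/2) *\<^sub>R (f m + f n))" by (rule dle)
    also have "x - (1/2) *\<^sub>R (f m + f n) = (1/2) *\<^sub>R (?u + ?v)"
      by (simp add: algebra_simps flip: scaleR_add_left)
    finally have "2 * d \<le> norm (?u + ?v)" by simp
    then have "4 * d\<^sup>2 \<le> (norm (?u + ?v))\<^sup>2"
      using power_mono[of "2 * d" "norm (?u + ?v)" 2] d0 by (simp add: power_mult_distrib)
    moreover have "(norm (?u - ?v))\<^sup>2 = (norm (f m - f n))\<^sup>2" by (simp add: norm_minus_commute)
    ultimately show ?thesis using parallelogram_law[of ?u ?v] f[of m] f[of n] by simp
  qed
  have "Cauchy f"
  proof (rule metric_CauchyI)
    fix e :: real assume e: "e > 0"
    obtain N where N: "4 / e\<^sup>2 < real N" using reals_Archimedean2 by blast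
    have "dist (f m) (f n) < e" if "m \<ge> N" "n \<ge> N" for m n
    proof -
      have N0: "real N > 0" using N e by (smt (verit) divide_pos_pos zero_less_power)
      have "2 / real (Suc m) \<le> 2 / real N" "2 / real (Suc n) \<le> 2 / real N"
        using that N0 by (auto intro!: divide_left_mono)
      then have "(norm (f m - f n))\<^sup>2 \<le> 4 / real N" using diff[of m n] by simp
      also have "\<dots> < e\<^sup>2" using N e N0 by (simp add: field_simps)
      finally show ?thesis unfolding dist_norm using e by (simp add: power2_less_imp_less)
    qed
    then show "\<exists>N. \<forall>m\<ge>N. \<forall>n\<ge>N. dist (f m) (f n) < e" by blast
  qed
  then obtain y where y: "f \<longlonglongrightarrow> y" using Cauchy_convergent_iff convergent_def by blast
  have yM: "y \<in> M" using cM fM y closed_sequentially by blast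
  have "(\<lambda>n. d\<^sup>2 + inverse (real (Suc n))) \<longlonglongrightarrow> d\<^sup>2 + 0"
    by (intro tendsto_intros LIMSEQ_inverse_real_of_nat)
  moreover have "(\<lambda>n. (norm (x - f n))\<^sup>2) \<longlonglongrightarrow> (norm (x - y))\<^sup>2"
    by (intro tendsto_intros y)
  moreover have "(norm (x - f n))\<^sup>2 \<le> d\<^sup>2 + inverse (real (Suc n))" for n
    using f[of n] by (simp add: inverse_eq_divide)
  ultimately have yd: "(norm (x - y))\<^sup>2 \<le> d\<^sup>2 + 0"
    using LIMSEQ_le by blast
  have "cinner (x - y) z = 0" if z: "z \<in> M" for z
  proof (cases "z = 0")
    case False
    let ?c = "cinner (x - y) z / complex_of_real ((norm z)\<^sup>2)"
    have nz: "(norm z)\<^sup>2 > 0" using False by simp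
    have c: "cmod ?c = cmod (cinner (x - y) z) / (norm z)\<^sup>2"
      by (simp add: norm_divide norm_power)
    have "y + ?c *\<^sub>C z \<in> M" using yM z sM by (intro cvec.subspace_add cvec.subspace_scale)
    then have "d\<^sup>2 \<le> (norm (x - (y + ?c *\<^sub>C z)))\<^sup>2" using dle d0 by (intro power_mono) auto
    also have "x - (y + ?c *\<^sub>C z) = (x - y) - ?c *\<^sub>C z" by simp
    also have "(norm \<dots>)\<^sup>2 = (norm (x - y))\<^sup>2 + (cmod (cinner (x - y) z))\<^sup>2 / (norm z)\<^sup>2
        - 2 * Re (cnj ?c * cinner (x - y) z)"
      unfolding norm_sq_diff norm_scaleC cinner_scaleC_right c
      using nz by (simp add: power_mult_distrib power_divide power2_eq_square)
    also have "Re (cnj ?c * cinner (x - y) z) = (cmod (cinner (x - y) z))\<^sup>2 / (norm z)\<^sup>2"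
    proof -
      have "cnj ?c * cinner (x - y) z
          = cinner (x - y) z * cnj (cinner (x - y) z) / complex_of_real ((norm z)\<^sup>2)"
        by simp
      also have "\<dots> = complex_of_real ((cmod (cinner (x - y) z))\<^sup>2 / (norm z)\<^sup>2)"
        by (simp only: complex_norm_square[symmetric] of_real_divide of_real_power)
      finally show ?thesis by (simp only: Re_complex_of_real)
    qed
    finally have "(cmod (cinner (x - y) z))\<^sup>2 / (norm z)\<^sup>2 \<le> 0" using yd by linarith
    then show ?thesis using nz by (simp add: divide_le_0_iff)
  qed (simp add: cinner.zero_right)
  then show ?thesis using that yM by (auto simp: ocompl_def)
qed

lemma projection_unique:
  assumes "csubspace M" "y \<in> M" "x - y \<in> ocompl M" "z \<in> M" "x - z \<in> ocompl M"
  shows "y = z"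
proof -
  have "y - z \<in> M" using assms cvec.subspace_diff by blast
  moreover have "(x - z) - (x - y) \<in> ocompl M"
    using assms cvec.subspace_diff[OF csubspace_ocompl] by blast
  ultimately have "cinner (y - z) (y - z) = 0" by (simp add: ocompl_def)
  then show ?thesis by simp
qed

lemma proj_op_eqI:
  assumes "csubspace M" "y \<in> M" "x - y \<in> ocompl M"
  shows "proj_op M x = y"
  unfolding proj_op_def
  by (rule the_equality) (use assms projection_unique in \<open>auto simp: ocompl_def\<close>)

lemma proj_op:
  assumes "closed_csubspace M"
  shows "proj_op M x \<in> M" "x - proj_op M x \<in> ocompl M"
  using projection_exists[OF assms, of x] proj_op_eqI[of M _ x] assms
  by (metis csubspace_closed_csubspace)+

text \<open>Inside \<open>M\<close> the kernel \<open>Z\<close> of \<open>f\<close> has a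
  one-dimensional complement, spanned by \<open>u\<close>; the multiple of \<open>u\<close> that
  represents \<open>f\<close> is fixed by the value \<open>f u\<close>.\<close>

theorem riesz:
  fixes f :: "'a::complex_hilbert \<Rightarrow> complex"
  assumes M: "closed_csubspace M"
    and add: "\<And>x y. x \<in> M \<Longrightarrow> y \<in> M \<Longrightarrow> f (x + y) = f x + f y"
    and scale: "\<And>c x. x \<in> M \<Longrightarrow> f (c *\<^sub>C x) = c * f x"
    and bound: "\<And>x. x \<in> M \<Longrightarrow> cmod (f x) \<le> b * norm x"
  obtains z where "z \<in> M" "\<And>x. x \<in> M \<Longrightarrow> f x = cinner x z"
proof (cases "\<forall>x\<in>M. f x = 0")
  case True
  then show ?thesis
    using that[of 0] cvec.subspace_0[OF csubspace_closed_csubspace[OF M]]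
    by (simp add: cinner.zero_right)
next
  case False
  then obtain v where v: "v \<in> M" "f v \<noteq> 0" by blast
  have sM: "csubspace M" and cM: "closed M" using M by (auto simp: closed_csubspace_def)
  have fdiff: "f (x - y) = f x - f y" if "x \<in> M" "y \<in> M" for x y
    using add[of "x - y" y] cvec.subspace_diff[OF sM that] that by simp
  define Z where "Z = {x\<in>M. f x = 0}"
  have "csubspace Z"
    using sM scale[of 0 0] by (auto simp: Z_def add scale cvec.subspace_def)
  moreover have "closed Z"
  proof (unfold closed_sequential_limits, intro allI impI, elim conjE)
    fix u l assume u: "\<forall>n. u n \<in> Z" "u \<longlonglongrightarrow> l"
    have lM: "l \<in> M" using closed_sequentially[OF cM _ u(2)] u(1) by (auto simp: Z_def)
    have "(\<lambda>n. b * norm (l - u n)) \<longlonglongrightarrow> b * norm (l - l)" by (intro tendsto_intros u)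
    moreover have "cmod (f l) \<le> b * norm (l - u n)" for n
      using bound[of "l - u n"] fdiff[of l "u n"] u lM cvec.subspace_diff[OF sM] by (auto simp: Z_def)
    ultimately have "cmod (f l) \<le> b * norm (l - l)" by (meson LIMSEQ_le_const)
    then show "l \<in> Z" using lM by (simp add: Z_def)
  qed
  ultimately have Z: "closed_csubspace Z" by (simp add: closed_csubspace_def)
  obtain p where p: "p \<in> Z" "v - p \<in> ocompl Z" using projection_exists[OF Z] by blast
  define u where "u = v - p"
  have uM: "u \<in> M" using p v sM by (auto simp: u_def Z_def intro: cvec.subspace_diff)
  have fu: "f u = f v" using p v fdiff by (auto simp: u_def Z_def)
  have "f u \<noteq> 0" using fu v by simp
  then have "u \<noteq> 0" using scale[of 0 0] cvec.subspace_0[OF sM] by auto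
  then have nu: "cinner u u \<noteq> 0" by simp
  show ?thesis
  proof (rule that[of "cnj (f u / cinner u u) *\<^sub>C u"])
    show "cnj (f u / cinner u u) *\<^sub>C u \<in> M" using uM sM cvec.subspace_scale by blast
    fix x assume x: "x \<in> M"
    have "x - (f x / f u) *\<^sub>C u \<in> Z"
      using x uM sM \<open>f u \<noteq> 0\<close> by (simp add: Z_def fdiff scale cvec.subspace_scale cvec.subspace_diff)
    then have "cinner u (x - (f x / f u) *\<^sub>C u) = 0" using p by (simp add: ocompl_def u_def)
    then have "cinner (x - (f x / f u) *\<^sub>C u) u = 0" using cinner_eq_0_commute by blast
    then have "cinner x u = f x / f u * cinner u u"
      by (simp add: cinner.diff_left cinner_scaleC_left)
    then show "f x = cinner x (cnj (f u / cinner u u) *\<^sub>C u)"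
      using nu \<open>f u \<noteq> 0\<close> by (simp add: cinner_scaleC_right)
  qed
qed

section \<open>Bounded operators on a subspace\<close>

lemma bounded_op_mem: "bounded_op M N T \<Longrightarrow> x \<in> M \<Longrightarrow> T x \<in> N"
  by (simp add: bounded_op_def)

lemma bounded_op_add: "bounded_op M N T \<Longrightarrow> x \<in> M \<Longrightarrow> y \<in> M \<Longrightarrow> T (x + y) = T x + T y"
  by (simp add: bounded_op_def)

lemma bounded_op_scaleC: "bounded_op M N T \<Longrightarrow> x \<in> M \<Longrightarrow> T (c *\<^sub>C x) = c *\<^sub>C T x"
  by (simp add: bounded_op_def)

lemma bounded_op_scaleR: "bounded_op M N T \<Longrightarrow> x \<in> M \<Longrightarrow> T (r *\<^sub>R x) = r *\<^sub>R T x"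
  by (metis bounded_op_scaleC scaleC_of_real)

lemma bounded_op_zero: "bounded_op M N T \<Longrightarrow> csubspace M \<Longrightarrow> T 0 = 0"
  using bounded_op_scaleC[of M N T 0 0] cvec.subspace_0[of M] by simp

lemma bounded_op_diff:
  "bounded_op M N T \<Longrightarrow> csubspace M \<Longrightarrow> x \<in> M \<Longrightarrow> y \<in> M \<Longrightarrow> T (x - y) = T x - T y"
  using bounded_op_add[of M N T "x - y" y] cvec.subspace_diff[of M x y] by simp

lemma bounded_op_sum:
  assumes "bounded_op M N T" "csubspace M" "\<And>i. i \<in> I \<Longrightarrow> x i \<in> M"
  shows "T (\<Sum>i\<in>I. x i) = (\<Sum>i\<in>I. T (x i))"
  using assms(3)
  by (induction I rule: infinite_finite_induct)
    (use assms in \<open>simp_all add: bounded_op_zero bounded_op_add cvec.subspace_sum\<close>)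

lemma bounded_op_bound:
  assumes "bounded_op M N T"
  obtains b where "b > 0" "\<And>x. x \<in> M \<Longrightarrow> norm (T x) \<le> b * norm x"
proof -
  obtain b where b: "\<forall>x\<in>M. norm (T x) \<le> b * norm x" using assms by (auto simp: bounded_op_def)
  show ?thesis
  proof (rule that)
    show "norm (T x) \<le> (\<bar>b\<bar> + 1) * norm x" if "x \<in> M" for x
      using b that by (smt (verit) mult_right_mono norm_ge_zero)
  qed simp
qed

lemma bounded_op_subset: "bounded_op M N T \<Longrightarrow> M' \<subseteq> M \<Longrightarrow> bounded_op M' UNIV T"
  unfolding bounded_op_def by blast

lemma LIMSEQ_norm_comparison:
  assumes "\<And>n. norm (f n - l) \<le> g n" and "g \<longlonglongrightarrow> 0"
  shows "f \<longlonglongrightarrow> (l :: 'a::real_normed_vector)"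
proof -
  have "\<forall>\<^sub>F n in sequentially. norm (f n - l) \<le> g n" using assms(1) by simp
  from Lim_null_comparison[OF this assms(2)] show ?thesis by (simp add: LIM_zero_iff)
qed

lemma bounded_op_tendsto:
  assumes T: "bounded_op M N T" and M: "csubspace M" and "\<And>n. f n \<in> M" "x \<in> M" "f \<longlonglongrightarrow> x"
  shows "(\<lambda>n. T (f n)) \<longlonglongrightarrow> T x"
proof -
  obtain b where b: "\<And>x. x \<in> M \<Longrightarrow> norm (T x) \<le> b * norm x" using bounded_op_bound[OF T] by blast
  have "(\<lambda>n. b * norm (f n - x)) \<longlonglongrightarrow> b * norm (x - x)" by (intro tendsto_intros assms)
  then have 1: "(\<lambda>n. b * norm (f n - x)) \<longlonglongrightarrow> 0" by simp
  have 2: "norm (T (f n) - T x) \<le> b * norm (f n - x)" for n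
    using b[of "f n - x"] bounded_op_diff[OF T M] assms cvec.subspace_diff[OF M] by metis
  show ?thesis by (rule LIMSEQ_norm_comparison[OF 2 1])
qed

section \<open>Adjoints relative to a closed subspace\<close>

lemma adjoint_op_eqI:
  assumes "csubspace M" "z \<in> M" "\<And>x. x \<in> M \<Longrightarrow> cinner (T x) y = cinner x z"
  shows "adjoint_op M T y = z"
  unfolding adjoint_op_def
proof (rule the_equality)
  fix u assume u: "u \<in> M \<and> (\<forall>x\<in>M. cinner (T x) y = cinner x u)"
  then have "u - z \<in> M" using assms cvec.subspace_diff by blast
  then have "cinner (u - z) (u - z) = 0" using u assms(3) by (metis cinner.diff_right right_minus_eq)
  then show "u = z" by simp
qed (use assms in auto)

lemma adjoint_op:
  assumes M: "closed_csubspace M" and T: "bounded_op M N T"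
  shows "adjoint_op M T y \<in> M" "x \<in> M \<Longrightarrow> cinner (T x) y = cinner x (adjoint_op M T y)"
proof -
  obtain b where b: "\<And>x. x \<in> M \<Longrightarrow> norm (T x) \<le> b * norm x" using bounded_op_bound[OF T] by blast
  have bd: "cmod (cinner (T x) y) \<le> (b * norm y) * norm x" if "x \<in> M" for x
    using cauchy_schwarz[of "T x" y] mult_right_mono[OF b[OF that], of "norm y"]
    by (simp add: algebra_simps)
  obtain z where z: "z \<in> M" "\<And>x. x \<in> M \<Longrightarrow> cinner (T x) y = cinner x z"
    using riesz[OF M _ _ bd]
    by (auto simp: bounded_op_add[OF T] bounded_op_scaleC[OF T] cinner_add_left cinner_scaleC_left)
  have "adjoint_op M T y = z" by (rule adjoint_op_eqI[OF csubspace_closed_csubspace[OF M] z])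
  then show "adjoint_op M T y \<in> M" "x \<in> M \<Longrightarrow> cinner (T x) y = cinner x (adjoint_op M T y)"
    using z by simp_all
qed

section \<open>Positive operators\<close>

lemma positive_op_bounded: "positive_op M A \<Longrightarrow> bounded_op M M A"
  by (simp add: positive_op_def)

lemma positive_op_nonneg: "positive_op M A \<Longrightarrow> x \<in> M \<Longrightarrow> 0 \<le> Re (cinner (A x) x)"
  by (auto simp: positive_op_def complex_nonneg_Reals_iff)

text \<open>Polarization: over the complex numbers a real quadratic form comes from a symmetric operator.\<close>

lemma positive_op_symmetric:
  assumes A: "positive_op M A" and M: "csubspace M" and x: "x \<in> M" and y: "y \<in> M"
  shows "cinner (A x) y = cinner x (A y)"
proof -
  note B = positive_op_bounded[OF A]
  have real: "Im (cinner (A u) u) = 0" if "u \<in> M" for u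
    using A that by (auto simp: positive_op_def complex_nonneg_Reals_iff)
  have "Im (cinner (A (x + y)) (x + y)) = 0" using real M x y cvec.subspace_add by blast
  then have 1: "Im (cinner (A x) y) + Im (cinner (A y) x) = 0"
    using real[OF x] real[OF y] x y
    by (simp add: bounded_op_add[OF B] cinner_add_left cinner_add_right)
  have iy: "\<i> *\<^sub>C y \<in> M" using M y cvec.subspace_scale by blast
  have "Im (cinner (A (x + \<i> *\<^sub>C y)) (x + \<i> *\<^sub>C y)) = 0"
    using real M x iy cvec.subspace_add by blast
  then have 2: "Re (cinner (A y) x) - Re (cinner (A x) y) = 0"
    using real[OF x] real[OF y] x y iy
    by (simp add: bounded_op_add[OF B] bounded_op_scaleC[OF B] cinner_add_left cinner_add_right
        cinner_scaleC_left cinner_scaleC_right)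
  have "cinner x (A y) = cnj (cinner (A y) x)" by (rule cinner_commute)
  with 1 2 show ?thesis by (simp add: complex_eq_iff)
qed

lemma positive_opI:
  assumes "bounded_op M M A" "\<And>x y. x \<in> M \<Longrightarrow> y \<in> M \<Longrightarrow> cinner (A x) y = cinner x (A y)"
    "\<And>x. x \<in> M \<Longrightarrow> 0 \<le> Re (cinner (A x) x)"
  shows "positive_op M A"
  unfolding positive_op_def
proof (intro conjI ballI assms(1))
  fix x assume x: "x \<in> M"
  have "cinner (A x) x = cnj (cinner (A x) x)" using assms(2)[OF x x] cinner_commute by metis
  then have "Im (cinner (A x) x) = 0" by (simp add: complex_eq_iff)
  then show "cinner (A x) x \<in> \<real>\<^sub>\<ge>\<^sub>0" using assms(3)[OF x] by (simp add: complex_nonneg_Reals_iff)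
qed

lemma bounded_op_UNIV_mem: "bounded_op M N T \<Longrightarrow> bounded_op M UNIV T"
  by (simp add: bounded_op_def)

text \<open>Evaluate the positive form at \<open>x - (1 / c) *\<^sub>R A x\<close> and bound its
  last term, the form at \<open>A x\<close>, by \<open>c * (norm (A x))\<^sup>2\<close>. This is the
  operator inequality A^2 <= c A, in a version available before square roots are
  constructed.\<close>

lemma positive_op_norm_sq_le:
  assumes A: "positive_op M A" and M: "csubspace M" and x: "x \<in> M"
    and c: "c > 0" "\<And>x. x \<in> M \<Longrightarrow> norm (A x) \<le> c * norm x"
  shows "(norm (A x))\<^sup>2 \<le> c * Re (cinner (A x) x)"
proof -
  note B = positive_op_bounded[OF A]
  have Ax: "A x \<in> M" using bounded_op_mem[OF B x] .
  then have tAx: "(1 / c) *\<^sub>R A x \<in> M" using M csubspace_scaleR by blast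
  define y where "y = x - (1 / c) *\<^sub>R A x"
  have Ay: "A y = A x - (1 / c) *\<^sub>R A (A x)"
    unfolding y_def using bounded_op_diff[OF B M x tAx] bounded_op_scaleR[OF B Ax] by simp
  have sym: "cinner (A (A x)) x = cinner (A x) (A x)"
    using positive_op_symmetric[OF A M Ax x] .
  have "y \<in> M" unfolding y_def using x tAx M cvec.subspace_diff by blast
  then have "0 \<le> Re (cinner (A y) y)" by (rule positive_op_nonneg[OF A])
  also have "\<dots> = Re (cinner (A x) x) - 2 / c * (norm (A x))\<^sup>2 + Re (cinner (A (A x)) (A x)) / c\<^sup>2"
    unfolding Ay unfolding y_def
    by (simp add: cinner.diff_left cinner.diff_right cinner_scaleR_left cinner_scaleR_right sym
        Re_cinner_self power2_eq_square diff_divide_distrib)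
  also have "\<dots> \<le> Re (cinner (A x) x) - 2 / c * (norm (A x))\<^sup>2 + c * (norm (A x))\<^sup>2 / c\<^sup>2"
  proof -
    have "Re (cinner (A (A x)) (A x)) \<le> norm (A (A x)) * norm (A x)" by (rule Re_cinner_le)
    also have "\<dots> \<le> c * norm (A x) * norm (A x)" using c(2)[OF Ax] by (intro mult_right_mono) auto
    finally have "Re (cinner (A (A x)) (A x)) / c\<^sup>2 \<le> c * (norm (A x))\<^sup>2 / c\<^sup>2"
      using c(1) by (intro divide_right_mono) (auto simp: power2_eq_square)
    then show ?thesis by simp
  qed
  also have "\<dots> = Re (cinner (A x) x) - (norm (A x))\<^sup>2 / c"
    using c(1) by (simp add: field_simps power2_eq_square)
  finally show ?thesis using c(1) by (simp add: field_simps)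
qed

lemma positive_op_kernel:
  assumes A: "positive_op M A" and M: "csubspace M" and x: "x \<in> M" and "Re (cinner (A x) x) = 0"
  shows "A x = 0"
proof -
  obtain b where "b > 0" "\<And>x. x \<in> M \<Longrightarrow> norm (A x) \<le> b * norm x"
    using bounded_op_bound[OF positive_op_bounded[OF A]] by blast
  from positive_op_norm_sq_le[OF A M x this] show ?thesis using assms(4) by simp
qed

lemma positive_op_adjoint_comp:
  assumes M: "closed_csubspace M" and T: "bounded_op M N T"
  shows "positive_op M (\<lambda>x. adjoint_op M T (T x))"
proof -
  note sM = csubspace_closed_csubspace[OF M]
  note adj = adjoint_op[OF M T]
  let ?B = "\<lambda>x. adjoint_op M T (T x)"
  have form: "cinner y (?B x) = cinner (T y) (T x)" if "y \<in> M" for x y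
    using adj(2)[OF that] by simp
  obtain b where b: "b > 0" "\<And>x. x \<in> M \<Longrightarrow> norm (T x) \<le> b * norm x"
    using bounded_op_bound[OF T] by blast
  \<comment> \<open>The square of the left side is the inner product of \<open>T (?B x)\<close> and
    \<open>T x\<close>, so one factor \<open>norm (?B x)\<close> cancels.\<close>
  have bd: "norm (?B x) \<le> b\<^sup>2 * norm x" if x: "x \<in> M" for x
  proof -
    have "(norm (?B x))\<^sup>2 = Re (cinner (T (?B x)) (T x))"
      using form[OF adj(1)] by (simp flip: Re_cinner_self)
    also have "\<dots> \<le> norm (T (?B x)) * norm (T x)" by (rule Re_cinner_le)
    also have "\<dots> \<le> (b * norm (?B x)) * (b * norm x)"
      using b x adj(1) by (intro mult_mono) auto
    finally have "norm (?B x) * norm (?B x) \<le> norm (?B x) * (b\<^sup>2 * norm x)"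
      by (simp add: power2_eq_square algebra_simps)
    then show ?thesis by (cases "norm (?B x) = 0") (auto simp: b(1) mult_le_cancel_left)
  qed
  have add: "?B (x + y) = ?B x + ?B y" if "x \<in> M" "y \<in> M" for x y
    by (rule adjoint_op_eqI[OF sM])
      (use that adj in \<open>simp_all add: cvec.subspace_add[OF sM] bounded_op_add[OF T] cinner_add_right\<close>)
  have scale: "?B (c *\<^sub>C x) = c *\<^sub>C ?B x" if "x \<in> M" for c x
    by (rule adjoint_op_eqI[OF sM])
      (use that adj in \<open>simp_all add: cvec.subspace_scale[OF sM] bounded_op_scaleC[OF T] cinner_scaleC_right\<close>)
  show ?thesis
  proof (rule positive_opI)
    show "bounded_op M M ?B" unfolding bounded_op_def using adj(1) add scale bd by blast
    show "cinner (?B x) y = cinner x (?B y)" if "x \<in> M" "y \<in> M" for x y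
      using form[OF that(1)] form[OF that(2)] cinner_commute by metis
    show "0 \<le> Re (cinner (?B x) x)" if "x \<in> M" for x
      using form[OF that, of x] Re_cinner_commute[of "?B x" x] by (simp add: Re_cinner_self)
  qed
qed

section \<open>The square root of a positive operator\<close>

text \<open>For \<open>0 \<le> A \<le> 1\<close> and \<open>X = 1 - A\<close> the iteration \<open>Y \<mapsto> (X + Y\<^sup>2) / 2\<close> starting in 0 converges to
  a fixed point \<open>Y\<close>, which means \<open>(1 - Y)\<^sup>2 = A\<close>. The scalar iteration with \<open>X = 1\<close> majorizes it.\<close>

primrec sqrt_iter :: "('a::complex_hilbert \<Rightarrow> 'a) \<Rightarrow> nat \<Rightarrow> 'a \<Rightarrow> 'a" where
  "sqrt_iter X 0 = (\<lambda>x. 0)"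
| "sqrt_iter X (Suc n) = (\<lambda>x. (1/2) *\<^sub>R (X x + sqrt_iter X n (sqrt_iter X n x)))"

primrec sqrt_iter_real :: "nat \<Rightarrow> real" where
  "sqrt_iter_real 0 = 0"
| "sqrt_iter_real (Suc n) = (1 + (sqrt_iter_real n)\<^sup>2) / 2"

lemma sqrt_iter_real_bounds: "0 \<le> sqrt_iter_real n" "sqrt_iter_real n \<le> 1"
proof (induction n)
  case (Suc n)
  have "(sqrt_iter_real n)\<^sup>2 \<le> 1" using Suc by (simp add: power_le_one)
  then show "sqrt_iter_real (Suc n) \<le> 1" by simp
qed simp_all

lemma sqrt_iter_real_mono: "sqrt_iter_real n \<le> sqrt_iter_real (Suc n)"
  using sum_squares_bound[of "sqrt_iter_real n" 1] by simp

text \<open>Each increment is dominated by that of the scalar iteration, which is increasing and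
  bounded by 1; hence the iterates are Cauchy at every vector of \<open>M\<close>. The last
  conclusion, commutation with whatever commutes with \<open>X\<close>, is what uniqueness of the
  root rests on.\<close>

lemma sqrt_iter_contraction_exists:
  fixes X :: "'a::complex_hilbert \<Rightarrow> 'a"
  assumes M: "closed_csubspace M" and X: "bounded_op M M X"
    and sym: "\<And>x y. x \<in> M \<Longrightarrow> y \<in> M \<Longrightarrow> cinner (X x) y = cinner x (X y)"
    and X1: "\<And>x. x \<in> M \<Longrightarrow> norm (X x) \<le> norm x"
  obtains Y where "bounded_op M M Y"
    "\<And>x y. x \<in> M \<Longrightarrow> y \<in> M \<Longrightarrow> cinner (Y x) y = cinner x (Y y)"
    "\<And>x. x \<in> M \<Longrightarrow> norm (Y x) \<le> norm x"
    "\<And>x. x \<in> M \<Longrightarrow> 2 *\<^sub>R Y x = X x + Y (Y x)"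
    "\<And>C x. bounded_op M M C \<Longrightarrow> (\<And>x. x \<in> M \<Longrightarrow> C (X x) = X (C x)) \<Longrightarrow> x \<in> M \<Longrightarrow> C (Y x) = Y (C x)"
proof -
  let ?Y = "sqrt_iter X" and ?y = sqrt_iter_real
  have sM: "csubspace M" and cM: "closed M" using M by (auto simp: closed_csubspace_def)
  have mem: "?Y n x \<in> M" if "x \<in> M" for n x
    using that by (induction n arbitrary: x)
      (auto intro!: csubspace_scaleR cvec.subspace_add cvec.subspace_0 sM bounded_op_mem[OF X])
  have add: "?Y n (x + y) = ?Y n x + ?Y n y" if "x \<in> M" "y \<in> M" for n x y
    using that by (induction n arbitrary: x y)
      (simp_all add: mem bounded_op_add[OF X] scaleR_add_right)
  have scale: "?Y n (c *\<^sub>C x) = c *\<^sub>C ?Y n x" if "x \<in> M" for n c x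
    using that by (induction n arbitrary: x)
      (simp_all add: mem bounded_op_scaleC[OF X] scaleC_add_right scaleC_scaleR)
  have diff: "?Y n (x - y) = ?Y n x - ?Y n y" if "x \<in> M" "y \<in> M" for n x y
    using add[of "x - y" y n] cvec.subspace_diff[OF sM] that by simp
  have Ysym: "cinner (?Y n x) y = cinner x (?Y n y)" if "x \<in> M" "y \<in> M" for n x y
    using that by (induction n arbitrary: x y)
      (simp_all add: mem sym cinner.zero_left cinner.zero_right cinner_scaleR_left cinner_scaleR_right
        cinner_add_left cinner_add_right)
  have bound: "norm (?Y n x) \<le> ?y n * norm x" if "x \<in> M" for n x
    using that
  proof (induction n arbitrary: x)
    case (Suc n)
    have "norm (?Y n (?Y n x)) \<le> ?y n * norm (?Y n x)" using Suc mem by blast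
    also have "\<dots> \<le> ?y n * (?y n * norm x)"
      using Suc sqrt_iter_real_bounds by (intro mult_left_mono) auto
    finally have "norm (X x + ?Y n (?Y n x)) \<le> norm x + ?y n * (?y n * norm x)"
      using X1[OF Suc.prems] norm_triangle_ineq[of "X x" "?Y n (?Y n x)"] by linarith
    then show ?case
      by (simp only: sqrt_iter.simps sqrt_iter_real.simps norm_scaleR)
        (simp add: power2_eq_square field_simps)
  qed simp
  note [simp del] = sqrt_iter.simps(2) sqrt_iter_real.simps(2)
  have step: "norm (?Y (Suc n) x - ?Y n x) \<le> (?y (Suc n) - ?y n) * norm x" if "x \<in> M" for n x
    using that
  proof (induction n arbitrary: x)
    case 0
    then show ?case using X1 by (simp add: sqrt_iter.simps sqrt_iter_real.simps)
  next
    case (Suc n)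
    let ?P = "?Y (Suc n)" and ?Q = "?Y n"
    have "?Y (Suc (Suc n)) x - ?P x = (1/2) *\<^sub>R (?P (?P x) - ?Q (?Q x))"
      by (simp add: sqrt_iter.simps(2)[of X "Suc n"] sqrt_iter.simps(2)[of X n] flip: scaleR_diff_right)
    \<comment> \<open>This splitting of a difference of squares keeps the order of the factors, and
      it matches (p - q) p + q (p - q) for the scalar sequence.\<close>
    also have "?P (?P x) - ?Q (?Q x) = (?P (?P x) - ?Q (?P x)) + ?Q (?P x - ?Q x)"
      by (simp add: diff[OF mem[OF Suc.prems] mem[OF Suc.prems]])
    finally have "2 * norm (?Y (Suc (Suc n)) x - ?P x)
        \<le> norm (?P (?P x) - ?Q (?P x)) + norm (?Q (?P x - ?Q x))"
      by (simp add: norm_triangle_ineq)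
    also have "norm (?P (?P x) - ?Q (?P x)) \<le> (?y (Suc n) - ?y n) * norm (?P x)"
      using Suc mem by blast
    also have "\<dots> \<le> (?y (Suc n) - ?y n) * (?y (Suc n) * norm x)"
      using sqrt_iter_real_mono[of n] bound[OF Suc.prems] by (intro mult_left_mono) auto
    also have "norm (?Q (?P x - ?Q x)) \<le> ?y n * norm (?P x - ?Q x)"
      using bound mem Suc.prems cvec.subspace_diff[OF sM] by blast
    also have "\<dots> \<le> ?y n * ((?y (Suc n) - ?y n) * norm x)"
      using Suc sqrt_iter_real_bounds by (intro mult_left_mono) auto
    also have "(?y (Suc n) - ?y n) * (?y (Suc n) * norm x) + ?y n * ((?y (Suc n) - ?y n) * norm x)
        = ((?y (Suc n))\<^sup>2 - (?y n)\<^sup>2) * norm x"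
      by (simp only: power2_eq_square) (simp only: algebra_simps)
    also have "\<dots> = 2 * ((?y (Suc (Suc n)) - ?y (Suc n)) * norm x)"
      by (simp add: sqrt_iter_real.simps(2)[of "Suc n"] sqrt_iter_real.simps(2)[of n] field_simps)
    finally show ?case by simp
  qed
  have "incseq ?y" using sqrt_iter_real_mono by (rule incseq_SucI)
  then have yC: "Cauchy ?y"
    using incseq_convergent[of ?y 1] sqrt_iter_real_bounds LIMSEQ_imp_Cauchy by metis
  have dist: "norm (?Y (n + k) x - ?Y n x) \<le> (?y (n + k) - ?y n) * norm x" if "x \<in> M" for n k x
  proof (induction k)
    case (Suc k)
    have "norm (?Y (n + Suc k) x - ?Y n x)
        \<le> norm (?Y (Suc (n + k)) x - ?Y (n + k) x) + norm (?Y (n + k) x - ?Y n x)"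
      using norm_triangle_ineq[of "?Y (Suc (n + k)) x - ?Y (n + k) x" "?Y (n + k) x - ?Y n x"] by simp
    then show ?case using step[OF that, of "n + k"] Suc by (simp add: algebra_simps)
  qed simp
  have YC: "Cauchy (\<lambda>n. ?Y n x)" if x: "x \<in> M" for x
  proof (rule metric_CauchyI)
    fix e :: real assume e: "e > 0"
    \<comment> \<open>The added 1 covers \<open>x = 0\<close>.\<close>
    have "e / (norm x + 1) > 0" using e by (simp add: add_nonneg_pos)
    then obtain N where N: "\<And>m n. m \<ge> N \<Longrightarrow> n \<ge> N \<Longrightarrow> dist (?y m) (?y n) < e / (norm x + 1)"
      using yC unfolding Cauchy_def by metis
    have le: "dist (?Y m x) (?Y n x) < e" if "n \<ge> N" "m \<ge> n" for m n
    proof -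
      obtain k where k: "m = n + k" using \<open>m \<ge> n\<close> le_Suc_ex by blast
      have "(?y m - ?y n) * norm x \<le> e / (norm x + 1) * norm x"
        using N[of m n] that by (intro mult_right_mono) (auto simp: dist_real_def)
      also have "\<dots> < e"
        using e by (simp add: pos_divide_less_eq add_nonneg_pos add_pos_nonneg distrib_left)
      finally show ?thesis using dist[OF x, of n k] by (simp add: dist_norm k)
    qed
    have "dist (?Y m x) (?Y n x) < e" if "m \<ge> N" "n \<ge> N" for m n
      using le[of n m] le[of m n] that by (cases "m \<ge> n") (auto simp: dist_commute)
    then show "\<exists>N. \<forall>m\<ge>N. \<forall>n\<ge>N. dist (?Y m x) (?Y n x) < e" by blast
  qed
  define Y where "Y = (\<lambda>x. lim (\<lambda>n. ?Y n x))"
  have lim: "(\<lambda>n. ?Y n x) \<longlonglongrightarrow> Y x" if "x \<in> M" for x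
    unfolding Y_def using YC[OF that] by (simp add: Cauchy_convergent_iff convergent_LIMSEQ_iff)
  have Ymem: "Y x \<in> M" if "x \<in> M" for x
    using closed_sequentially[OF cM _ lim[OF that]] mem that by blast
  have Yadd: "Y (x + y) = Y x + Y y" if "x \<in> M" "y \<in> M" for x y
  proof (rule LIMSEQ_unique)
    show "(\<lambda>n. ?Y n (x + y)) \<longlonglongrightarrow> Y (x + y)" using lim that cvec.subspace_add[OF sM] by blast
    show "(\<lambda>n. ?Y n (x + y)) \<longlonglongrightarrow> Y x + Y y"
      using add[OF that] by (simp add: tendsto_add lim that)
  qed
  have Yscale: "Y (c *\<^sub>C x) = c *\<^sub>C Y x" if "x \<in> M" for c x
  proof (rule LIMSEQ_unique)
    show "(\<lambda>n. ?Y n (c *\<^sub>C x)) \<longlonglongrightarrow> Y (c *\<^sub>C x)" using lim that cvec.subspace_scale[OF sM] by blast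
    show "(\<lambda>n. ?Y n (c *\<^sub>C x)) \<longlonglongrightarrow> c *\<^sub>C Y x"
      using scale[OF that] by (simp add: scaleC.tendsto lim that)
  qed
  have Y1: "norm (Y x) \<le> norm x" if "x \<in> M" for x
  proof (rule LIMSEQ_le_const2)
    show "(\<lambda>n. norm (?Y n x)) \<longlonglongrightarrow> norm (Y x)" using lim[OF that] by (rule tendsto_norm)
    have "norm (?Y n x) \<le> norm x" for n
      using bound[OF that, of n] mult_right_mono[OF sqrt_iter_real_bounds(2)[of n], of "norm x"] by simp
    then show "\<exists>N. \<forall>n\<ge>N. norm (?Y n x) \<le> norm x" by blast
  qed
  have Ybd: "bounded_op M M Y"
    unfolding bounded_op_def using Ymem Yadd Yscale Y1 by (auto intro!: exI[of _ 1])
  have YY: "(\<lambda>n. ?Y n (?Y n x)) \<longlonglongrightarrow> Y (Y x)" if x: "x \<in> M" for x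
  proof -
    \<comment> \<open>The outer \<open>?Y n\<close> is a contraction, so its argument may be
      replaced by the limit \<open>Y x\<close> before the outer limit is taken.\<close>
    have 1: "norm (?Y n (?Y n x) - ?Y n (Y x) - 0) \<le> norm (?Y n x - Y x)" for n
    proof -
      have "?Y n (?Y n x) - ?Y n (Y x) = ?Y n (?Y n x - Y x)"
        using diff mem Ymem x by metis
      also have "norm \<dots> \<le> ?y n * norm (?Y n x - Y x)"
        using bound mem Ymem x cvec.subspace_diff[OF sM] by blast
      also have "\<dots> \<le> norm (?Y n x - Y x)"
        using mult_right_mono[OF sqrt_iter_real_bounds(2)[of n]] by fastforce
      finally show ?thesis by simp
    qed
    have 2: "(\<lambda>n. norm (?Y n x - Y x)) \<longlonglongrightarrow> 0"
      using lim[OF x] by (simp add: LIM_zero_iff tendsto_norm_zero)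
    have "(\<lambda>n. ?Y n (?Y n x) - ?Y n (Y x)) \<longlonglongrightarrow> 0"
      by (rule LIMSEQ_norm_comparison[OF 1 2])
    from tendsto_add[OF this lim[OF Ymem[OF x]]] show ?thesis by simp
  qed
  show ?thesis
  proof (rule that[OF Ybd])
    show "cinner (Y x) y = cinner x (Y y)" if "x \<in> M" "y \<in> M" for x y
    proof (rule LIMSEQ_unique)
      show "(\<lambda>n. cinner (?Y n x) y) \<longlonglongrightarrow> cinner (Y x) y"
        by (intro cinner.tendsto lim tendsto_const that)
      show "(\<lambda>n. cinner (?Y n x) y) \<longlonglongrightarrow> cinner x (Y y)"
        unfolding Ysym[OF that] by (intro cinner.tendsto lim tendsto_const that)
    qed
    show "norm (Y x) \<le> norm x" if "x \<in> M" for x using Y1 that .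
    show "2 *\<^sub>R Y x = X x + Y (Y x)" if x: "x \<in> M" for x
    proof (rule LIMSEQ_unique)
      show "(\<lambda>n. 2 *\<^sub>R ?Y (Suc n) x) \<longlonglongrightarrow> 2 *\<^sub>R Y x"
        by (intro tendsto_intros LIMSEQ_Suc lim x)
      have "(\<lambda>n. X x + ?Y n (?Y n x)) \<longlonglongrightarrow> X x + Y (Y x)" by (intro tendsto_intros YY x)
      then show "(\<lambda>n. 2 *\<^sub>R ?Y (Suc n) x) \<longlonglongrightarrow> X x + Y (Y x)" by (simp add: sqrt_iter.simps(2))
    qed
    show "C (Y x) = Y (C x)"
      if C: "bounded_op M M C" and CX: "\<And>x. x \<in> M \<Longrightarrow> C (X x) = X (C x)" and x: "x \<in> M" for C x
    proof (rule LIMSEQ_unique)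
      have comm: "C (?Y n x) = ?Y n (C x)" if "x \<in> M" for n x
        using that by (induction n arbitrary: x)
          (simp_all add: sqrt_iter.simps(2) bounded_op_zero[OF C sM] bounded_op_scaleR[OF C] bounded_op_add[OF C] CX mem
            bounded_op_mem[OF X] bounded_op_mem[OF C] cvec.subspace_add[OF sM])
      show "(\<lambda>n. C (?Y n x)) \<longlonglongrightarrow> C (Y x)"
        by (rule bounded_op_tendsto[OF C sM]) (simp_all add: mem x Ymem lim)
      show "(\<lambda>n. C (?Y n x)) \<longlonglongrightarrow> Y (C x)"
        unfolding comm[OF x] using lim bounded_op_mem[OF C x] by blast
    qed
  qed
qed

lemma positive_sqrt_exists:
  fixes A :: "'a::complex_hilbert \<Rightarrow> 'a"
  assumes M: "closed_csubspace M" and A: "positive_op M A"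
  shows "\<exists>S. positive_op M S \<and> (\<forall>x\<in>M. S (S x) = A x) \<and>
    (\<forall>C. bounded_op M M C \<longrightarrow> (\<forall>x\<in>M. C (A x) = A (C x)) \<longrightarrow> (\<forall>x\<in>M. C (S x) = S (C x)))"
proof -
  note sM = csubspace_closed_csubspace[OF M] and bA = positive_op_bounded[OF A]
  obtain c where c: "c > 0" "\<And>x. x \<in> M \<Longrightarrow> norm (A x) \<le> c * norm x"
    using bounded_op_bound[OF bA] by blast
  \<comment> \<open>Dividing by the bound \<open>c\<close> brings \<open>A\<close> below the
    identity, and \<open>positive_op_norm_sq_le\<close> is exactly what makes the difference
    \<open>X\<close> a contraction.\<close>
  define X where "X = (\<lambda>x. x - (1 / c) *\<^sub>R A x)"
  have Xbd: "norm (X x) \<le> norm x" if x: "x \<in> M" for x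
  proof -
    have "(norm (X x))\<^sup>2 = (norm x)\<^sup>2 + (norm (A x))\<^sup>2 / c\<^sup>2 - 2 * Re (cinner (A x) x) / c"
      unfolding X_def norm_sq_diff
      by (simp add: cinner_scaleR_right power_mult_distrib power_divide Re_cinner_commute[of x])
    also have "(norm (A x))\<^sup>2 / c\<^sup>2 \<le> c * Re (cinner (A x) x) / c\<^sup>2"
      using positive_op_norm_sq_le[OF A sM x c] by (intro divide_right_mono) auto
    also have "c * Re (cinner (A x) x) / c\<^sup>2 = Re (cinner (A x) x) / c"
      using c(1) by (simp add: power2_eq_square)
    finally have "(norm (X x))\<^sup>2 \<le> (norm x)\<^sup>2 - Re (cinner (A x) x) / c" by simp
    also have "\<dots> \<le> (norm x)\<^sup>2" using positive_op_nonneg[OF A x] c(1) by simp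
    finally show ?thesis by (rule power2_le_imp_le) simp
  qed
  have X: "bounded_op M M X"
    unfolding bounded_op_def
  proof (intro conjI ballI allI)
    show "X x \<in> M" if "x \<in> M" for x
      unfolding X_def using that bounded_op_mem[OF bA that] sM
      by (intro cvec.subspace_diff csubspace_scaleR)
    show "X (x + y) = X x + X y" if "x \<in> M" "y \<in> M" for x y
      using that by (simp add: X_def bounded_op_add[OF bA] algebra_simps)
    show "X (r *\<^sub>C x) = r *\<^sub>C X x" if "x \<in> M" for r x
      using that by (simp add: X_def bounded_op_scaleC[OF bA] scaleC_diff_right scaleC_scaleR)
    show "\<exists>b. \<forall>x\<in>M. norm (X x) \<le> b * norm x" using Xbd by (auto intro!: exI[of _ 1])
  qed
  have Xsym: "cinner (X x) y = cinner x (X y)" if "x \<in> M" "y \<in> M" for x y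
    using positive_op_symmetric[OF A sM that]
    by (simp add: X_def cinner.diff_left cinner.diff_right cinner_scaleR_left cinner_scaleR_right)
  obtain Y where Y: "bounded_op M M Y"
    "\<And>x y. x \<in> M \<Longrightarrow> y \<in> M \<Longrightarrow> cinner (Y x) y = cinner x (Y y)"
    "\<And>x. x \<in> M \<Longrightarrow> norm (Y x) \<le> norm x"
    "\<And>x. x \<in> M \<Longrightarrow> 2 *\<^sub>R Y x = X x + Y (Y x)"
    and Ycomm: "\<And>C x. bounded_op M M C \<Longrightarrow> (\<And>x. x \<in> M \<Longrightarrow> C (X x) = X (C x)) \<Longrightarrow> x \<in> M \<Longrightarrow> C (Y x) = Y (C x)"
    using sqrt_iter_contraction_exists[OF M X Xsym Xbd] by blast
  \<comment> \<open>The fixed point equation 2 Y = X + Y^2 says (1 - Y)^2 = 1 - X = A / c, hence the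
    factor \<open>sqrt c\<close>.\<close>
  define S where "S = (\<lambda>x. sqrt c *\<^sub>R (x - Y x))"
  have Ym: "Y x \<in> M" if "x \<in> M" for x using bounded_op_mem[OF Y(1) that] .
  have Sm: "S x \<in> M" if "x \<in> M" for x
    unfolding S_def using that Ym sM by (intro cvec.subspace_diff csubspace_scaleR)
  have "positive_op M S"
  proof (rule positive_opI)
    show "cinner (S x) y = cinner x (S y)" if "x \<in> M" "y \<in> M" for x y
      using Y(2)[OF that]
      by (simp add: S_def cinner.diff_left cinner.diff_right cinner_scaleR_left cinner_scaleR_right)
    show "0 \<le> Re (cinner (S x) x)" if "x \<in> M" for x
    proof -
      have "Re (cinner (Y x) x) \<le> norm (Y x) * norm x" by (rule Re_cinner_le)
      also have "\<dots> \<le> norm x * norm x" using Y(3)[OF that] by (intro mult_right_mono) auto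
      finally show ?thesis
        using c(1) by (simp add: S_def cinner.diff_left cinner_scaleR_left Re_cinner_self power2_eq_square)
    qed
    show "bounded_op M M S"
      unfolding bounded_op_def
    proof (intro conjI ballI allI)
      show "S (x + y) = S x + S y" if "x \<in> M" "y \<in> M" for x y
        using that by (simp add: S_def bounded_op_add[OF Y(1)] algebra_simps)
      show "S (r *\<^sub>C x) = r *\<^sub>C S x" if "x \<in> M" for r x
        using that by (simp add: S_def bounded_op_scaleC[OF Y(1)] scaleC_diff_right scaleC_scaleR)
      have "norm (S x) \<le> (sqrt c * 2) * norm x" if "x \<in> M" for x
      proof -
        have "norm (x - Y x) \<le> 2 * norm x"
          using norm_triangle_ineq4[of x "Y x"] Y(3)[OF that] by simp
        then have "sqrt c * norm (x - Y x) \<le> sqrt c * (2 * norm x)"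
          using c(1) by (intro mult_left_mono) auto
        then show ?thesis using c(1) by (simp add: S_def)
      qed
      then show "\<exists>b. \<forall>x\<in>M. norm (S x) \<le> b * norm x" by blast
    qed (rule Sm)
  qed
  moreover have "S (S x) = A x" if x: "x \<in> M" for x
  proof -
    have d: "x - Y x \<in> M" using x Ym sM cvec.subspace_diff by blast
    have "S (S x) = (sqrt c * sqrt c) *\<^sub>R ((x - Y x) - Y (x - Y x))"
      unfolding S_def using bounded_op_scaleR[OF Y(1) d, of "sqrt c"]
      by (simp add: scaleR_diff_right)
    also have "(x - Y x) - Y (x - Y x) = x - 2 *\<^sub>R Y x + Y (Y x)"
      using bounded_op_diff[OF Y(1) sM x Ym[OF x]] by (simp add: scaleR_2)
    also have "\<dots> = x - X x" using Y(4)[OF x] by simp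
    also have "\<dots> = (1 / c) *\<^sub>R A x" by (simp add: X_def)
    finally show ?thesis using c(1) by simp
  qed
  moreover have "C (S x) = S (C x)"
    if C: "bounded_op M M C" and CA: "\<And>x. x \<in> M \<Longrightarrow> C (A x) = A (C x)" and x: "x \<in> M" for C x
  proof -
    have "C (X x) = X (C x)" if "x \<in> M" for x
      unfolding X_def using that CA bounded_op_mem[OF bA that] sM
      by (simp add: bounded_op_diff[OF C sM] bounded_op_scaleR[OF C] csubspace_scaleR)
    from Ycomm[OF C this x] show ?thesis
      unfolding S_def using x Ym sM
      by (simp add: bounded_op_diff[OF C sM] bounded_op_scaleR[OF C] cvec.subspace_diff)
  qed
  ultimately show ?thesis by (intro exI[of _ S] conjI) blast+
qed

text \<open>Any root \<open>D\<close> commutes with its square \<open>A\<close>, hence with the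
  constructed root \<open>S\<close>. So (D + S)(D - S) = 0, and at \<open>y = D x - S x\<close> two
  nonnegative forms sum to 0; then \<open>D y\<close> and \<open>S y\<close> vanish, and by symmetry
  \<open>y\<close> is orthogonal to itself.\<close>

lemma positive_sqrt_unique:
  assumes M: "closed_csubspace M" and A: "positive_op M A"
    and B: "positive_op M B" "\<And>x. x \<in> M \<Longrightarrow> B (B x) = A x"
    and C: "positive_op M C" "\<And>x. x \<in> M \<Longrightarrow> C (C x) = A x"
    and x: "x \<in> M"
  shows "B x = C x"
proof -
  note sM = csubspace_closed_csubspace[OF M]
  obtain S where S: "positive_op M S" "\<And>x. x \<in> M \<Longrightarrow> S (S x) = A x"
    "\<And>C x. bounded_op M M C \<Longrightarrow> (\<And>x. x \<in> M \<Longrightarrow> C (A x) = A (C x)) \<Longrightarrow> x \<in> M \<Longrightarrow> C (S x) = S (C x)"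
    using positive_sqrt_exists[OF M A] by (elim exE conjE) blast
  have "D x = S x" if D: "positive_op M D" "\<And>x. x \<in> M \<Longrightarrow> D (D x) = A x" for D
  proof -
    note bD = positive_op_bounded[OF D(1)] and bS = positive_op_bounded[OF S(1)]
    have m: "D u \<in> M" "S u \<in> M" if "u \<in> M" for u using bounded_op_mem bD bS that by blast+
    have "D (A u) = A (D u)" if "u \<in> M" for u using D(2) m that by metis
    then have comm: "D (S u) = S (D u)" if "u \<in> M" for u using S(3)[OF bD] that by blast
    define y where "y = D x - S x"
    have y: "y \<in> M" unfolding y_def using m x sM cvec.subspace_diff by blast
    have "D y + S y = D (D x) - S (S x)"
      unfolding y_def using m x comm[OF x] by (simp add: bounded_op_diff[OF bD sM] bounded_op_diff[OF bS sM])
    then have "D y + S y = 0" using D(2) S(2) x by simp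
    then have "Re (cinner (D y) y) + Re (cinner (S y) y) = 0"
      by (metis cinner_add_left cinner.zero_left plus_complex.sel(1) zero_complex.sel(1))
    then have "Re (cinner (D y) y) = 0" "Re (cinner (S y) y) = 0"
      using positive_op_nonneg[OF D(1) y] positive_op_nonneg[OF S(1) y] by linarith+
    then have "D y = 0" "S y = 0" using positive_op_kernel D(1) S(1) sM y by blast+
    have "cinner y y = cinner (D x) y - cinner (S x) y" by (simp add: y_def cinner.diff_left)
    also have "\<dots> = cinner x (D y) - cinner x (S y)"
      using positive_op_symmetric[OF D(1) sM x y] positive_op_symmetric[OF S(1) sM x y] by simp
    also have "\<dots> = 0" using \<open>D y = 0\<close> \<open>S y = 0\<close> by simp
    finally show ?thesis by (simp add: y_def)
  qed
  from this[OF B] this[OF C] show ?thesis by simp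
qed

lemma positive_op_cong:
  assumes "csubspace M" "\<And>x. x \<in> M \<Longrightarrow> A x = B x" "positive_op M A"
  shows "positive_op M B"
proof -
  note A = positive_op_bounded[OF assms(3)]
  have "bounded_op M M B"
    unfolding bounded_op_def
  proof (intro conjI ballI allI)
    show "B x \<in> M" if "x \<in> M" for x using bounded_op_mem[OF A that] assms(2)[OF that] by simp
    show "B (x + y) = B x + B y" if "x \<in> M" "y \<in> M" for x y
      using bounded_op_add[OF A that] that cvec.subspace_add[OF assms(1) that] by (simp flip: assms(2))
    show "B (c *\<^sub>C x) = c *\<^sub>C B x" if "x \<in> M" for c x
      using bounded_op_scaleC[OF A that] that cvec.subspace_scale[OF assms(1) that]
      by (simp flip: assms(2))
    show "\<exists>b. \<forall>x\<in>M. norm (B x) \<le> b * norm x"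
      using bounded_op_bound[OF A] assms(2) by metis
  qed
  moreover have "\<forall>x\<in>M. cinner (B x) x \<in> \<real>\<^sub>\<ge>\<^sub>0"
    using assms(2,3) unfolding positive_op_def by simp
  ultimately show ?thesis by (simp add: positive_op_def)
qed

lemma sqrt_op:
  assumes M: "closed_csubspace M" and A: "positive_op M A"
  shows "positive_op M (sqrt_op M A)" "x \<in> M \<Longrightarrow> sqrt_op M A (sqrt_op M A x) = A x"
proof -
  note sM = csubspace_closed_csubspace[OF M]
  let ?P = "\<lambda>B. B \<in> extensional M \<and> positive_op M B \<and> (\<forall>x\<in>M. B (B x) = A x)"
  obtain S where S: "positive_op M S" "\<And>x. x \<in> M \<Longrightarrow> S (S x) = A x"
    using positive_sqrt_exists[OF M A] by (elim exE conjE) simp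
  have Sm: "S u \<in> M" if "u \<in> M" for u using bounded_op_mem[OF positive_op_bounded[OF S(1)] that] .
  \<comment> \<open>Two roots agree only on \<open>M\<close>; cutting off outside makes the root
    unique as a function, as the definite description demands.\<close>
  have "positive_op M (restrict S M)" by (rule positive_op_cong[OF sM _ S(1)]) simp
  then have "?P (restrict S M)" using S(2) Sm by simp
  moreover have "B = restrict S M" if "?P B" for B
  proof
    fix x
    have "B x = S x" if "x \<in> M" using positive_sqrt_unique[OF M A _ _ S that] \<open>?P B\<close> by blast
    then show "B x = restrict S M x" using that by (auto simp: extensional_def)
  qed
  ultimately have "?P (sqrt_op M A)" unfolding sqrt_op_def by (rule theI)
  then show "positive_op M (sqrt_op M A)" "x \<in> M \<Longrightarrow> sqrt_op M A (sqrt_op M A x) = A x" by blast+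
qed

text \<open>Moving one factor of the modulus across the inner product produces its square, the
  adjoint times \<open>T\<close>. Later arguments know the modulus only through its positivity and
  these equalities.\<close>

lemma abs_op:
  assumes M: "closed_csubspace M" and T: "bounded_op M N T"
  shows positive_op_abs_op: "positive_op M (abs_op M T)"
    and cinner_abs_op: "x \<in> M \<Longrightarrow> y \<in> M \<Longrightarrow> cinner (abs_op M T x) (abs_op M T y) = cinner (T x) (T y)"
    and norm_abs_op: "x \<in> M \<Longrightarrow> norm (abs_op M T x) = norm (T x)"
proof -
  let ?B = "\<lambda>x. adjoint_op M T (T x)"
  note sM = csubspace_closed_csubspace[OF M]
  note B = positive_op_adjoint_comp[OF M T]
  show P: "positive_op M (abs_op M T)" unfolding abs_op_def by (rule sqrt_op[OF M B])
  have sq: "abs_op M T (abs_op M T y) = ?B y" if "y \<in> M" for y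
    unfolding abs_op_def by (rule sqrt_op(2)[OF M B that])
  show *: "cinner (abs_op M T x) (abs_op M T y) = cinner (T x) (T y)" if "x \<in> M" "y \<in> M" for x y
  proof -
    have "cinner (abs_op M T x) (abs_op M T y) = cinner x (abs_op M T (abs_op M T y))"
      using positive_op_symmetric[OF P sM] that bounded_op_mem[OF positive_op_bounded[OF P]] by blast
    then show ?thesis using sq[OF that(2)] adjoint_op(2)[OF M T that(1)] by simp
  qed
  show "norm (abs_op M T x) = norm (T x)" if "x \<in> M"
  proof -
    have "(norm (abs_op M T x))\<^sup>2 = (norm (T x))\<^sup>2"
      using *[OF that that] by (metis Re_cinner_self)
    then show ?thesis by simp
  qed
qed

section \<open>Orthonormal sequences and finite dimension\<close>

lemma ocompl_cspan: "ocompl (cspan S) = ocompl S"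
proof
  show "ocompl (cspan S) \<subseteq> ocompl S" using cvec.span_superset by (auto simp: ocompl_def)
  have "cspan S \<subseteq> closure (cspan S)" by (rule closure_subset)
  then show "ocompl S \<subseteq> ocompl (cspan S)" by (subst ocompl_closure_cspan[symmetric]) (auto simp: ocompl_def)
qed

lemma ocompl_antimono: "S \<subseteq> S' \<Longrightarrow> ocompl S' \<subseteq> ocompl S"
  by (auto simp: ocompl_def)

lemma corthonormal_norm: "corthonormal x J \<Longrightarrow> i \<in> J \<Longrightarrow> norm (x i) = 1"
  using Re_cinner_self[of "x i"] norm_ge_zero[of "x i"] by (auto simp: corthonormal_def power2_eq_1_iff)

lemma corthonormal_mono: "corthonormal x J \<Longrightarrow> I \<subseteq> J \<Longrightarrow> corthonormal x I"
  unfolding corthonormal_def by blast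

lemma corthonormal_ocompl: "corthonormal x {..<n} \<Longrightarrow> i \<le> j \<Longrightarrow> j < n \<Longrightarrow> x j \<in> ocompl (x ` {..<i})"
  by (auto simp: corthonormal_def ocompl_def)

lemma corthonormalI:
  assumes "\<And>j. j < n \<Longrightarrow> x j \<in> ocompl (x ` {..<j})" "\<And>j. j < n \<Longrightarrow> norm (x j) = 1"
  shows "corthonormal x {..<n}"
  unfolding corthonormal_def
proof (intro ballI)
  fix i j assume ij: "i \<in> {..<n}" "j \<in> {..<n}"
  consider "i = j" | "i < j" | "j < i" by linarith
  then show "cinner (x i) (x j) = (if i = j then 1 else 0)"
  proof cases
    case 1
    then show ?thesis using assms(2)[of j] ij by (simp add: cinner_self)
  next
    case 2
    then have "cinner (x j) (x i) = 0" using assms(1)[of j] ij by (auto simp: ocompl_def)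
    then show ?thesis using 2 cinner_eq_0_commute by auto
  next
    case 3
    then show ?thesis using assms(1)[of i] ij by (auto simp: ocompl_def)
  qed
qed

text \<open>For orthonormal vectors this is the orthogonal projection onto the span of the first
  \<open>n\<close>; the explicit sum makes linearity, and the action of operators with eigenvectors
  \<open>x i\<close>, a matter of computation.\<close>

definition oproj :: "(nat \<Rightarrow> 'a::complex_hilbert) \<Rightarrow> nat \<Rightarrow> 'a \<Rightarrow> 'a"
  where "oproj x n y = (\<Sum>i<n. cinner y (x i) *\<^sub>C x i)"

lemma oproj_in_cspan: "oproj x n y \<in> cspan (x ` {..<n})"
  unfolding oproj_def by (intro cvec.span_sum cvec.span_scale cvec.span_base) auto

lemma diff_oproj_ocompl:
  assumes "corthonormal x {..<n}"
  shows "y - oproj x n y \<in> ocompl (x ` {..<n})"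
proof -
  have "cinner (y - oproj x n y) (x i) = 0" if i: "i < n" for i
  proof -
    have "cinner (oproj x n y) (x i) = (\<Sum>j<n. if j = i then cinner y (x j) else 0)"
      unfolding oproj_def cinner.sum_left cinner_scaleC_left
      using assms i by (intro sum.cong) (auto simp: corthonormal_def)
    also have "\<dots> = cinner y (x i)" using i by simp
    finally show ?thesis by (simp add: cinner.diff_left)
  qed
  then show ?thesis by (auto simp: ocompl_def)
qed

lemma oproj_id:
  assumes "corthonormal x {..<n}" "y \<in> cspan (x ` {..<n})"
  shows "oproj x n y = y"
proof (rule projection_unique)
  show "y - oproj x n y \<in> ocompl (cspan (x ` {..<n}))"
    using diff_oproj_ocompl[OF assms(1)] by (simp add: ocompl_cspan)
  show "y - y \<in> ocompl (cspan (x ` {..<n}))" by (simp add: ocompl_def cinner.zero_left)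
qed (use assms oproj_in_cspan in auto)

lemma cinner_oproj:
  assumes "corthonormal x {..<n}" "u \<in> ocompl (x ` {..<n})"
  shows "cinner u (oproj x n v) = 0"
  using assms(2) oproj_in_cspan[of x n v] ocompl_cspan[of "x ` {..<n}"] by (auto simp: ocompl_def)

lemma oproj_ocompl: "u \<in> ocompl (x ` {..<n}) \<Longrightarrow> oproj x n u = 0"
  unfolding oproj_def by (intro sum.neutral) (auto simp: ocompl_def)

lemma oproj_add: "oproj x n (y + v) = oproj x n y + oproj x n v"
  by (simp add: oproj_def cinner_add_left scaleC_add_left sum.distrib)

lemma oproj_scaleC: "oproj x n (c *\<^sub>C y) = c *\<^sub>C oproj x n y"
  by (simp add: oproj_def cinner_scaleC_left cvec.scale_sum_right scaleC_scaleC)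

lemma oproj_pythagoras:
  assumes "corthonormal x {..<n}"
  shows "(norm y)\<^sup>2 = (norm (y - oproj x n y))\<^sup>2 + (norm (oproj x n y))\<^sup>2"
proof -
  have "cinner (y - oproj x n y) (oproj x n y) = 0"
    by (rule cinner_oproj[OF assms diff_oproj_ocompl[OF assms]])
  from pythagoras[OF this] show ?thesis by simp
qed

lemma norm_diff_oproj_le: "corthonormal x {..<n} \<Longrightarrow> norm (y - oproj x n y) \<le> norm y"
  by (rule power2_le_imp_le) (use oproj_pythagoras[of x n y] in simp_all)

lemma norm_oproj_le: "corthonormal x {..<n} \<Longrightarrow> norm (oproj x n y) \<le> norm y"
  by (rule power2_le_imp_le) (use oproj_pythagoras[of x n y] in simp_all)

lemma bounded_op_oproj:
  assumes "corthonormal x {..<n}"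
  shows "bounded_op UNIV UNIV (oproj x n)"
  unfolding bounded_op_def
  using norm_oproj_le[OF assms] by (auto simp: oproj_add oproj_scaleC intro: exI[of _ 1])

lemma proj_op_cspan:
  assumes "corthonormal x {..<n}"
  shows "proj_op (cspan (x ` {..<n})) y = oproj x n y"
  using diff_oproj_ocompl[OF assms] by (intro proj_op_eqI) (auto simp: oproj_in_cspan ocompl_cspan)

text \<open>A vector in the span of the earlier ones would equal its projection there, which is 0 by
  orthogonality, against norm 1.\<close>

lemma corthonormal_independent:
  "corthonormal x {..<n} \<Longrightarrow> \<not> cvec.dependent (x ` {..<n}) \<and> inj_on x {..<n}"
proof (induction n)
  case (Suc n)
  have o: "corthonormal x {..<n}" using Suc.prems corthonormal_mono by fastforce
  have "x n \<notin> cspan (x ` {..<n})"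
  proof
    assume "x n \<in> cspan (x ` {..<n})"
    then have "x n = oproj x n (x n)" using oproj_id[OF o] by metis
    also have "\<dots> = 0"
      unfolding oproj_def using Suc.prems by (intro sum.neutral) (auto simp: corthonormal_def)
    finally show False using corthonormal_norm[OF Suc.prems, of n] by simp
  qed
  then show ?case
    using Suc.IH[OF o] cvec.span_superset[of "x ` {..<n}"]
    by (auto simp: lessThan_Suc cvec.independent_insert)
qed (simp add: cvec.independent_empty)

lemma cdim_cspan_corthonormal: "corthonormal x {..<n} \<Longrightarrow> cdim (cspan (x ` {..<n})) = n"
  using corthonormal_independent[of x n]
  by (simp add: cvec.dim_eq_card_independent card_image)

section \<open>Finite-dimensional subspaces\<close>

lemma cfinite_dim_cspan: "finite B \<Longrightarrow> cfinite_dim (cspan B)"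
  unfolding cfinite_dim_def by blast

lemma cfinite_dim_subset: "cfinite_dim S \<Longrightarrow> S' \<subseteq> S \<Longrightarrow> cfinite_dim S'"
  unfolding cfinite_dim_def by blast

lemma independent_card_le_cdim:
  assumes S: "cfinite_dim S" and B: "\<not> cvec.dependent B" "B \<subseteq> S"
  shows "finite B \<and> card B \<le> cdim S"
proof -
  obtain D where D: "D \<subseteq> S" "\<not> cvec.dependent D" "S \<subseteq> cspan D" "card D = cdim S"
    using cvec.basis_exists by blast
  obtain F where F: "finite F" "S \<subseteq> cspan F" using S by (auto simp: cfinite_dim_def)
  have "finite D" using cvec.independent_span_bound[OF F(1) D(2)] D(1) F(2) by blast
  from cvec.independent_span_bound[OF this B(1)] show ?thesis using B D by auto
qed

lemma corthonormal_le_cdim: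
  assumes "cfinite_dim S" "corthonormal x {..<n}" "x ` {..<n} \<subseteq> S"
  shows "n \<le> cdim S"
  using independent_card_le_cdim[OF assms(1), of "x ` {..<n}"] corthonormal_independent[OF assms(2)] assms(3)
  by (simp add: card_image)

lemma subset_cspan_corthonormal:
  assumes M: "csubspace M" and x: "corthonormal x {..<n}" "x ` {..<n} \<subseteq> M"
    and "M \<inter> ocompl (x ` {..<n}) = {0}"
  shows "M = cspan (x ` {..<n})"
proof
  show sub: "cspan (x ` {..<n}) \<subseteq> M" using x(2) M by (rule cvec.span_minimal)
  show "M \<subseteq> cspan (x ` {..<n})"
  proof
    fix y assume y: "y \<in> M"
    have "y - oproj x n y \<in> M" using y sub oproj_in_cspan M cvec.subspace_diff by blast
    then have "y - oproj x n y = 0" using diff_oproj_ocompl[OF x(1)] assms(4) by blast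
    then show "y \<in> cspan (x ` {..<n})" using oproj_in_cspan[of x n y] by simp
  qed
qed

text \<open>\<open>P S y\<close> is the selection rule for the next vector \<open>y\<close> after
  the set \<open>S\<close> of earlier ones. The conclusion is conditional on a nontrivial
  complement, so that the same lemma serves finite-dimensional \<open>M\<close>, where the choice
  must stop.\<close>

lemma greedy_sequence:
  fixes M :: "'a::complex_hilbert set"
  assumes "\<And>S. finite S \<Longrightarrow> M \<inter> ocompl S \<noteq> {0} \<Longrightarrow> \<exists>y\<in>M \<inter> ocompl S. norm y = 1 \<and> P S y"
  obtains x :: "nat \<Rightarrow> 'a" where
    "\<And>n. M \<inter> ocompl (x ` {..<n}) \<noteq> {0} \<Longrightarrow>
      corthonormal x {..<Suc n} \<and> x ` {..<Suc n} \<subseteq> M \<and> P (x ` {..<n}) (x n)"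
proof -
  let ?Q = "\<lambda>S y. y \<in> M \<inter> ocompl S \<and> norm y = 1 \<and> P S y"
  have "\<exists>x::nat \<Rightarrow> 'a. \<forall>n. M \<inter> ocompl (x ` {..<n}) \<noteq> {0} \<longrightarrow> ?Q (x ` {..<n}) (x n)"
  proof (rule dependent_wellorder_choice[where
        P = "\<lambda>f (n::nat) r. M \<inter> ocompl (f ` {..<n}) \<noteq> {0} \<longrightarrow> ?Q (f ` {..<n}) r"])
    show "(M \<inter> ocompl (f ` {..<n}) \<noteq> {0} \<longrightarrow> ?Q (f ` {..<n}) r)
        = (M \<inter> ocompl (g ` {..<n}) \<noteq> {0} \<longrightarrow> ?Q (g ` {..<n}) r)"
      if "\<And>y. y < n \<Longrightarrow> f y = g y" for f g :: "nat \<Rightarrow> 'a" and n r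
    proof -
      have "f ` {..<n} = g ` {..<n}" using that by (intro image_cong) auto
      then show ?thesis by simp
    qed
    show "\<exists>r. M \<inter> ocompl (f ` {..<n}) \<noteq> {0} \<longrightarrow> ?Q (f ` {..<n}) r" for f :: "nat \<Rightarrow> 'a" and n
      using assms[of "f ` {..<n}"] by (cases "M \<inter> ocompl (f ` {..<n}) = {0}") auto
  qed
  then obtain x :: "nat \<Rightarrow> 'a"
    where "\<forall>n. M \<inter> ocompl (x ` {..<n}) \<noteq> {0} \<longrightarrow> ?Q (x ` {..<n}) (x n)" ..
  then have x: "M \<inter> ocompl (x ` {..<n}) \<noteq> {0} \<Longrightarrow> ?Q (x ` {..<n}) (x n)" for n by simp
  show ?thesis
  proof (rule that)
    fix n assume n: "M \<inter> ocompl (x ` {..<n}) \<noteq> {0}"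
    \<comment> \<open>Complements shrink along the sequence, so nontriviality at stage
      \<open>n\<close> certifies every earlier choice.\<close>
    have Q: "?Q (x ` {..<j}) (x j)" if "j < Suc n" for j
    proof (rule x)
      have "ocompl (x ` {..<n}) \<subseteq> ocompl (x ` {..<j})" using that by (intro ocompl_antimono) auto
      moreover have "0 \<in> ocompl (x ` {..<n})" by (simp add: ocompl_def cinner.zero_left)
      ultimately show "M \<inter> ocompl (x ` {..<j}) \<noteq> {0}" using n by blast
    qed
    then show "corthonormal x {..<Suc n} \<and> x ` {..<Suc n} \<subseteq> M \<and> P (x ` {..<n}) (x n)"
      by (intro conjI corthonormalI) auto
  qed
qed

lemma csubspace_Int_ocompl: "csubspace M \<Longrightarrow> csubspace (M \<inter> ocompl S)"
  by (intro cvec.subspace_inter csubspace_ocompl)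

lemma corthonormal_basis_exists:
  assumes M: "csubspace M" and fin: "cfinite_dim M"
  obtains x n where "corthonormal x {..<n}" "M = cspan (x ` {..<n})"
proof -
  obtain x :: "nat \<Rightarrow> 'a" where x: "\<And>n. M \<inter> ocompl (x ` {..<n}) \<noteq> {0} \<Longrightarrow>
      corthonormal x {..<Suc n} \<and> x ` {..<Suc n} \<subseteq> M \<and> True"
    using greedy_sequence[of M "\<lambda>S y. True"] csubspace_sgn[OF csubspace_Int_ocompl[OF M]] by metis
  have ex: "\<exists>n. M \<inter> ocompl (x ` {..<n}) = {0}"
  proof (rule ccontr)
    assume "\<nexists>n. M \<inter> ocompl (x ` {..<n}) = {0}"
    then have "corthonormal x {..<Suc (cdim M)}" "x ` {..<Suc (cdim M)} \<subseteq> M" using x by blast+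
    from corthonormal_le_cdim[OF fin this] show False by simp
  qed
  \<comment> \<open>The greedy choice stops here; by minimality of \<open>n\<close> all vectors
    before it are genuine choices.\<close>
  define n where "n = (LEAST n. M \<inter> ocompl (x ` {..<n}) = {0})"
  have n: "M \<inter> ocompl (x ` {..<n}) = {0}" "j < n \<Longrightarrow> M \<inter> ocompl (x ` {..<j}) \<noteq> {0}" for j
    subgoal unfolding n_def by (rule LeastI_ex[OF ex])
    subgoal unfolding n_def by (drule not_less_Least)
    done
  have "corthonormal x {..<n} \<and> x ` {..<n} \<subseteq> M"
    using x[of "n - 1"] n(2)[of "n - 1"] by (cases n) (auto simp: corthonormal_def)
  then show ?thesis using that subset_cspan_corthonormal[OF M] n(1) by blast
qed

text \<open>Coordinates in an orthonormal family are bounded by the norm, and a box of coordinates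
  is enclosed step by step by continuous images of products with a disc. An enclosing compact set
  suffices for extracting subsequences and finite nets.\<close>

lemma compact_cspan_bounded:
  fixes x :: "nat \<Rightarrow> 'a::complex_hilbert"
  assumes x: "corthonormal x {..<n}"
  shows "\<exists>C. compact C \<and> {y \<in> cspan (x ` {..<n}). norm y \<le> r} \<subseteq> C"
proof -
  have box: "\<exists>C. compact C \<and> {\<Sum>i<n. c i *\<^sub>C x i | c. \<forall>i<n. cmod (c i) \<le> r} \<subseteq> C" for n
  proof (induction n)
    case 0
    show ?case by (rule exI[of _ "{0}"]) auto
  next
    case (Suc n)
    then obtain C where C: "compact C" "{\<Sum>i<n. c i *\<^sub>C x i | c. \<forall>i<n. cmod (c i) \<le> r} \<subseteq> C"
      by (elim exE conjE)
    let ?f = "\<lambda>p. fst p *\<^sub>C x n + snd p"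
    let ?D = "?f ` (cball 0 r \<times> C)"
    have "compact ?D"
      by (intro compact_continuous_image compact_Times compact_cball C(1) continuous_intros
          scaleC.continuous_on)
    moreover have "{\<Sum>i<Suc n. c i *\<^sub>C x i | c. \<forall>i<Suc n. cmod (c i) \<le> r} \<subseteq> ?D"
    proof clarify
      fix c :: "nat \<Rightarrow> complex" assume c: "\<forall>i<Suc n. cmod (c i) \<le> r"
      then have "\<forall>i<n. cmod (c i) \<le> r" by simp
      then have "(\<Sum>i<n. c i *\<^sub>C x i) \<in> C" by (intro subsetD[OF C(2)] CollectI exI[of _ c]) simp
      then have "(c n, \<Sum>i<n. c i *\<^sub>C x i) \<in> cball 0 r \<times> C" using c by (simp add: dist_norm)
      then show "(\<Sum>i<Suc n. c i *\<^sub>C x i) \<in> ?D" by (rule rev_image_eqI) simp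
    qed
    ultimately show ?case by (intro exI[of _ ?D] conjI)
  qed
  from box[of n] obtain C where C: "compact C" "{\<Sum>i<n. c i *\<^sub>C x i | c. \<forall>i<n. cmod (c i) \<le> r} \<subseteq> C"
    by (elim exE conjE)
  have "y \<in> C" if y: "y \<in> cspan (x ` {..<n})" "norm y \<le> r" for y
  proof -
    have "cmod (cinner y (x i)) \<le> r" if "i < n" for i
      using cauchy_schwarz[of y "x i"] corthonormal_norm[OF x, of i] that y(2) by simp
    moreover have "y = (\<Sum>i<n. cinner y (x i) *\<^sub>C x i)"
      using oproj_id[OF x y(1)] by (simp add: oproj_def)
    ultimately show ?thesis by (intro subsetD[OF C(2)] CollectI exI[of _ "\<lambda>i. cinner y (x i)"]) simp
  qed
  then show ?thesis using C(1) by (intro exI[of _ C]) auto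
qed

lemma cfinite_dim_convergent_subseq:
  fixes f :: "nat \<Rightarrow> 'a::complex_hilbert"
  assumes "csubspace S" "cfinite_dim S" "\<And>n. f n \<in> S" "\<And>n. norm (f n) \<le> r"
  obtains \<phi> l where "strict_mono (\<phi> :: nat \<Rightarrow> nat)" "(f \<circ> \<phi>) \<longlonglongrightarrow> l"
proof -
  obtain x n where x: "corthonormal x {..<n}" "S = cspan (x ` {..<n})"
    using corthonormal_basis_exists[OF assms(1,2)] by blast
  obtain C where "compact C" "{y \<in> S. norm y \<le> r} \<subseteq> C"
    using compact_cspan_bounded[OF x(1), of r] unfolding x(2) by (elim exE conjE)
  then have "seq_compact C" "\<forall>n. f n \<in> C" using assms by (auto simp: compact_eq_seq_compact_metric)
  then show ?thesis using that unfolding seq_compact_def by blast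
qed

section \<open>The top of the spectrum of a positive operator\<close>

text \<open>Surjectivity defines the inverse on all of \<open>M\<close>; the lower bound makes it
  single-valued and bounds it by 1 / d.\<close>

lemma not_in_spectrumI:
  assumes M: "csubspace M" and A: "bounded_op M M A" and d: "d > 0"
    and below: "\<And>x. x \<in> M \<Longrightarrow> d * norm x \<le> norm (A x - z *\<^sub>C x)"
    and surj: "\<And>y. y \<in> M \<Longrightarrow> \<exists>x\<in>M. A x - z *\<^sub>C x = y"
  shows "z \<notin> spectrum_op M A"
proof -
  let ?B = "\<lambda>x. A x - z *\<^sub>C x"
  obtain S where S: "\<And>y. y \<in> M \<Longrightarrow> S y \<in> M" "\<And>y. y \<in> M \<Longrightarrow> ?B (S y) = y" using surj by metis
  have Bm: "?B x \<in> M" if "x \<in> M" for x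
    using that bounded_op_mem[OF A that] M by (intro cvec.subspace_diff cvec.subspace_scale)
  have inj: "x = y" if "x \<in> M" "y \<in> M" "?B x = ?B y" for x y
  proof -
    have "?B (x - y) = 0"
      using that(3) unfolding bounded_op_diff[OF A M that(1,2)] scaleC_diff_right
      by (simp add: algebra_simps)
    then have "d * norm (x - y) \<le> 0" using below[of "x - y"] that M cvec.subspace_diff by fastforce
    then show ?thesis using d by (simp add: mult_le_0_iff)
  qed
  have "bounded_op M M S"
    unfolding bounded_op_def
  proof (intro conjI ballI allI)
    show "S (x + y) = S x + S y" if xy: "x \<in> M" "y \<in> M" for x y
    proof (rule inj)
      have "?B (S x + S y) = ?B (S x) + ?B (S y)"
        using S(1) xy by (simp add: bounded_op_add[OF A] scaleC_add_right)
      then show "?B (S (x + y)) = ?B (S x + S y)"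
        using S(2) xy cvec.subspace_add[OF M xy] by simp
    qed (use S(1) xy M cvec.subspace_add in blast)+
    show "S (c *\<^sub>C x) = c *\<^sub>C S x" if x: "x \<in> M" for c x
    proof (rule inj)
      have "?B (c *\<^sub>C S x) = c *\<^sub>C ?B (S x)"
        using S(1) x by (simp add: bounded_op_scaleC[OF A] scaleC_diff_right scaleC_scaleC mult.commute)
      then show "?B (S (c *\<^sub>C x)) = ?B (c *\<^sub>C S x)"
        using S(2) x cvec.subspace_scale[OF M x] by simp
    qed (use S(1) x M cvec.subspace_scale in blast)+
    have "norm (S y) \<le> (1 / d) * norm y" if "y \<in> M" for y
      using below[OF S(1)[OF that]] S(2)[OF that] d by (simp add: field_simps)
    then show "\<exists>b. \<forall>x\<in>M. norm (S x) \<le> b * norm x" by blast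
  qed (use S in blast)
  moreover have "S (?B x) = x" if "x \<in> M" for x
    using inj[OF S(1)[OF Bm] that] S(2) Bm that by blast
  ultimately show ?thesis using S(2) unfolding spectrum_op_def by blast
qed

text \<open>A bounded inverse with bound \<open>b\<close> would keep
  \<open>norm (A x - z *\<^sub>C x)\<close> at least 1 / b on unit vectors.\<close>

lemma in_spectrumI:
  assumes M: "csubspace M" and A: "bounded_op M M A"
    and approx: "\<And>d. d > 0 \<Longrightarrow> \<exists>x\<in>M. norm x = 1 \<and> norm (A x - z *\<^sub>C x) < d"
  shows "z \<in> spectrum_op M A"
proof (rule ccontr)
  assume "z \<notin> spectrum_op M A"
  then obtain S where S: "bounded_op M M S" "\<And>x. x \<in> M \<Longrightarrow> S (A x - z *\<^sub>C x) = x"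
    by (auto simp: spectrum_op_def)
  obtain b where b: "b > 0" "\<And>x. x \<in> M \<Longrightarrow> norm (S x) \<le> b * norm x" using bounded_op_bound[OF S(1)] by blast
  obtain x where x: "x \<in> M" "norm x = 1" "norm (A x - z *\<^sub>C x) < 1 / b" using approx[of "1 / b"] b by auto
  have "A x - z *\<^sub>C x \<in> M"
    using x(1) bounded_op_mem[OF A x(1)] M by (intro cvec.subspace_diff cvec.subspace_scale)
  from b(2)[OF this] have "1 \<le> b * norm (A x - z *\<^sub>C x)" using S(2) x by simp
  then show False using x(3) b(1) by (simp add: field_simps)
qed

text \<open>The equation is the fixed point problem of
  \<open>x \<mapsto> inverse z *\<^sub>C (A x - y)\<close>, a contraction with factor c /
  |z|.\<close>

lemma resolvent_surj:
  assumes M: "closed_csubspace M" and A: "bounded_op M M A"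
    and c: "0 \<le> c" "\<And>x. x \<in> M \<Longrightarrow> norm (A x) \<le> c * norm x" "c < cmod z" and y: "y \<in> M"
  shows "\<exists>x\<in>M. A x - z *\<^sub>C x = y"
proof -
  have sM: "csubspace M" and cM: "closed M" using M by (auto simp: closed_csubspace_def)
  have z: "z \<noteq> 0" using c by auto
  let ?f = "\<lambda>x. inverse z *\<^sub>C (A x - y)"
  have "\<exists>!x\<in>M. ?f x = x"
  proof (rule Banach_fix)
    show "complete M" using cM by (simp add: complete_eq_closed)
    show "M \<noteq> {}" using y by blast
    show "0 \<le> c / cmod z" "c / cmod z < 1" using c z by simp_all
    show "?f ` M \<subseteq> M"
      using bounded_op_mem[OF A] y sM by (auto intro!: cvec.subspace_scale cvec.subspace_diff)
    fix u v assume uv: "u \<in> M" "v \<in> M"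
    have "?f u - ?f v = inverse z *\<^sub>C A (u - v)"
      using bounded_op_diff[OF A sM uv] by (simp flip: scaleC_diff_right)
    then have "norm (?f u - ?f v) = norm (A (u - v)) / cmod z"
      by (simp add: norm_scaleC norm_inverse divide_inverse mult.commute)
    also have "\<dots> \<le> c * norm (u - v) / cmod z"
      using c(2) sM uv cvec.subspace_diff by (intro divide_right_mono) auto
    finally show "dist (?f u) (?f v) \<le> c / cmod z * dist u v" by (simp add: dist_norm)
  qed
  then obtain x where x: "x \<in> M" "?f x = x" by blast
  have "z *\<^sub>C x = z *\<^sub>C (?f x)" using x by simp
  also have "\<dots> = A x - y" using z by (simp add: scaleC_scaleC scaleC_one)
  finally show ?thesis using x(1) by (intro bexI[of _ x]) simp_all
qed

lemma resolvent_below: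
  fixes A :: "'a::complex_hilbert \<Rightarrow> 'a"
  assumes "norm (A x) \<le> c * norm x"
  shows "(cmod z - c) * norm x \<le> norm (A x - z *\<^sub>C x)"
  using norm_triangle_ineq2[of "z *\<^sub>C x" "A x"] assms
  by (simp add: norm_scaleC left_diff_distrib norm_minus_commute)

text \<open>The inequality |A x|^2 <= \<nu> <A x, x> turns near-maximizers of
  \<open>norm (A x)\<close> into approximate eigenvectors at \<nu>, while for |z| > \<nu> the
  resolvent exists.\<close>

lemma sup_spectrum_op_eq:
  assumes M: "closed_csubspace M" and A: "positive_op M A" and nu: "0 \<le> \<nu>"
    and le: "\<And>x. x \<in> M \<Longrightarrow> norm (A x) \<le> \<nu> * norm x"
    and approx: "\<And>e. e > 0 \<Longrightarrow> \<exists>x\<in>M. norm x = 1 \<and> \<nu> - e < norm (A x)"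
  shows "sup_spectrum_op M A = \<nu>" "complex_of_real \<nu> \<in> spectrum_op M A"
proof -
  note sM = csubspace_closed_csubspace[OF M] and bA = positive_op_bounded[OF A]
  show in_spec: "complex_of_real \<nu> \<in> spectrum_op M A"
  proof (rule in_spectrumI[OF sM bA])
    fix d :: real assume d: "d > 0"
    \<comment> \<open>With this \<open>e\<close> the squared defect is at most 2 \<nu> e, which is
      below \<open>d\<^sup>2\<close>; the added 1 covers \<nu> = 0.\<close>
    define e where "e = d\<^sup>2 / (2 * \<nu> + 1)"
    have e: "e > 0" using d nu by (simp add: e_def)
    obtain x where x: "x \<in> M" "norm x = 1" "\<nu> - e < norm (A x)" using approx[OF e] by blast
    have le1: "norm (A x) \<le> \<nu>" using le[OF x(1)] x(2) by simp
    have "(norm (A x))\<^sup>2 \<le> \<nu> * Re (cinner (A x) x)"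
    proof (cases "\<nu> = 0")
      case False
      then show ?thesis using positive_op_norm_sq_le[OF A sM x(1) _ le] nu by simp
    qed (use le1 in simp)
    moreover have "(norm (A x - complex_of_real \<nu> *\<^sub>C x))\<^sup>2
        = (norm (A x))\<^sup>2 + \<nu>\<^sup>2 - 2 * (\<nu> * Re (cinner (A x) x))"
      unfolding norm_sq_diff scaleC_of_real using x(2) by (simp add: cinner_scaleR_right)
    ultimately have "(norm (A x - complex_of_real \<nu> *\<^sub>C x))\<^sup>2 \<le> \<nu>\<^sup>2 - (norm (A x))\<^sup>2" by linarith
    also have "\<dots> = (\<nu> - norm (A x)) * (\<nu> + norm (A x))" by (simp add: algebra_simps power2_eq_square)
    also have "\<dots> \<le> e * (2 * \<nu>)" using x(3) le1 nu e by (intro mult_mono) auto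
    also have "\<dots> < d\<^sup>2" using d nu by (simp add: e_def field_simps)
    finally have "norm (A x - complex_of_real \<nu> *\<^sub>C x) < d" using d by (simp add: power2_less_imp_less)
    then show "\<exists>x\<in>M. norm x = 1 \<and> norm (A x - complex_of_real \<nu> *\<^sub>C x) < d" using x by blast
  qed
  have "t \<le> \<nu>" if "complex_of_real t \<in> spectrum_op M A" for t
  proof (rule ccontr)
    assume "\<not> t \<le> \<nu>"
    then have t: "\<nu> < cmod (complex_of_real t)" "0 < cmod (complex_of_real t) - \<nu>" using nu by simp_all
    have "complex_of_real t \<notin> spectrum_op M A"
      by (rule not_in_spectrumI[OF sM bA, of "cmod (complex_of_real t) - \<nu>"])
        (use t resolvent_below[where A = A, OF le] resolvent_surj[OF M bA nu le t(1)] in blast)+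
    then show False using that by blast
  qed
  then show "sup_spectrum_op M A = \<nu>"
    unfolding sup_spectrum_op_def using in_spec by (intro cSup_eq_maximum) auto
qed

section \<open>Isolated eigenvalues and the recursion for s-numbers\<close>

lemma eigenvectors_cspan:
  assumes "bounded_op M M A" "csubspace M" "x ` I \<subseteq> M" "\<And>i. i \<in> I \<Longrightarrow> A (x i) = c *\<^sub>C x i"
    and "y \<in> cspan (x ` I)"
  shows "y \<in> M" "A y = c *\<^sub>C y"
proof -
  have "csubspace {y\<in>M. A y = c *\<^sub>C y}"
    using assms(1,2)
    by (intro cvec.subspaceI)
      (auto simp: cvec.subspace_0 bounded_op_zero cvec.subspace_add bounded_op_add scaleC_add_right
        cvec.subspace_scale bounded_op_scaleC scaleC_scaleC mult.commute)
  then have "cspan (x ` I) \<subseteq> {y\<in>M. A y = c *\<^sub>C y}" using assms(3,4) by (intro cvec.span_minimal) auto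
  then show "y \<in> M" "A y = c *\<^sub>C y" using assms(5) by auto
qed

lemma eigenvectors_ocompl_invariant:
  assumes A: "positive_op M A" and M: "csubspace M" and x: "x ` I \<subseteq> M"
    and ev: "\<And>i. i \<in> I \<Longrightarrow> A (x i) = c i *\<^sub>R x i" and y: "y \<in> M \<inter> ocompl (x ` I)"
  shows "A y \<in> M \<inter> ocompl (x ` I)"
proof -
  have "cinner (A y) (x i) = 0" if "i \<in> I" for i
  proof -
    have "cinner (A y) (x i) = cinner y (A (x i))" using positive_op_symmetric[OF A M] y x that by blast
    then show ?thesis using ev[OF that] y that by (simp add: cinner_scaleR_right ocompl_def)
  qed
  then show ?thesis using bounded_op_mem[OF positive_op_bounded[OF A]] y by (auto simp: ocompl_def)
qed

text \<open>\<open>M\<close> splits into the span of the eigenvectors and an invariant complement on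
  which \<open>A\<close> is bounded by \<open>c\<close>. For \<open>z\<close> close to \<mu> but
  different from it, |z| exceeds \<open>c\<close>, so A - z is invertible on both summands and \<mu>
  is isolated in the spectrum. This provides the case in which \<open>lambda_op\<close> splits off
  an eigenspace and recurses.\<close>

lemma isolated_top_eigenvalue:
  assumes M: "closed_csubspace M" and A: "positive_op M A"
    and x: "x ` {..<n} \<subseteq> M" "corthonormal x {..<n}" and ev: "\<And>i. i < n \<Longrightarrow> A (x i) = \<mu> *\<^sub>R x i"
    and c: "0 \<le> c" "c < \<mu>" "\<And>y. y \<in> M \<inter> ocompl (x ` {..<n}) \<Longrightarrow> norm (A y) \<le> c * norm y"
  shows "eigenspace_op M A (complex_of_real \<mu>) = cspan (x ` {..<n})"
    and "complex_of_real \<mu> \<notin> ess_spectrum_op M A"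
proof -
  note sM = csubspace_closed_csubspace[OF M] and bA = positive_op_bounded[OF A]
  let ?V = "cspan (x ` {..<n})" and ?N = "M \<inter> ocompl (x ` {..<n})" and ?m = "complex_of_real \<mu>"
  have N: "closed_csubspace ?N" by (intro closed_csubspace_Int M closed_csubspace_ocompl)
  note sN = csubspace_closed_csubspace[OF N]
  have V: "y \<in> M" "A y = ?m *\<^sub>C y" if "y \<in> ?V" for y
    using eigenvectors_cspan[OF bA sM x(1), of ?m y] ev that by (simp_all add: scaleC_of_real)
  have inv: "A u \<in> ?N" if "u \<in> ?N" for u
    using eigenvectors_ocompl_invariant[OF A sM x(1), of "\<lambda>_. \<mu>"] ev that by blast
  have bN: "bounded_op ?N ?N A"
    using bA inv by (auto simp: bounded_op_def)
  have decomp: "\<exists>q u. q \<in> ?V \<and> u \<in> ?N \<and> y = q + u" if "y \<in> M" for y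
    using that V(1) oproj_in_cspan[of x n y] diff_oproj_ocompl[OF x(2), of y] cvec.subspace_diff[OF sM]
    by (intro exI[of _ "oproj x n y"] exI[of _ "y - oproj x n y"]) auto
  have ort: "cinner q u = 0" if "q \<in> ?V" "u \<in> ?N" for q u
    using that ocompl_cspan[of "x ` {..<n}"] cinner_eq_0_commute[of q u] by (auto simp: ocompl_def)
  show E: "eigenspace_op M A ?m = ?V"
  proof
    show "?V \<subseteq> eigenspace_op M A ?m" using V by (auto simp: eigenspace_op_def)
    show "eigenspace_op M A ?m \<subseteq> ?V"
    proof
      fix y assume y: "y \<in> eigenspace_op M A ?m"
      then have "y \<in> M" by (simp add: eigenspace_op_def)
      then obtain q u where qu: "q \<in> ?V" "u \<in> ?N" "y = q + u" using decomp by blast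
      have "A u = ?m *\<^sub>C u"
        using y qu V[OF qu(1)] by (simp add: eigenspace_op_def bounded_op_add[OF bA] scaleC_add_right)
      then have "\<mu> * norm u \<le> c * norm u" using c(3)[OF qu(2)] c by (simp add: norm_scaleC)
      then have "u = 0" using c(2) by (simp add: mult_le_cancel_right)
      then show "y \<in> ?V" using qu by simp
    qed
  qed
  have "z \<notin> spectrum_op M A" if z: "z \<noteq> ?m" "dist z ?m < \<mu> - c" for z
  proof -
    \<comment> \<open>The smaller of the lower bounds for A - z on the two summands.\<close>
    define d where "d = min (cmod (?m - z)) (cmod z - c)"
    have "\<mu> \<le> cmod z + cmod (?m - z)" using norm_triangle_ineq[of z "?m - z"] c by simp
    then have cz: "c < cmod z" using z(2) by (simp add: dist_norm norm_minus_commute)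
    then have d: "d > 0" using z by (simp add: d_def)
    show ?thesis
    proof (rule not_in_spectrumI[OF sM bA d])
      fix y assume "y \<in> M"
      then obtain q u where qu: "q \<in> ?V" "u \<in> ?N" "y = q + u" using decomp by blast
      have qM: "q \<in> M" "u \<in> M" using V qu by auto
      have eq: "A y - z *\<^sub>C y = (?m - z) *\<^sub>C q + (A u - z *\<^sub>C u)"
        using qu V(2)[OF qu(1)] qM
        by (simp add: bounded_op_add[OF bA] scaleC_add_right cvec.scale_left_diff_distrib)
      have w: "A u - z *\<^sub>C u \<in> ?N"
        using sN qu inv by (intro cvec.subspace_diff cvec.subspace_scale) auto
      have 1: "(d * norm y)\<^sup>2 = (d * norm q)\<^sup>2 + (d * norm u)\<^sup>2"
        using pythagoras[OF ort[OF qu(1,2)]] qu(3) by (simp add: power_mult_distrib algebra_simps)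
      have 2: "(d * norm q)\<^sup>2 \<le> (norm ((?m - z) *\<^sub>C q))\<^sup>2"
        unfolding norm_scaleC using d by (intro power_mono mult_right_mono) (auto simp: d_def)
      have 3: "(d * norm u)\<^sup>2 \<le> (norm (A u - z *\<^sub>C u))\<^sup>2"
      proof (rule power_mono)
        have "d * norm u \<le> (cmod z - c) * norm u" by (intro mult_right_mono) (auto simp: d_def)
        then show "d * norm u \<le> norm (A u - z *\<^sub>C u)"
          using resolvent_below[where A = A, OF c(3)[OF qu(2)], of z] by linarith
      qed (use d in simp)
      have 4: "(norm ((?m - z) *\<^sub>C q))\<^sup>2 + (norm (A u - z *\<^sub>C u))\<^sup>2 = (norm (A y - z *\<^sub>C y))\<^sup>2"
        unfolding eq using ort[OF cvec.span_scale[OF qu(1)] w] by (rule pythagoras[symmetric])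
      have "(d * norm y)\<^sup>2 \<le> (norm (A y - z *\<^sub>C y))\<^sup>2" using 1 2 3 4 by linarith
      then show "d * norm y \<le> norm (A y - z *\<^sub>C y)" by (rule power2_le_imp_le) simp
    next
      fix y assume "y \<in> M"
      then obtain q u where qu: "q \<in> ?V" "u \<in> ?N" "y = q + u" using decomp by blast
      obtain v where v: "v \<in> ?N" "A v - z *\<^sub>C v = u" using resolvent_surj[OF N bN c(1,3) cz qu(2)] by blast
      let ?p = "inverse (?m - z) *\<^sub>C q"
      have p: "?p \<in> ?V" using qu(1) cvec.span_scale by blast
      have "?p + v \<in> M" using V(1)[OF p] v sM cvec.subspace_add by blast
      moreover have "A (?p + v) - z *\<^sub>C (?p + v) = (?m - z) *\<^sub>C ?p + (A v - z *\<^sub>C v)"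
        using V[OF p] v(1)
        by (simp add: bounded_op_add[OF bA] scaleC_add_right left_diff_distrib cvec.scale_left_diff_distrib)
      moreover have "(?m - z) *\<^sub>C ?p = q" using z(1) by (simp add: scaleC_scaleC scaleC_one)
      ultimately show "\<exists>x\<in>M. A x - z *\<^sub>C x = y" using v(2) qu(3) by auto
    qed
  qed
  then have "\<not> ?m islimpt spectrum_op M A"
    using c(2) unfolding islimpt_approachable by (metis diff_gt_0_iff_gt)
  then show "?m \<notin> ess_spectrum_op M A"
    using E cfinite_dim_cspan[of "x ` {..<n}"] by (simp add: ess_spectrum_op_def)
qed


text \<open>The induction generalizes over \<open>A\<close> and the eigenvectors, because the
  recursion replaces \<open>A\<close> by \<open>A\<close> minus its top part, for which the
  remaining vectors \<open>x (i + l)\<close> satisfy the same hypotheses. The vectors are counted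
  from 0 and the values of \<open>lambda_op\<close> from 1, hence \<open>Suc j\<close>.\<close>

lemma lambda_op_eq_eigenvalue:
  assumes M: "closed_csubspace M" and A: "positive_op M A"
    and x: "x ` {..<n} \<subseteq> M" "corthonormal x {..<n}" and a: "\<And>j. j < n \<Longrightarrow> 0 \<le> a j"
    and ev: "\<And>j. j < n \<Longrightarrow> A (x j) = a j *\<^sub>R x j"
    and le: "\<And>j y. j < n \<Longrightarrow> y \<in> M \<inter> ocompl (x ` {..<j}) \<Longrightarrow> norm (A y) \<le> a j * norm y"
    and j: "j < n"
  shows "lambda_op M A (Suc j) = a j"
  using assms(2-)
proof (induction j arbitrary: A x a n rule: less_induct)
  case (less j)
  note A = less.prems(1) and x = less.prems(2,3) and a = less.prems(4) and ev = less.prems(5)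
    and le = less.prems(6) and j = less.prems(7)
  note sM = csubspace_closed_csubspace[OF M] and bA = positive_op_bounded[OF A]
  have xM: "x i \<in> M" if "i < n" for i using x(1) that by blast
  have nx: "norm (x i) = 1" if "i < n" for i using corthonormal_norm[OF x(2)] that by blast
  have nAx: "norm (A (x i)) = a i" if "i < n" for i using ev a nx that by simp
  have mono: "a i' \<le> a i" if "i \<le> i'" "i' < n" for i i'
    using le[of i "x i'"] corthonormal_ocompl[OF x(2) that] xM nx nAx that by simp
  have n0: "0 < n" using j by simp
  have le0: "norm (A y) \<le> a 0 * norm y" if "y \<in> M" for y
    using le[OF n0, of y] that by (simp add: ocompl_def)
  have approx: "\<exists>y\<in>M. norm y = 1 \<and> a 0 - e < norm (A y)" if "e > 0" for e
    using nAx[OF n0] nx[OF n0] xM[OF n0] that by (intro bexI[of _ "x 0"]) auto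
  note sup = sup_spectrum_op_eq[OF M A a[OF n0] le0 approx]
  let ?E = "eigenspace_op M A (complex_of_real (a 0))"
  \<comment> \<open>The rank test in \<open>lambda_op\<close> comes first and may return 0. This is
    the right value, since a nonzero \<open>a j\<close> would put \<open>Suc j\<close> orthonormal
    vectors into the range.\<close>
  have rank: "a j = 0" if fin: "cfinite_dim (A ` M)" and dim: "Suc j > cdim (A ` M)"
  proof (rule ccontr)
    assume "a j \<noteq> 0"
    then have "0 < a i" if "i < Suc j" for i using mono[of i j] a[OF j] that j by fastforce
    then have xA: "x i = A ((1 / a i) *\<^sub>R x i)" if "i < Suc j" for i
      using ev[of i] bounded_op_scaleR[OF bA xM, of i "1 / a i"] that j by fastforce
    have "x i \<in> A ` M" if "i < Suc j" for i
      using xA[OF that] csubspace_scaleR[OF sM xM, of i "1 / a i"] that j by (intro image_eqI) auto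
    then have "x ` {..<Suc j} \<subseteq> A ` M" by auto
    moreover have "corthonormal x {..<Suc j}" using x(2) by (rule corthonormal_mono) (use j in auto)
    ultimately show False using corthonormal_le_cdim[OF fin] dim by fastforce
  qed
  show ?case
  \<comment> \<open>If \<open>a j = a 0\<close>, index \<open>Suc j\<close> still belongs to the top
    value: either that value is essential or its multiplicity is at least \<open>Suc j\<close>.
    Otherwise the top eigenspace is split off.\<close>
  proof (cases "a j = a 0")
    case True
    have "Suc j \<le> cdim ?E" if "complex_of_real (a 0) \<notin> ess_spectrum_op M A"
    proof (rule corthonormal_le_cdim)
      show "cfinite_dim ?E" using that sup(2) by (auto simp: ess_spectrum_op_def)
      show "corthonormal x {..<Suc j}" using x(2) by (rule corthonormal_mono) (use j in auto)
      have "x i \<in> ?E" if "i < Suc j" for i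
      proof -
        have "a i = a 0" using mono[of 0 i] mono[of i j] that j True by simp
        then show ?thesis using xM[of i] ev[of i] that j by (simp add: eigenspace_op_def scaleC_of_real)
      qed
      then show "x ` {..<Suc j} \<subseteq> ?E" by auto
    qed
    then show ?thesis using rank True by (subst lambda_op.simps) (auto simp: Let_def sup(1))
  next
    case False
    \<comment> \<open>The first drop below \<open>a 0\<close>: it is the multiplicity of the top
      eigenvalue, and \<open>a i < a 0\<close> is the gap that isolates it.\<close>
    define i where "i = (LEAST i. a i \<noteq> a 0)"
    have ai: "a i \<noteq> a 0" unfolding i_def using False by (rule LeastI)
    have ij: "i \<le> j" unfolding i_def using False by (rule Least_le)
    have lt: "a l = a 0" if "l < i" for l using that not_less_Least unfolding i_def by blast
    have i0: "0 < i" using ai by (cases i) auto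
    have i_n: "i < n" using ij j by simp
    have xi: "x ` {..<i} \<subseteq> M" "corthonormal x {..<i}"
      using xM i_n corthonormal_mono[OF x(2)] by auto
    have evi: "A (x l) = a 0 *\<^sub>R x l" if "l < i" for l using ev[of l] lt[OF that] that i_n by simp
    note iso = isolated_top_eigenvalue[OF M A xi evi a[OF i_n] _ le[OF i_n]]
    have ai_less: "a i < a 0" using ai mono[of 0 i] i_n by simp
    have E: "?E = cspan (x ` {..<i})" using iso(1) ai_less by blast
    have dimE: "cdim ?E = i" unfolding E by (rule cdim_cspan_corthonormal[OF xi(2)])
    have proj: "proj_op ?E y = oproj x i y" for y unfolding E by (rule proj_op_cspan[OF xi(2)])
    have oM: "oproj x i y \<in> M" for y
      using oproj_in_cspan[of x i y] cvec.span_minimal[OF xi(1) sM] by blast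
    have Ao: "A (oproj x i y) = a 0 *\<^sub>R oproj x i y" for y
      using eigenvectors_cspan(2)[OF bA sM xi(1), of "complex_of_real (a 0)"] evi oproj_in_cspan[of x i y]
      by (simp add: scaleC_of_real)
    define A1 where "A1 = (\<lambda>y. A y - a 0 *\<^sub>R proj_op ?E y)"
    \<comment> \<open>Subtracting the top part amounts to projecting off the top eigenspace first;
      positivity and the norm bounds of \<open>A1\<close> are read off from this form.\<close>
    have A1: "A1 y = A (y - oproj x i y)" if "y \<in> M" for y
      unfolding A1_def proj using bounded_op_diff[OF bA sM that oM] Ao by simp
    let ?N = "M \<inter> ocompl (x ` {..<i})"
    have dN: "y - oproj x i y \<in> ?N" if "y \<in> M" for y
      using diff_oproj_ocompl[OF xi(2)] cvec.subspace_diff[OF sM that oM] by blast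
    have inv: "A u \<in> ?N" if "u \<in> ?N" for u
      using eigenvectors_ocompl_invariant[OF A sM xi(1), of "\<lambda>_. a 0"] evi that by blast
    have form: "cinner (A1 y) v = cinner (A (y - oproj x i y)) (v - oproj x i v)" if "y \<in> M" for y v
      using A1[OF that] cinner_oproj[OF xi(2), of "A (y - oproj x i y)" v] inv[OF dN[OF that]]
      by (simp add: cinner.diff_right)
    have pA1: "positive_op M A1"
    proof (rule positive_opI)
      show "cinner (A1 y) v = cinner y (A1 v)" if "y \<in> M" "v \<in> M" for y v
      proof -
        have "cinner y (A1 v) = cnj (cinner (A1 v) y)" by (rule cinner_commute)
        also have "\<dots> = cinner (y - oproj x i y) (A (v - oproj x i v))"
          unfolding form[OF that(2)] by (rule cinner_commute[symmetric])
        also have "\<dots> = cinner (A1 y) v"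
          unfolding form[OF that(1)] using positive_op_symmetric[OF A sM] dN that by force
        finally show ?thesis by simp
      qed
      show "0 \<le> Re (cinner (A1 y) y)" if "y \<in> M" for y
        unfolding form[OF that] using positive_op_nonneg[OF A] dN[OF that] by blast
      show "bounded_op M M A1"
        unfolding bounded_op_def
      proof (intro conjI ballI allI)
        show "A1 y \<in> M" if "y \<in> M" for y using A1[OF that] inv[OF dN[OF that]] by simp
        show "A1 (y + v) = A1 y + A1 v" if "y \<in> M" "v \<in> M" for y v
          unfolding A1_def proj using bounded_op_add[OF bA that] by (simp add: oproj_add algebra_simps)
        show "A1 (c *\<^sub>C y) = c *\<^sub>C A1 y" if "y \<in> M" for c y
          unfolding A1_def proj using bounded_op_scaleC[OF bA that]
          by (simp add: oproj_scaleC scaleC_diff_right scaleC_scaleR)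
        have "norm (A1 y) \<le> a 0 * norm y" if "y \<in> M" for y
        proof -
          have "norm (A1 y) \<le> a 0 * norm (y - oproj x i y)"
            unfolding A1[OF that] using le0 dN[OF that] by blast
          also have "\<dots> \<le> a 0 * norm y" using norm_diff_oproj_le[OF xi(2)] a[OF n0] by (intro mult_left_mono)
          finally show ?thesis .
        qed
        then show "\<exists>b. \<forall>y\<in>M. norm (A1 y) \<le> b * norm y" by blast
      qed
    qed
    have IH: "lambda_op M A1 (Suc (j - i)) = a (i + (j - i))"
    proof (rule less.IH[of "j - i" A1 "\<lambda>l. x (i + l)" "n - i" "\<lambda>l. a (i + l)"])
      show "j - i < j" using i0 ij by simp
      show "positive_op M A1" by (rule pA1)
      show "(\<lambda>l. x (i + l)) ` {..<n - i} \<subseteq> M" using xM by auto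
      show "corthonormal (\<lambda>l. x (i + l)) {..<n - i}" using x(2) by (auto simp: corthonormal_def)
      show "0 \<le> a (i + l)" if "l < n - i" for l using a that by simp
      show "A1 (x (i + l)) = a (i + l) *\<^sub>R x (i + l)" if "l < n - i" for l
        using A1[OF xM] oproj_ocompl[OF corthonormal_ocompl[OF x(2)], of i "i + l"] ev that by simp
      show "norm (A1 y) \<le> a (i + l) * norm y"
        if "l < n - i" "y \<in> M \<inter> ocompl ((\<lambda>l. x (i + l)) ` {..<l})" for l y
      proof -
        let ?u = "y - oproj x i y"
        \<comment> \<open>Projecting off the top eigenspace keeps the orthogonality of
          \<open>y\<close> to the later vectors and adds orthogonality to the first
          \<open>i\<close>, so the bound with index \<open>i + l\<close> applies to
          \<open>?u\<close>.\<close>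
        have "cinner ?u (x s) = 0" if "s < i + l" for s
        proof (cases "s < i")
          case True
          then show ?thesis using dN[of y] \<open>y \<in> M \<inter> _\<close> by (auto simp: ocompl_def)
        next
          case False
          then have s: "s = i + (s - i)" "s - i < l" using that by auto
          have "cinner (oproj x i y) (x s) = 0"
            unfolding oproj_def cinner.sum_left cinner_scaleC_left
            using x(2) False \<open>l < n - i\<close> that
            by (intro sum.neutral) (auto simp: corthonormal_def)
          moreover have "cinner y (x (i + (s - i))) = 0"
            using \<open>y \<in> M \<inter> _\<close> s(2) by (simp add: ocompl_def)
          ultimately show ?thesis using False by (simp add: cinner.diff_left)
        qed
        then have "?u \<in> M \<inter> ocompl (x ` {..<i + l})"
          using dN[of y] \<open>y \<in> M \<inter> _\<close> by (auto simp: ocompl_def)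
        then have "norm (A ?u) \<le> a (i + l) * norm ?u" using le[of "i + l"] that(1) by simp
        also have "\<dots> \<le> a (i + l) * norm y" using norm_diff_oproj_le[OF xi(2)] a that(1) by (intro mult_left_mono) auto
        finally show ?thesis using A1[of y] that(2) by simp
      qed
      show "j - i < n - i" using j ij by simp
    qed
    have "lambda_op M A (Suc j) = (if cfinite_dim (A ` M) \<and> Suc j > cdim (A ` M) then 0
        else lambda_op M A1 (Suc j - i))"
      using iso(2) ai_less dimE i0 ij by (subst lambda_op.simps) (simp add: Let_def sup(1) A1_def)
    moreover have "Suc j - i = Suc (j - i)" "i + (j - i) = j" using ij by simp_all
    ultimately show ?thesis using IH rank by auto
  qed
qed

section \<open>Norm-attaining operators\<close>

text \<open>The homogeneous form takes the place of a supremum: the maximal value is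
  \<open>norm (T x)\<close> itself.\<close>

definition attains_norm :: "'a::complex_hilbert set \<Rightarrow> ('a \<Rightarrow> 'b::complex_hilbert) \<Rightarrow> bool"
  where "attains_norm M T \<longleftrightarrow> (\<exists>x\<in>M. norm x = 1 \<and> (\<forall>y\<in>M. norm (T y) \<le> norm (T x) * norm y))"

definition absolutely_norm_attaining :: "('a::complex_hilbert \<Rightarrow> 'b::complex_hilbert) \<Rightarrow> bool"
  where "absolutely_norm_attaining T \<longleftrightarrow> (\<forall>M. closed_csubspace M \<and> M \<noteq> {0} \<longrightarrow> attains_norm M T)"

text \<open>With \<nu> = \<open>norm (A x)\<close> one has |A (A x)| <= \<nu>^2 = <A (A x), x>, the
  equality case of Cauchy-Schwarz, so A (A x) = \<nu>^2 x. Then y = A x - \<nu> x satisfies A y = -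
  \<nu> y, and positivity leaves only y = 0 or \<nu> = 0.\<close>

lemma maximizer_eigenvector:
  assumes N: "csubspace N" and A: "positive_op N A" and x: "x \<in> N" "norm x = 1"
    and max: "\<And>y. y \<in> N \<Longrightarrow> norm (A y) \<le> norm (A x) * norm y"
  shows "A x = norm (A x) *\<^sub>R x"
proof -
  note bA = positive_op_bounded[OF A]
  let ?a = "norm (A x)"
  have Ax: "A x \<in> N" "A (A x) \<in> N" using bounded_op_mem[OF bA] x by blast+
  have ax: "?a *\<^sub>R x \<in> N" using csubspace_scaleR[OF N x(1)] .
  have "norm (A (A x)) \<le> ?a\<^sup>2" using max[OF Ax(1)] by (simp add: power2_eq_square)
  then have "(norm (A (A x)))\<^sup>2 \<le> (?a\<^sup>2)\<^sup>2" by (intro power_mono) auto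
  moreover have "Re (cinner (A (A x)) x) = ?a\<^sup>2"
    using positive_op_symmetric[OF A N Ax(1) x(1)] by (simp add: Re_cinner_self)
  moreover have "(norm (A (A x) - ?a\<^sup>2 *\<^sub>R x))\<^sup>2
      = (norm (A (A x)))\<^sup>2 + (?a\<^sup>2)\<^sup>2 - 2 * (?a\<^sup>2 * Re (cinner (A (A x)) x))"
    using x(2) by (simp add: norm_sq_diff cinner_scaleR_right)
  ultimately have "(norm (A (A x) - ?a\<^sup>2 *\<^sub>R x))\<^sup>2 \<le> 0"
    by (simp add: power2_eq_square[of "?a\<^sup>2"])
  then have sq: "A (A x) = ?a\<^sup>2 *\<^sub>R x" by simp
  define y where "y = A x - ?a *\<^sub>R x"
  have y: "y \<in> N" unfolding y_def using Ax(1) ax N cvec.subspace_diff by blast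
  have "A y = - ?a *\<^sub>R y"
    using bounded_op_diff[OF bA N Ax(1) ax] bounded_op_scaleR[OF bA x(1)]
    by (simp add: y_def sq scaleR_diff_right power2_eq_square)
  then have "0 \<le> - (?a * (norm y)\<^sup>2)"
    using positive_op_nonneg[OF A y] by (simp add: cinner_scaleR_left Re_cinner_self cinner.minus_left)
  moreover have "0 \<le> ?a * (norm y)\<^sup>2" by simp
  ultimately have "?a * (norm y)\<^sup>2 = 0" by linarith
  then show ?thesis by (auto simp: y_def)
qed

lemma operator_norm_exists:
  assumes M: "csubspace M" "M \<noteq> {0}" and A: "bounded_op M N A"
  shows "\<exists>\<nu>\<ge>0. (\<forall>x\<in>M. norm (A x) \<le> \<nu> * norm x) \<and> (\<forall>e>0. \<exists>x\<in>M. norm x = 1 \<and> \<nu> - e < norm (A x))"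
proof -
  define D where "D = (\<lambda>x. norm (A x)) ` {x\<in>M. norm x = 1}"
  obtain b where b: "b > 0" "\<And>x. x \<in> M \<Longrightarrow> norm (A x) \<le> b * norm x" using bounded_op_bound[OF A] by blast
  have bdd: "bdd_above D" using b(2) by (force simp: D_def intro: bdd_aboveI[of _ b])
  obtain u where u: "u \<in> M" "norm u = 1" using csubspace_sgn[OF M] .
  then have D0: "D \<noteq> {}" by (auto simp: D_def)
  have le1: "norm (A x) \<le> Sup D" if "x \<in> M" "norm x = 1" for x
    using that bdd by (auto simp: D_def intro: cSup_upper)
  have "norm (A x) \<le> Sup D * norm x" if x: "x \<in> M" for x
  proof (cases "x = 0")
    case False
    have "(1 / norm x) *\<^sub>R x \<in> M" using csubspace_scaleR[OF M(1) x] .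
    from le1[OF this] show ?thesis
      using False bounded_op_scaleR[OF A x] by (simp add: field_simps)
  qed (simp add: bounded_op_zero[OF A M(1)])
  moreover have "\<exists>x\<in>M. norm x = 1 \<and> Sup D - e < norm (A x)" if "e > 0" for e
  proof -
    have "Sup D - e < Sup D" using that by simp
    then obtain r where "r \<in> D" "Sup D - e < r" using less_cSupD[OF D0] by blast
    then show ?thesis by (auto simp: D_def)
  qed
  moreover have "0 \<le> Sup D" using le1[OF u] norm_ge_zero order_trans by blast
  ultimately show ?thesis by blast
qed

text \<open>If the norm exceeds \<open>\<alpha>\<close>, a maximizing sequence whose image under \<open>C\<close> converges is Cauchy, by
  the parallelogram law for the form \<open>\<nu>\<^sup>2 |x|\<^sup>2 - |A x|\<^sup>2 \<ge> 0\<close>, \<open>\<nu>\<close> the norm of \<open>A\<close>.\<close>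

lemma attains_norm_compact_perturbation:
  fixes A :: "'a::complex_hilbert \<Rightarrow> 'b::complex_hilbert" and C :: "'a \<Rightarrow> 'c::complex_hilbert"
  assumes M: "closed_csubspace M" and A: "bounded_op M N A" and C: "bounded_op M N' C"
    and le: "\<And>x. x \<in> M \<Longrightarrow> norm (A x) \<le> \<alpha> * norm x + norm (C x)" and \<alpha>: "0 \<le> \<alpha>"
    and comp: "\<And>f :: nat \<Rightarrow> 'a. (\<And>n. f n \<in> M \<and> norm (f n) = 1) \<Longrightarrow>
      \<exists>\<phi> l. strict_mono (\<phi> :: nat \<Rightarrow> nat) \<and> (\<lambda>n. C (f (\<phi> n))) \<longlonglongrightarrow> l"
    and large: "\<exists>x\<in>M. norm x = 1 \<and> \<alpha> < norm (A x)"
  shows "attains_norm M A"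
proof -
  have sM: "csubspace M" and cM: "closed M" using M by (auto simp: closed_csubspace_def)
  have "M \<noteq> {0}" using large by auto
  then obtain \<nu> where le\<nu>: "\<And>x. x \<in> M \<Longrightarrow> norm (A x) \<le> \<nu> * norm x"
    and approx: "\<And>e. e > 0 \<Longrightarrow> \<exists>x\<in>M. norm x = 1 \<and> \<nu> - e < norm (A x)"
    using operator_norm_exists[OF sM _ A] by metis
  have le1: "norm (A x) \<le> \<nu>" if "x \<in> M" "norm x = 1" for x using le\<nu>[OF that(1)] that(2) by simp
  have \<nu>: "\<alpha> < \<nu>" using large le1 by force
  have "\<exists>x. x \<in> M \<and> norm x = 1 \<and> \<nu> - inverse (real (Suc n)) < norm (A x)" for n
    using approx[of "inverse (real (Suc n))"] by auto
  then obtain f where f: "\<And>n. f n \<in> M \<and> norm (f n) = 1" "\<And>n. \<nu> - inverse (real (Suc n)) < norm (A (f n))"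
    by metis
  obtain \<phi> l where \<phi>: "strict_mono (\<phi> :: nat \<Rightarrow> nat)" and l: "(\<lambda>n. C (f (\<phi> n))) \<longlonglongrightarrow> l"
    using comp[of f] f(1) by blast
  define g where "g = (\<lambda>n. f (\<phi> n))"
  have gM: "g n \<in> M" and g1: "norm (g n) = 1" for n using f(1) by (auto simp: g_def)
  have "norm (norm (A (g n)) - \<nu>) \<le> inverse (real (Suc n))" for n
  proof -
    have "inverse (real (Suc (\<phi> n))) \<le> inverse (real (Suc n))"
      using seq_suble[OF \<phi>, of n] by (intro le_imp_inverse_le) auto
    moreover have "\<nu> - inverse (real (Suc (\<phi> n))) < norm (A (g n))" using f(2) by (simp only: g_def)
    ultimately show ?thesis using le1[OF gM g1, of n] by (simp only: real_norm_def)
  qed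
  from LIMSEQ_norm_comparison[OF this LIMSEQ_inverse_real_of_nat]
  have Ag: "(\<lambda>n. norm (A (g n))) \<longlonglongrightarrow> \<nu>" .
  then have "(\<lambda>n. \<nu>\<^sup>2 - (norm (A (g n)))\<^sup>2) \<longlonglongrightarrow> \<nu>\<^sup>2 - \<nu>\<^sup>2" by (intro tendsto_intros)
  then have h: "(\<lambda>n. \<nu>\<^sup>2 - (norm (A (g n)))\<^sup>2) \<longlonglongrightarrow> 0" by simp
  have "Cauchy g"
  proof (rule metric_CauchyI)
    fix e :: real assume e: "e > 0"
    \<comment> \<open>Chosen so that 2 \<eta> in the final estimate is \<nu> - \<alpha> times 2 e /
      3, and the positive factor \<nu> - \<alpha> cancels.\<close>
    define \<eta> where "\<eta> = (\<nu> - \<alpha>) * e / 3"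
    have \<eta>: "\<eta> > 0" using e \<nu> by (simp add: \<eta>_def)
    have "Cauchy (\<lambda>n. C (g n))" using l LIMSEQ_imp_Cauchy by (simp add: g_def)
    then obtain N1 where N1: "\<And>m n. m \<ge> N1 \<Longrightarrow> n \<ge> N1 \<Longrightarrow> norm (C (g m) - C (g n)) < \<eta>"
      using \<eta> unfolding Cauchy_def dist_norm by metis
    obtain N2 where N2: "\<And>n. n \<ge> N2 \<Longrightarrow> \<nu>\<^sup>2 - (norm (A (g n)))\<^sup>2 < \<eta>\<^sup>2 / 4"
      using order_tendstoD(2)[OF h, of "\<eta>\<^sup>2 / 4"] \<eta> by (auto simp: eventually_sequentially)
    have "dist (g m) (g n) < e" if mn: "m \<ge> max N1 N2" "n \<ge> max N1 N2" for m n
    proof -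
      let ?d = "norm (g m - g n)"
      have d: "g m - g n \<in> M" "g m + g n \<in> M" using gM sM cvec.subspace_diff cvec.subspace_add by blast+
      have "(norm (A (g m) + A (g n)))\<^sup>2 + (norm (A (g m) - A (g n)))\<^sup>2
          = 2 * (norm (A (g m)))\<^sup>2 + 2 * (norm (A (g n)))\<^sup>2" by (rule parallelogram_law)
      moreover have "\<nu>\<^sup>2 * (norm (g m + g n))\<^sup>2 + \<nu>\<^sup>2 * ?d\<^sup>2 = 4 * \<nu>\<^sup>2"
        using parallelogram_law[of "g m" "g n"] g1 by (simp flip: distrib_left)
      moreover have "(norm (A (g m) + A (g n)))\<^sup>2 \<le> \<nu>\<^sup>2 * (norm (g m + g n))\<^sup>2"
        using power_mono[OF le\<nu>[OF d(2)], of 2] bounded_op_add[OF A gM gM] by (simp add: power_mult_distrib)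
      \<comment> \<open>This is \<nu>^2 times the parallelogram law for the vectors minus the law
        for their images; the two sum terms compare in the right direction because \<nu> bounds
        \<open>A\<close>.\<close>
      ultimately have "\<nu>\<^sup>2 * ?d\<^sup>2 \<le> (norm (A (g m) - A (g n)))\<^sup>2
          + 2 * (\<nu>\<^sup>2 - (norm (A (g m)))\<^sup>2) + 2 * (\<nu>\<^sup>2 - (norm (A (g n)))\<^sup>2)"
        by argo
      also have "\<dots> \<le> (norm (A (g m) - A (g n)))\<^sup>2 + \<eta>\<^sup>2" using N2[of m] N2[of n] mn by simp
      also have "(norm (A (g m) - A (g n)))\<^sup>2 \<le> (\<alpha> * ?d + \<eta>)\<^sup>2"
      proof (rule power_mono)
        show "norm (A (g m) - A (g n)) \<le> \<alpha> * ?d + \<eta>"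
          using le[OF d(1)] N1[of m n] mn
          by (simp add: bounded_op_diff[OF A sM gM gM] bounded_op_diff[OF C sM gM gM])
      qed simp
      also have "(\<alpha> * ?d + \<eta>)\<^sup>2 + \<eta>\<^sup>2 \<le> (\<alpha> * ?d + 2 * \<eta>)\<^sup>2"
      proof -
        have "0 \<le> \<alpha> * ?d * \<eta>" using \<alpha> \<eta> by simp
        then show ?thesis by (simp add: power2_eq_square algebra_simps)
      qed
      finally have "(\<nu> * ?d)\<^sup>2 \<le> (\<alpha> * ?d + 2 * \<eta>)\<^sup>2" by (simp add: power_mult_distrib)
      then have "\<nu> * ?d \<le> \<alpha> * ?d + 2 * \<eta>" by (rule power2_le_imp_le) (use \<alpha> \<eta> in simp)
      moreover have "2 * \<eta> = (\<nu> - \<alpha>) * (2 * e / 3)" by (simp add: \<eta>_def)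
      ultimately have "(\<nu> - \<alpha>) * ?d \<le> (\<nu> - \<alpha>) * (2 * e / 3)"
        unfolding left_diff_distrib[of \<nu> \<alpha> ?d] by linarith
      then have "?d \<le> 2 * e / 3" using \<nu> by simp
      then show ?thesis using e by (simp add: dist_norm)
    qed
    then show "\<exists>N. \<forall>m\<ge>N. \<forall>n\<ge>N. dist (g m) (g n) < e" by blast
  qed
  then obtain x where x: "g \<longlonglongrightarrow> x" using Cauchy_convergent_iff convergent_def by blast
  have xM: "x \<in> M" using closed_sequentially[OF cM gM x] .
  have "(\<lambda>n. norm (A (g n))) \<longlonglongrightarrow> norm (A x)"
    by (intro tendsto_norm bounded_op_tendsto[OF A sM gM xM x])
  then have Ax: "norm (A x) = \<nu>" using Ag LIMSEQ_unique by blast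
  have "(\<lambda>n. norm (g n)) \<longlonglongrightarrow> norm x" using x by (rule tendsto_norm)
  then have "norm x = 1" using g1 LIMSEQ_unique[of "\<lambda>n. 1" "norm x" 1] by simp
  then show ?thesis unfolding attains_norm_def using xM Ax le\<nu> by auto
qed

lemma csubspace_image:
  assumes A: "bounded_op M N A" and M: "csubspace M"
  shows "csubspace (A ` M)"
proof (rule cvec.subspaceI)
  show "0 \<in> A ` M" using bounded_op_zero[OF A M] cvec.subspace_0[OF M] by force
  fix u assume "u \<in> A ` M"
  then obtain x where x: "x \<in> M" "u = A x" by blast
  show "c *\<^sub>C u \<in> A ` M" for c
    using bounded_op_scaleC[OF A x(1), of c] cvec.subspace_scale[OF M x(1), of c] x(2) by force
  fix v assume "v \<in> A ` M"
  then obtain y where y: "y \<in> M" "v = A y" by blast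
  show "u + v \<in> A ` M"
    using bounded_op_add[OF A x(1) y(1)] cvec.subspace_add[OF M x(1) y(1)] x(2) y(2) by force
qed

text \<open>A nonzero \<open>A\<close> is its own compact part: the perturbation lemma applies with
  \<alpha> = 0 and \<open>C = A\<close>, since bounded sequences in the range have convergent
  subsequences. If \<open>A\<close> vanishes on \<open>M\<close>, any unit vector attains.\<close>

lemma attains_norm_finite_rank:
  fixes A :: "'a::complex_hilbert \<Rightarrow> 'b::complex_hilbert"
  assumes M: "closed_csubspace M" "M \<noteq> {0}" and A: "bounded_op M N A" and fin: "cfinite_dim (A ` M)"
  shows "attains_norm M A"
proof (cases "\<exists>x\<in>M. norm x = 1 \<and> 0 < norm (A x)")
  case True
  note sM = csubspace_closed_csubspace[OF M(1)]
  obtain b where b: "b > 0" "\<And>x. x \<in> M \<Longrightarrow> norm (A x) \<le> b * norm x" using bounded_op_bound[OF A] by blast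
  show ?thesis
  proof (rule attains_norm_compact_perturbation[OF M(1) A A, of 0])
    fix f :: "nat \<Rightarrow> 'a" assume f: "\<And>n. f n \<in> M \<and> norm (f n) = 1"
    have "norm (A (f n)) \<le> b" for n using b(2)[of "f n"] f[of n] by simp
    then obtain \<phi> l where "strict_mono (\<phi> :: nat \<Rightarrow> nat)" "((\<lambda>n. A (f n)) \<circ> \<phi>) \<longlonglongrightarrow> l"
      using cfinite_dim_convergent_subseq[OF csubspace_image[OF A sM] fin, of "\<lambda>n. A (f n)" b] f by blast
    then show "\<exists>\<phi> l. strict_mono (\<phi> :: nat \<Rightarrow> nat) \<and> (\<lambda>n. A (f (\<phi> n))) \<longlonglongrightarrow> l" by (auto simp: o_def)
  qed (use True in auto)
next
  case False
  note sM = csubspace_closed_csubspace[OF M(1)]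
  have "A y = 0" if y: "y \<in> M" for y
  proof (cases "y = 0")
    case nz: False
    have "A ((1 / norm y) *\<^sub>R y) = 0" using False csubspace_scaleR[OF sM y] nz by force
    then show ?thesis using bounded_op_scaleR[OF A y] nz by simp
  qed (simp add: bounded_op_zero[OF A sM])
  then show ?thesis
    unfolding attains_norm_def using csubspace_sgn[OF sM M(2)] by (metis mult_zero_left norm_zero order_refl)
qed

lemma bounded_op_image_cfinite_dim:
  assumes A: "bounded_op M N A" and "csubspace M" "cfinite_dim M"
  shows "cfinite_dim (A ` M)"
proof -
  obtain x n where x: "corthonormal x {..<n}" "M = cspan (x ` {..<n})"
    using corthonormal_basis_exists assms(2,3) by blast
  have xM: "x i \<in> M" if "i < n" for i using that unfolding x(2) by (intro cvec.span_base) simp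
  have "A y \<in> cspan ((\<lambda>i. A (x i)) ` {..<n})" if "y \<in> M" for y
  proof -
    have "A y = A (\<Sum>i<n. cinner y (x i) *\<^sub>C x i)" using oproj_id[OF x(1)] that x(2) by (simp add: oproj_def)
    also have "\<dots> = (\<Sum>i<n. A (cinner y (x i) *\<^sub>C x i))"
      by (rule bounded_op_sum[OF A assms(2)]) (use xM assms(2) cvec.subspace_scale in auto)
    also have "\<dots> = (\<Sum>i<n. cinner y (x i) *\<^sub>C A (x i))"
      using bounded_op_scaleC[OF A xM] by (intro sum.cong) auto
    also have "\<dots> \<in> cspan ((\<lambda>i. A (x i)) ` {..<n})"
      by (intro cvec.span_sum cvec.span_scale cvec.span_base) simp
    finally show ?thesis .
  qed
  then show ?thesis
    unfolding cfinite_dim_def by (intro exI[of _ "(\<lambda>i. A (x i)) ` {..<n}"]) auto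
qed

section \<open>Norming versus norm attaining\<close>

lemma attains_norm_abs_op:
  assumes "closed_csubspace M" "bounded_op M N T"
  shows "attains_norm M (abs_op M T) \<longleftrightarrow> attains_norm M T"
  unfolding attains_norm_def using norm_abs_op[OF assms] by simp

lemma norming_imp_attains_norm:
  assumes M: "closed_csubspace M" "M \<noteq> {0}" and T: "bounded_op M N T" and w: "w \<in> weights" and k: "k \<ge> 1"
    and norming: "norming w k M T"
  shows "attains_norm M T"
\<comment> \<open>Finite rank is settled by compactness; infinite rank excludes the zero branch of
  \<open>lambda_op\<close> at every index.\<close>
proof (cases "cfinite_dim (abs_op M T ` M)")
  case True
  have "attains_norm M (abs_op M T)"
    using attains_norm_finite_rank[OF M positive_op_bounded[OF positive_op_abs_op[OF M(1) T]] True] .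
  then show ?thesis using attains_norm_abs_op[OF M(1) T] by simp
next
  case infin: False
  define A where "A = abs_op M T"
  note sM = csubspace_closed_csubspace[OF M(1)]
  have A: "positive_op M A" unfolding A_def by (rule positive_op_abs_op[OF M(1) T])
  note bA = positive_op_bounded[OF A]
  have nA: "norm (A x) = norm (T x)" if "x \<in> M" for x unfolding A_def by (rule norm_abs_op[OF M(1) T that])
  have "\<not> cfinite_dim M" using bounded_op_image_cfinite_dim[OF bA sM] infin by (auto simp: A_def)
  then have "\<exists>x. (\<forall>j\<in>{1..k}. x j \<in> M) \<and> corthonormal x {1..k} \<and>
      ky_fan_norm w k M T = (\<Sum>j=1..k. w j * norm (T (x j)))"
    using norming by (simp add: norming_def)
  then obtain x where x: "\<And>j. j \<in> {1..k} \<Longrightarrow> x j \<in> M" "corthonormal x {1..k}"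
    and sum: "ky_fan_norm w k M T = (\<Sum>j=1..k. w j * norm (T (x j)))"
    by blast
  obtain \<nu> where \<nu>0: "0 \<le> \<nu>" and le\<nu>: "\<And>x. x \<in> M \<Longrightarrow> norm (A x) \<le> \<nu> * norm x"
    and approx: "\<And>e. e > 0 \<Longrightarrow> \<exists>x\<in>M. norm x = 1 \<and> \<nu> - e < norm (A x)"
    using operator_norm_exists[OF sM M(2) bA] by metis
  have le1: "norm (A y) \<le> \<nu>" if "y \<in> M" "norm y = 1" for y using le\<nu>[OF that(1)] that(2) by simp
  have sup: "sup_spectrum_op M A = \<nu>" using sup_spectrum_op_eq[OF M(1) A \<nu>0 le\<nu> approx] by blast
  let ?E = "eigenspace_op M A (complex_of_real \<nu>)"
  have "\<exists>y\<in>M. norm y = 1 \<and> norm (A y) = \<nu>"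
  \<comment> \<open>In the first case \<open>lambda_op\<close> returns \<nu> at every index, also
    through its clause for multiplicity 0, and equality of the weighted sums makes every term w j
    (\<nu> - |A (x j)|) vanish, in particular the one for \<open>x 1\<close>. In the second case the
    eigenspace is nonzero.\<close>
  proof (cases "complex_of_real \<nu> \<in> ess_spectrum_op M A \<or> cdim ?E = 0")
    case True
    have "s_number M T j = \<nu>" for j
      unfolding s_number_def A_def[symmetric]
      using True infin[folded A_def] by (subst lambda_op.simps) (auto simp: Let_def sup)
    then have "(\<Sum>j=1..k. w j * (\<nu> - norm (A (x j)))) = 0"
      using sum nA x(1) by (simp add: ky_fan_norm_def right_diff_distrib sum_subtractf)
    moreover have "0 \<le> w j * (\<nu> - norm (A (x j)))" if "j \<in> {1..k}" for j
    proof (rule mult_nonneg_nonneg)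
      show "0 \<le> w j" using w that by (auto simp: weights_def intro: less_imp_le)
      show "0 \<le> \<nu> - norm (A (x j))" using le1[OF x(1)[OF that] corthonormal_norm[OF x(2) that]] by simp
    qed
    ultimately have "\<forall>j\<in>{1..k}. w j * (\<nu> - norm (A (x j))) = 0"
      by (subst (asm) sum_nonneg_eq_0_iff) auto
    then have "w 1 * (\<nu> - norm (A (x 1))) = 0" using k by simp
    then have "norm (A (x 1)) = \<nu>" using w by (simp add: weights_def)
    then show ?thesis using x(1)[of 1] corthonormal_norm[OF x(2), of 1] k by auto
  next
    case False
    have E: "csubspace ?E"
      using sM bA by (intro cvec.subspaceI)
        (auto simp: eigenspace_op_def cvec.subspace_0 bounded_op_zero cvec.subspace_add bounded_op_add
          scaleC_add_right cvec.subspace_scale bounded_op_scaleC scaleC_scaleC mult.commute)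
    have "cdim {0::'a} = 0" using cvec.dim_le_card[of "{0}" "{}"] by (simp add: cvec.span_empty)
    moreover have "cdim ?E \<noteq> 0" using False by blast
    ultimately have "?E \<noteq> {0}" by metis
    then obtain y where "y \<in> ?E" "norm y = 1" by (rule csubspace_sgn[OF E])
    then show ?thesis using \<nu>0 by (auto simp: eigenspace_op_def norm_scaleC)
  qed
  then show ?thesis using le\<nu> nA unfolding attains_norm_def by auto
qed

text \<open>Inductively the earlier maximizers are eigenvectors, so their complement is invariant
  and the next maximizer is an eigenvector of the restriction. One sequence serves all lengths
  \<open>n\<close>, up to the dimension when that is finite.\<close>

lemma greedy_eigenvectors:
  fixes A :: "'a::complex_hilbert \<Rightarrow> 'a"
  assumes M: "closed_csubspace M" and A: "positive_op M A"
    and att: "\<And>S. M \<inter> ocompl S \<noteq> {0} \<Longrightarrow> attains_norm (M \<inter> ocompl S) A"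
  shows "\<exists>x. \<forall>n. (cfinite_dim M \<longrightarrow> n \<le> cdim M) \<longrightarrow> corthonormal x {..<n} \<and> x ` {..<n} \<subseteq> M \<and>
    (\<forall>j<n. A (x j) = norm (A (x j)) *\<^sub>R x j \<and>
      (\<forall>y\<in>M \<inter> ocompl (x ` {..<j}). norm (A y) \<le> norm (A (x j)) * norm y))"
proof -
  note sM = csubspace_closed_csubspace[OF M] and bA = positive_op_bounded[OF A]
  have "\<exists>y\<in>M \<inter> ocompl S. norm y = 1 \<and> (\<forall>z\<in>M \<inter> ocompl S. norm (A z) \<le> norm (A y) * norm z)"
    if "M \<inter> ocompl S \<noteq> {0}" for S
    using att[OF that] unfolding attains_norm_def .
  then obtain x :: "nat \<Rightarrow> 'a" where x: "\<And>n. M \<inter> ocompl (x ` {..<n}) \<noteq> {0} \<Longrightarrow>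
      corthonormal x {..<Suc n} \<and> x ` {..<Suc n} \<subseteq> M \<and>
      (\<forall>z\<in>M \<inter> ocompl (x ` {..<n}). norm (A z) \<le> norm (A (x n)) * norm z)"
    using greedy_sequence[of M "\<lambda>S y. \<forall>z\<in>M \<inter> ocompl S. norm (A z) \<le> norm (A y) * norm z"] by metis
  have span: "M = cspan (x ` {..<j}) \<and> corthonormal x {..<j}"
    if j: "M \<inter> ocompl (x ` {..<j}) = {0}" "\<And>i. i < j \<Longrightarrow> M \<inter> ocompl (x ` {..<i}) \<noteq> {0}" for j
  proof -
    have "corthonormal x {..<j} \<and> x ` {..<j} \<subseteq> M"
      using x[of "j - 1"] j(2)[of "j - 1"] by (cases j) (auto simp: corthonormal_def)
    then show ?thesis using subset_cspan_corthonormal[OF sM] j(1) by blast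
  qed
  have "corthonormal x {..<n} \<and> x ` {..<n} \<subseteq> M \<and>
    (\<forall>j<n. A (x j) = norm (A (x j)) *\<^sub>R x j \<and>
      (\<forall>y\<in>M \<inter> ocompl (x ` {..<j}). norm (A y) \<le> norm (A (x j)) * norm y))"
    if n: "cfinite_dim M \<longrightarrow> n \<le> cdim M" for n
  proof -
    \<comment> \<open>A trivial complement after \<open>j\<close> vectors would make
      \<open>j\<close> the dimension, although \<open>j < n\<close>.\<close>
    have nz: "M \<inter> ocompl (x ` {..<j}) \<noteq> {0}" if "j < n" for j
      using that
    proof (induction j rule: less_induct)
      case (less j)
      show ?case
      proof
        assume "M \<inter> ocompl (x ` {..<j}) = {0}"
        then have "M = cspan (x ` {..<j})" "corthonormal x {..<j}" using span less by simp_all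
        then have "cfinite_dim M" "cdim M = j"
          using cdim_cspan_corthonormal[of x j] cfinite_dim_cspan[of "x ` {..<j}"]
          by (metis finite_imageI finite_lessThan)+
        then show False using less.prems n by simp
      qed
    qed
    have ortho: "corthonormal x {..<n}" "x ` {..<n} \<subseteq> M"
      using x[of "n - 1"] nz[of "n - 1"] by (cases n; auto simp: corthonormal_def)+
    have xM: "x i \<in> M" if "i < n" for i using ortho(2) that by blast
    have le: "norm (A y) \<le> norm (A (x j)) * norm y" if "j < n" "y \<in> M \<inter> ocompl (x ` {..<j})" for j y
      using x[OF nz[OF that(1)]] that by simp
    have ev: "A (x j) = norm (A (x j)) *\<^sub>R x j" if "j < n" for j
      using that
    proof (induction j rule: less_induct)
      case (less j)
      let ?N = "M \<inter> ocompl (x ` {..<j})"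
      have sub: "x ` {..<j} \<subseteq> M" using xM less.prems by auto
      have inv: "A y \<in> ?N" if "y \<in> ?N" for y
        by (rule eigenvectors_ocompl_invariant[OF A sM sub, of "\<lambda>i. norm (A (x i))"])
          (use less that in auto)
      have bN: "bounded_op ?N ?N A" using bA inv unfolding bounded_op_def by blast
      have "positive_op ?N A" using A bN by (simp add: positive_op_def)
      moreover have "x j \<in> ?N" using xM corthonormal_ocompl[OF ortho(1), of j j] less.prems by simp
      moreover have "norm (x j) = 1" using corthonormal_norm[OF ortho(1)] less.prems by simp
      ultimately show ?case
        using le[OF less.prems] by (intro maximizer_eigenvector[OF csubspace_Int_ocompl[OF sM]]) blast+
    qed
    show ?thesis using ortho ev le by blast
  qed
  then show ?thesis by blast
qed

lemma attaining_imp_norming: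
  fixes T :: "'a::complex_hilbert \<Rightarrow> 'b::complex_hilbert"
  assumes T: "bounded_op UNIV UNIV T" and AN: "absolutely_norm_attaining T"
    and M: "closed_csubspace M"
  shows "norming w k M T"
proof -
  note sM = csubspace_closed_csubspace[OF M]
  have TM: "bounded_op M UNIV T" using bounded_op_subset[OF T] by blast
  \<comment> \<open>The modulus is taken on \<open>M\<close>, where the s-numbers in
    \<open>norming\<close> live; it inherits attainment on subspaces of \<open>M\<close> from
    \<open>T\<close> by equality of norms.\<close>
  define A where "A = abs_op M T"
  have A: "positive_op M A" unfolding A_def by (rule positive_op_abs_op[OF M TM])
  note bA = positive_op_bounded[OF A]
  have nA: "norm (A x) = norm (T x)" if "x \<in> M" for x unfolding A_def by (rule norm_abs_op[OF M TM that])
  define n where "n = (if cfinite_dim M \<and> cdim M < k then cdim M else k)"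
  have "attains_norm (M \<inter> ocompl S) A" if "M \<inter> ocompl S \<noteq> {0}" for S
  proof -
    have "closed_csubspace (M \<inter> ocompl S)" by (intro closed_csubspace_Int M closed_csubspace_ocompl)
    then have "attains_norm (M \<inter> ocompl S) T"
      using AN that by (simp add: absolutely_norm_attaining_def)
    then show ?thesis using nA by (simp add: attains_norm_def)
  qed
  from greedy_eigenvectors[OF M A this] obtain x :: "nat \<Rightarrow> 'a"
    where "\<forall>n. (cfinite_dim M \<longrightarrow> n \<le> cdim M) \<longrightarrow> corthonormal x {..<n} \<and> x ` {..<n} \<subseteq> M \<and>
    (\<forall>j<n. A (x j) = norm (A (x j)) *\<^sub>R x j \<and>
      (\<forall>y\<in>M \<inter> ocompl (x ` {..<j}). norm (A y) \<le> norm (A (x j)) * norm y))" ..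
  moreover have "cfinite_dim M \<longrightarrow> n \<le> cdim M" by (simp add: n_def)
  ultimately have ortho: "corthonormal x {..<n}" "x ` {..<n} \<subseteq> M"
    and ev: "\<And>j. j < n \<Longrightarrow> A (x j) = norm (A (x j)) *\<^sub>R x j"
    and le: "\<And>j y. j < n \<Longrightarrow> y \<in> M \<inter> ocompl (x ` {..<j}) \<Longrightarrow> norm (A y) \<le> norm (A (x j)) * norm y"
    by blast+
  have xM: "x i \<in> M" if "i < n" for i using ortho(2) that by blast
  have lam: "lambda_op M A (Suc j) = norm (T (x j))" if "j < n" for j
    using lambda_op_eq_eigenvalue[OF M A ortho(2,1) _ ev le that] nA xM that by simp
  \<comment> \<open>Indices beyond \<open>n\<close> occur only when \<open>M\<close> has dimension n
    < k. The rank is then at most \<open>n\<close>, so the surplus terms of the Ky Fan sum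
    vanish.\<close>
  have zero: "lambda_op M A j = 0" if "j > n" "j \<le> k" for j
  proof -
    have fin: "cfinite_dim M" "cdim M = n" using that by (auto simp: n_def split: if_splits)
    obtain e m where e: "corthonormal e {..<m}" "M = cspan (e ` {..<m})"
      using corthonormal_basis_exists[OF sM fin(1)] by blast
    have "m = n" using cdim_cspan_corthonormal[OF e(1)] e(2) fin(2) by simp
    have sub: "A ` M \<subseteq> M" using bounded_op_mem[OF bA] by blast
    have "cdim (A ` M) \<le> card (e ` {..<m})" using sub e(2) by (intro cvec.dim_le_card) auto
    also have "\<dots> \<le> n" using card_image_le[of "{..<m}" e] \<open>m = n\<close> by simp
    finally have "cdim (A ` M) < j" using that by simp
    moreover have "cfinite_dim (A ` M)" using cfinite_dim_subset[OF fin(1) sub] .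
    ultimately show ?thesis by (subst lambda_op.simps) (simp add: Let_def)
  qed
  have nk: "n \<le> k" by (simp add: n_def)
  have "ky_fan_norm w k M T = (\<Sum>j=1..k. w j * lambda_op M A j)"
    by (simp add: ky_fan_norm_def s_number_def A_def)
  also have "\<dots> = (\<Sum>j=1..n. w j * lambda_op M A j)"
    using zero nk by (intro sum.mono_neutral_right) auto
  also have "\<dots> = (\<Sum>j=1..n. w j * norm (T (x (j - 1))))"
  proof (intro sum.cong refl)
    fix j assume "j \<in> {1..n}"
    then have "j - 1 < n" "Suc (j - 1) = j" by auto
    then show "w j * lambda_op M A j = w j * norm (T (x (j - 1)))" using lam[of "j - 1"] by simp
  qed
  finally have eq: "ky_fan_norm w k M T = (\<Sum>j=1..n. w j * norm (T (x (j - 1))))" .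
  \<comment> \<open>Shift from vectors counted from 0 to the count from 1 in
    \<open>norming\<close>.\<close>
  have "corthonormal (\<lambda>j. x (j - 1)) {1..n}"
    using ortho(1) by (auto simp: corthonormal_def)
  moreover have "\<forall>j\<in>{1..n}. x (j - 1) \<in> M" using xM by auto
  ultimately show ?thesis
    unfolding norming_def Let_def n_def[symmetric] using eq by (intro exI[of _ "\<lambda>j. x (j - 1)"]) blast
qed

section \<open>Positive compact plus finite-rank perturbations of scalars\<close>

lemma bounded_op_plus:
  assumes "bounded_op M UNIV S" "bounded_op M UNIV T"
  shows "bounded_op M UNIV (\<lambda>x. S x + T x)"
proof -
  obtain b c where b: "\<And>x. x \<in> M \<Longrightarrow> norm (S x) \<le> b * norm x" "\<And>x. x \<in> M \<Longrightarrow> norm (T x) \<le> c * norm x"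
    using bounded_op_bound[OF assms(1)] bounded_op_bound[OF assms(2)] by metis
  have "norm (S x + T x) \<le> (b + c) * norm x" if "x \<in> M" for x
    using b[OF that] norm_triangle_ineq[of "S x" "T x"] by (simp add: distrib_right)
  then show ?thesis
    unfolding bounded_op_def[of _ _ "\<lambda>x. S x + T x"]
    by (auto simp: bounded_op_add[OF assms(1)] bounded_op_add[OF assms(2)] bounded_op_scaleC[OF assms(1)]
        bounded_op_scaleC[OF assms(2)] scaleC_add_right)
qed

lemma bounded_op_scaleR_fun:
  assumes "bounded_op M UNIV T"
  shows "bounded_op M UNIV (\<lambda>x. r *\<^sub>R T x)"
proof -
  obtain b where b: "\<And>x. x \<in> M \<Longrightarrow> norm (T x) \<le> b * norm x" using bounded_op_bound[OF assms] by metis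
  have "norm (r *\<^sub>R T x) \<le> (\<bar>r\<bar> * b) * norm x" if "x \<in> M" for x
    using mult_left_mono[OF b[OF that], of "\<bar>r\<bar>"] by (simp add: mult.assoc)
  then show ?thesis
    unfolding bounded_op_def[of _ _ "\<lambda>x. r *\<^sub>R T x"]
    by (auto simp: bounded_op_add[OF assms] bounded_op_scaleC[OF assms] scaleR_add_right scaleC_scaleR)
qed

lemma bounded_op_minus:
  assumes "bounded_op M UNIV S" "bounded_op M UNIV T"
  shows "bounded_op M UNIV (\<lambda>x. S x - T x)"
  using bounded_op_plus[OF assms(1) bounded_op_scaleR_fun[OF assms(2), of "-1"]] by simp

lemma bounded_op_id: "bounded_op M UNIV (\<lambda>x. x)"
  by (auto simp: bounded_op_def intro: exI[of _ 1])

lemma bounded_op_comp: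
  assumes S: "bounded_op N UNIV S" and T: "bounded_op M N T"
  shows "bounded_op M UNIV (\<lambda>x. S (T x))"
proof -
  obtain b where b: "b > 0" "\<And>x. x \<in> N \<Longrightarrow> norm (S x) \<le> b * norm x" using bounded_op_bound[OF S] by metis
  obtain c where c: "c > 0" "\<And>x. x \<in> M \<Longrightarrow> norm (T x) \<le> c * norm x" using bounded_op_bound[OF T] by metis
  have "norm (S (T x)) \<le> (b * c) * norm x" if "x \<in> M" for x
    using order_trans[OF b(2)[OF bounded_op_mem[OF T that]] mult_left_mono[OF c(2)[OF that], of b]] b(1)
    by (simp add: mult.assoc)
  then show ?thesis
    unfolding bounded_op_def[of _ _ "\<lambda>x. S (T x)"]
    by (auto simp: bounded_op_add[OF S] bounded_op_add[OF T] bounded_op_scaleC[OF S]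
        bounded_op_scaleC[OF T] bounded_op_mem[OF T])
qed

lemma bounded_op_proj_op:
  assumes M: "closed_csubspace M"
  shows "bounded_op UNIV UNIV (proj_op M)"
proof -
  note sM = csubspace_closed_csubspace[OF M] and p = proj_op[OF M]
  have add: "proj_op M (x + y) = proj_op M x + proj_op M y" for x y
  proof (rule proj_op_eqI[OF sM])
    have "x + y - (proj_op M x + proj_op M y) = (x - proj_op M x) + (y - proj_op M y)" by simp
    then show "x + y - (proj_op M x + proj_op M y) \<in> ocompl M"
      using p(2) cvec.subspace_add[OF csubspace_ocompl] by metis
  qed (use p sM cvec.subspace_add in blast)
  have scale: "proj_op M (c *\<^sub>C x) = c *\<^sub>C proj_op M x" for c x
  proof (rule proj_op_eqI[OF sM])
    show "c *\<^sub>C x - c *\<^sub>C proj_op M x \<in> ocompl M"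
      using p(2) cvec.subspace_scale[OF csubspace_ocompl] by (metis scaleC_diff_right)
  qed (use p sM cvec.subspace_scale in blast)
  have "norm (proj_op M x) \<le> norm x" for x
  proof -
    have "cinner (x - proj_op M x) (proj_op M x) = 0" using ocomplD[OF p(2) p(1)] .
    from pythagoras[OF this] have "(norm (proj_op M x))\<^sup>2 \<le> (norm x)\<^sup>2" by simp
    then show ?thesis by (rule power2_le_imp_le) simp
  qed
  then show ?thesis unfolding bounded_op_def using add scale by (auto intro: exI[of _ 1])
qed

lemma compact_op_seq:
  fixes K :: "'a::complex_hilbert \<Rightarrow> 'b::complex_hilbert" and f :: "nat \<Rightarrow> 'a"
  assumes "compact_op K" "\<And>n. norm (f n) \<le> 1"
  shows "\<exists>\<phi> l. strict_mono (\<phi> :: nat \<Rightarrow> nat) \<and> (\<lambda>n. K (f (\<phi> n))) \<longlonglongrightarrow> l"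
proof -
  have "seq_compact (closure (K ` cball 0 1))"
    using assms(1) by (simp add: compact_op_def compact_eq_seq_compact_metric)
  moreover have "\<forall>n. K (f n) \<in> closure (K ` cball 0 1)"
    using assms(2) closure_subset by (fastforce simp: dist_norm)
  ultimately obtain l \<phi> where "strict_mono (\<phi> :: nat \<Rightarrow> nat)" "((\<lambda>n. K (f n)) \<circ> \<phi>) \<longlonglongrightarrow> l"
    by (rule seq_compactE)
  then show ?thesis by (auto simp: o_def)
qed

text \<open>An injective restriction maps a basis of \<open>M\<close> to an independent subset of
  the finite-dimensional range. It yields the dichotomy that \<open>M\<close> either meets the
  kernel of \<open>F\<close> nontrivially or has finite dimension.\<close>

lemma cfinite_dim_injective:
  fixes F :: "'a::complex_hilbert \<Rightarrow> 'b::complex_hilbert"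
  assumes M: "csubspace M" and F: "bounded_op UNIV UNIV F" and fin: "cfinite_dim (range F)"
    and inj: "\<And>x. x \<in> M \<Longrightarrow> F x = 0 \<Longrightarrow> x = 0"
  shows "cfinite_dim M"
proof -
  interpret vector_space_pair "scaleC :: complex \<Rightarrow> 'a \<Rightarrow> 'a" "scaleC :: complex \<Rightarrow> 'b \<Rightarrow> 'b"
    by unfold_locales
  have lin: "Vector_Spaces.linear scaleC scaleC F"
    by unfold_locales (simp_all add: bounded_op_add[OF F] bounded_op_scaleC[OF F])
  obtain B where B: "B \<subseteq> M" "\<not> cvec.dependent B" "M \<subseteq> cspan B" "card B = cdim M"
    using cvec.basis_exists by blast
  have "cspan B \<subseteq> M" using B(1) M by (rule cvec.span_minimal)
  have inj: "inj_on F (cspan B)"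
  proof (rule inj_onI)
    fix u v assume uv: "u \<in> cspan B" "v \<in> cspan B" "F u = F v"
    have "F (u - v) = 0" using bounded_op_diff[OF F, of u v] uv(3) by simp
    then have "u - v = 0" using inj cvec.span_diff[OF uv(1,2)] \<open>cspan B \<subseteq> M\<close> by blast
    then show "u = v" by simp
  qed
  have "\<not> cvec.dependent (F ` B)"
    using linear_independent_injective_image[OF lin B(2)] inj by (simp add: cspan_def)
  then have "finite (F ` B)" using independent_card_le_cdim[OF fin] by blast
  then have "finite B" using finite_imageD inj_on_subset[OF inj cvec.span_superset] by blast
  then show ?thesis using B(3) by (auto simp: cfinite_dim_def)
qed

lemma decomposition_imp_attaining:
  fixes A K F :: "'a::complex_hilbert \<Rightarrow> 'a"
  assumes \<alpha>: "0 \<le> \<alpha>" and K: "positive_op UNIV K" "compact_op K" and F: "finite_rank_op F"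
    and A: "\<And>x. A x = \<alpha> *\<^sub>R x + K x + F x"
  shows "absolutely_norm_attaining A"
  unfolding absolutely_norm_attaining_def
proof (intro allI impI, elim conjE)
  fix M :: "'a set" assume M: "closed_csubspace M" and M0: "M \<noteq> {0}"
  note sM = csubspace_closed_csubspace[OF M]
  have bF: "bounded_op UNIV UNIV F" and finF: "cfinite_dim (range F)" using F by (auto simp: finite_rank_op_def)
  note bK = positive_op_bounded[OF K(1)]
  let ?C = "\<lambda>x. K x + F x"
  have bC: "bounded_op UNIV UNIV ?C" by (rule bounded_op_plus[OF bK bF])
  have "bounded_op UNIV UNIV (\<lambda>x. \<alpha> *\<^sub>R x + ?C x)"
    by (intro bounded_op_plus bounded_op_scaleR_fun bounded_op_id bC[THEN bounded_op_UNIV_mem])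
  moreover have "A = (\<lambda>x. \<alpha> *\<^sub>R x + ?C x)" using A by (auto simp: add.assoc)
  ultimately have "bounded_op UNIV UNIV A" by simp
  then have bA: "bounded_op M UNIV A" using bounded_op_subset by blast
  have bCM: "bounded_op M UNIV ?C" using bounded_op_subset[OF bC] by blast
  show "attains_norm M A"
  proof (cases "\<exists>x\<in>M. norm x = 1 \<and> \<alpha> < norm (A x)")
    case True
    show ?thesis
    proof (rule attains_norm_compact_perturbation[OF M bA bCM _ \<alpha> _ True])
      show "norm (A x) \<le> \<alpha> * norm x + norm (K x + F x)" for x
        using norm_triangle_ineq[of "\<alpha> *\<^sub>R x" "?C x"] \<alpha> by (simp add: A add.assoc)
      fix f :: "nat \<Rightarrow> 'a" assume f: "\<And>n. f n \<in> M \<and> norm (f n) = 1"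
      obtain \<phi> l where \<phi>: "strict_mono (\<phi> :: nat \<Rightarrow> nat)" "(\<lambda>n. K (f (\<phi> n))) \<longlonglongrightarrow> l"
        using compact_op_seq[OF K(2), of f] f by auto
      obtain b where b: "b > 0" "\<And>x. norm (F x) \<le> b * norm x" using bounded_op_bound[OF bF] by auto
      have "norm (F (f (\<phi> n))) \<le> b" for n using b(2)[of "f (\<phi> n)"] f by simp
      moreover have "csubspace (range F)"
        using csubspace_image[OF bF] csubspace_closed_csubspace[OF closed_csubspace_UNIV] by blast
      ultimately obtain \<psi> l' where \<psi>: "strict_mono (\<psi> :: nat \<Rightarrow> nat)"
        "((\<lambda>n. F (f (\<phi> n))) \<circ> \<psi>) \<longlonglongrightarrow> l'"
        using cfinite_dim_convergent_subseq[of "range F" "\<lambda>n. F (f (\<phi> n))" b] finF by blast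
      have "(\<lambda>n. K (f (\<phi> (\<psi> n))) + F (f (\<phi> (\<psi> n)))) \<longlonglongrightarrow> l + l'"
        using tendsto_add[OF LIMSEQ_subseq_LIMSEQ[OF \<phi>(2) \<psi>(1)] \<psi>(2)] by (simp add: o_def)
      moreover have "strict_mono (\<phi> \<circ> \<psi>)" using \<phi>(1) \<psi>(1) by (rule strict_mono_o)
      ultimately show "\<exists>\<phi> l. strict_mono (\<phi> :: nat \<Rightarrow> nat) \<and> (\<lambda>n. ?C (f (\<phi> n))) \<longlonglongrightarrow> l"
        by (intro exI[of _ "\<phi> \<circ> \<psi>"] exI[of _ "l + l'"]) (simp add: o_def)
    qed
  next
    case small: False
    have le: "norm (A y) \<le> \<alpha> * norm y" if y: "y \<in> M" for y
    proof (cases "y = 0")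
      case False
      have "(1 / norm y) *\<^sub>R y \<in> M" using csubspace_scaleR[OF sM y] .
      then have "norm (A ((1 / norm y) *\<^sub>R y)) \<le> \<alpha>" using small False by force
      then show ?thesis using bounded_op_scaleR[OF bA y] False by (simp add: field_simps)
    qed (simp add: bounded_op_zero[OF bA sM])
    show ?thesis
    proof (cases "\<exists>x\<in>M. F x = 0 \<and> x \<noteq> 0")
      case True
      then obtain x where x: "x \<in> M" "F x = 0" "x \<noteq> 0" by blast
      define u where "u = (1 / norm x) *\<^sub>R x"
      have u: "u \<in> M" "norm u = 1" "F u = 0"
        using x csubspace_scaleR[OF sM] bounded_op_scaleR[OF bF, of x] by (simp_all add: u_def)
      \<comment> \<open>On the kernel of \<open>F\<close>, positivity of \<open>K\<close> bounds the
        quadratic form of \<open>A\<close> from below by \<alpha>, whereas \<open>le\<close> makes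
        \<alpha> an upper bound on all of \<open>M\<close>; so \<open>u\<close> attains the
        norm.\<close>
      have "\<alpha> \<le> Re (cinner (A u) u)"
        using positive_op_nonneg[OF K(1), of u] u
        by (simp add: A cinner_add_left cinner_scaleR_left Re_cinner_self)
      also have "\<dots> \<le> norm (A u)" using Re_cinner_le[of "A u" u] u by simp
      finally have "\<alpha> * norm y \<le> norm (A u) * norm y" for y :: 'a by (rule mult_right_mono) simp
      then show ?thesis unfolding attains_norm_def using u le order_trans by blast
    next
      case False
      then have "cfinite_dim M" by (intro cfinite_dim_injective[OF sM bF finF]) blast
      then show ?thesis
        using attains_norm_finite_rank[OF M M0 bA bounded_op_image_cfinite_dim[OF bA sM]] by blast
    qed
  qed
qed

text \<open>By total boundedness: a finite net for the bounded part of the range of a close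
  finite-rank \<open>G\<close> is a slightly coarser net for the image of the ball under
  \<open>K\<close>.\<close>

lemma compact_op_limit:
  fixes K :: "'a::complex_hilbert \<Rightarrow> 'b::complex_hilbert"
  assumes K: "bounded_op UNIV UNIV K"
    and approx: "\<And>e. e > 0 \<Longrightarrow> \<exists>G. finite_rank_op G \<and> (\<forall>x. norm (K x - G x) \<le> e * norm x)"
  shows "compact_op K"
  unfolding compact_op_def
proof (intro conjI K)
  let ?S = "K ` cball 0 1"
  have "\<exists>k. finite k \<and> closure ?S \<subseteq> (\<Union>x\<in>k. ball x e)" if e: "e > 0" for e
  proof -
    have "e / 4 > 0" using e by simp
    then obtain G :: "'a \<Rightarrow> 'b" where G: "finite_rank_op G" "\<And>x. norm (K x - G x) \<le> e / 4 * norm x"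
      using approx by blast
    have bG: "bounded_op UNIV UNIV G" and finG: "cfinite_dim (range G)" using G by (auto simp: finite_rank_op_def)
    obtain b where b: "b > 0" "\<And>x. norm (G x) \<le> b * norm x" using bounded_op_bound[OF bG] by auto
    have "csubspace (range G)"
      using csubspace_image[OF bG] csubspace_closed_csubspace[OF closed_csubspace_UNIV] by blast
    then obtain x n where x: "corthonormal x {..<n}" "range G = cspan (x ` {..<n})"
      using corthonormal_basis_exists finG by blast
    obtain C where C: "compact C" "{y \<in> range G. norm y \<le> b} \<subseteq> C"
      using compact_cspan_bounded[OF x(1), of b] unfolding x(2) by (elim exE conjE)
    obtain k where k: "finite k" "C \<subseteq> (\<Union>x\<in>k. ball x (e / 4))"
      using C(1) \<open>e / 4 > 0\<close> unfolding compact_eq_totally_bounded by blast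
    \<comment> \<open>Two errors of at most e / 4 add up. Closed balls make the finite union closed,
      so it also covers the closure, and open balls of radius \<open>e\<close> contain them.\<close>
    have "?S \<subseteq> (\<Union>x\<in>k. cball x (e / 2))"
    proof
      fix y assume "y \<in> ?S"
      then obtain u where u: "norm u \<le> 1" "y = K u" by (auto simp: dist_norm)
      have "norm (G u) \<le> b * 1" using b(2)[of u] mult_left_mono[OF u(1), of b] b(1) by linarith
      then have "G u \<in> C" using C(2) by auto
      then obtain c where c: "c \<in> k" "dist c (G u) < e / 4" using k(2) by auto
      have "norm (K u - G u) \<le> e / 4"
        using order_trans[OF G(2)[of u] mult_left_mono[OF u(1), of "e / 4"]] e by simp
      then have "dist c y \<le> e / 2"
        using c(2) dist_triangle[of c y "G u"] u(2) by (simp add: dist_norm norm_minus_commute)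
      then show "y \<in> (\<Union>x\<in>k. cball x (e / 2))" using c(1) by auto
    qed
    then have "closure ?S \<subseteq> (\<Union>x\<in>k. cball x (e / 2))" using k(1) by (intro closure_minimal closed_UN) auto
    also have "\<dots> \<subseteq> (\<Union>x\<in>k. ball x e)" using e by (intro UN_mono) auto
    finally show ?thesis using k(1) by blast
  qed
  then show "compact (closure ?S)"
    by (simp add: compact_eq_totally_bounded complete_eq_closed)
qed

section \<open>Decomposing an operator that attains its norm on every subspace\<close>

lemma cspan_range_subset_UN: "cspan (range (x :: nat \<Rightarrow> 'a::complex_hilbert)) \<subseteq> (\<Union>n. cspan (x ` {..<n}))"
proof (rule cvec.span_minimal)
  show "range x \<subseteq> (\<Union>n. cspan (x ` {..<n}))"
  proof clarify
    fix i show "x i \<in> (\<Union>n. cspan (x ` {..<n}))"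
      by (rule UN_I[of "Suc i"]) (auto intro: cvec.span_base)
  qed
  have mono: "cspan (x ` {..<m}) \<subseteq> cspan (x ` {..<n})" if "m \<le> n" for m n
    using that by (intro cvec.span_mono image_mono) auto
  show "csubspace (\<Union>n. cspan (x ` {..<n}))"
  proof (rule cvec.subspaceI)
    show "0 \<in> (\<Union>n. cspan (x ` {..<n}))" using cvec.span_zero by blast
    show "c *\<^sub>C u \<in> (\<Union>n. cspan (x ` {..<n}))" if "u \<in> (\<Union>n. cspan (x ` {..<n}))" for c u
      using that cvec.span_scale by blast
    fix u v assume "u \<in> (\<Union>n. cspan (x ` {..<n}))" "v \<in> (\<Union>n. cspan (x ` {..<n}))"
    then obtain m n where "u \<in> cspan (x ` {..<m})" "v \<in> cspan (x ` {..<n})" by blast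
    then have "u \<in> cspan (x ` {..<max m n})" "v \<in> cspan (x ` {..<max m n})"
      using mono[of m "max m n"] mono[of n "max m n"] by auto
    then show "u + v \<in> (\<Union>n. cspan (x ` {..<n}))" using cvec.span_add by blast
  qed
qed

text \<open>Taking residuals kills the span of the first \<open>n\<close> vectors, so
  \<open>y\<close> and \<open>y - v\<close> have the same residual, and a residual is no longer than
  its vector.\<close>

lemma oproj_approximates:
  fixes x :: "nat \<Rightarrow> 'a::complex_hilbert"
  assumes x: "\<And>n. corthonormal x {..<n}" and y: "y \<in> closure (cspan (range x))" and e: "e > 0"
  shows "\<exists>n. norm (y - oproj x n y) < e"
proof -
  obtain v where v: "v \<in> cspan (range x)" "dist v y < e" using y e unfolding closure_approachable by blast
  obtain n where n: "v \<in> cspan (x ` {..<n})" using v(1) cspan_range_subset_UN by blast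
  have eq: "y - v - oproj x n (y - v) = y - oproj x n y"
    using oproj_id[OF x n] oproj_add[of x n "y - v" v] by simp
  have "norm (y - oproj x n y) \<le> norm (y - v)"
    using norm_diff_oproj_le[OF x, of "y - v" n] unfolding eq .
  then show ?thesis using v(2) by (intro exI[of _ n]) (simp add: dist_norm norm_minus_commute)
qed

text \<open>The maximizer \<open>x\<close> of \<open>|A y|\<close> on the closed span of the \<open>w n\<close> is an eigenvector of the modulus of
  the restriction of \<open>A\<close>, so it is orthogonal to every \<open>w n\<close>.\<close>

lemma not_attaining_diagonal:
  fixes A :: "'a::complex_hilbert \<Rightarrow> 'a"
  assumes A: "positive_op UNIV A" and w1: "\<And>n. norm (w n) = 1"
    and ort: "\<And>i j :: nat. i \<noteq> j \<Longrightarrow> cinner (w i) (w j) = 0"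
    and Aort: "\<And>i j. i \<noteq> j \<Longrightarrow> cinner (A (w i)) (A (w j)) = 0"
    and lt: "\<And>n. norm (A (w n)) < \<alpha>" and lim: "(\<lambda>n. norm (A (w n))) \<longlonglongrightarrow> \<alpha>"
  shows "\<not> absolutely_norm_attaining A"
proof
  assume AN: "absolutely_norm_attaining A"
  note bA = positive_op_bounded[OF A]
  define M where "M = closure (cspan (range w))"
  have M: "closed_csubspace M" unfolding M_def by (rule closed_csubspace_closure_cspan)
  note sM = csubspace_closed_csubspace[OF M]
  have wM: "w n \<in> M" for n
    unfolding M_def using closure_subset cvec.span_base[of "w n" "range w"] by blast
  have "w 0 \<noteq> 0" using w1[of 0] by auto
  then have "M \<noteq> {0}" using wM by blast
  then obtain x where x: "x \<in> M" "norm x = 1" and max: "\<And>y. y \<in> M \<Longrightarrow> norm (A y) \<le> norm (A x) * norm y"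
    using AN M unfolding absolutely_norm_attaining_def attains_norm_def by metis
  define \<nu> where "\<nu> = norm (A x)"
  have "\<exists>N. \<forall>n\<ge>N. norm (A (w n)) \<le> \<nu>" using max[OF wM] w1 by (simp add: \<nu>_def)
  then have "\<alpha> \<le> \<nu>" using LIMSEQ_le_const2[OF lim] by blast
  have AM: "bounded_op M UNIV A" using bounded_op_subset[OF bA] by blast
  define B where "B = abs_op M A"
  have B: "positive_op M B" unfolding B_def by (rule positive_op_abs_op[OF M AM])
  have nB: "norm (B y) = norm (A y)" if "y \<in> M" for y unfolding B_def by (rule norm_abs_op[OF M AM that])
  have "B x = norm (B x) *\<^sub>R x"
    by (rule maximizer_eigenvector[OF sM B x]) (use max nB x in simp)
  then have Bx: "B x = \<nu> *\<^sub>R x" using nB[OF x(1)] by (simp add: \<nu>_def)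
  have "cinner x (w n) = 0" for n
  proof -
    define g where "g = (norm (A (w n)))\<^sup>2"
    have "cinner (A x) (A (w n)) = cinner (B x) (B (w n))"
      unfolding B_def by (rule cinner_abs_op[OF M AM x(1) wM, symmetric])
    also have "\<dots> = \<nu> *\<^sub>R cinner x (B (w n))" by (simp add: Bx cinner_scaleR_left)
    also have "cinner x (B (w n)) = cinner (B x) (w n)"
      using positive_op_symmetric[OF B sM x(1) wM] by simp
    also have "\<dots> = \<nu> *\<^sub>R cinner x (w n)" by (simp add: Bx cinner_scaleR_left)
    finally have 1: "cinner (A x) (A (w n)) = (\<nu>\<^sup>2) *\<^sub>R cinner x (w n)" by (simp add: power2_eq_square)
    have sym: "cinner (A u) (A (w n)) = cinner u (A (A (w n)))" for u
      using positive_op_symmetric[OF A csubspace_closed_csubspace[OF closed_csubspace_UNIV]] by simp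
    \<comment> \<open>The orthogonality hypotheses say that A^2 compressed to \<open>M\<close> is
      diagonal: \<open>A (A (w n)) - g *\<^sub>R w n\<close> is orthogonal to \<open>M\<close>.
      Pairing \<open>A x\<close> with \<open>A (w n)\<close> therefore gives the factor
      \<open>g\<close>, while the eigenvalue of the modulus gives \<nu>^2; since g < \<nu>^2,
      \<open>x\<close> is orthogonal to \<open>w n\<close>.\<close>
    have "w i \<in> ocompl {A (A (w n)) - g *\<^sub>R w n}" for i
    proof (cases "i = n")
      case True
      have "cinner (w n) (A (A (w n))) = complex_of_real g"
        using sym[of "w n"] by (simp add: g_def cinner_self)
      then show ?thesis
        using w1[of n] True by (simp add: ocompl_def cinner.diff_right cinner_scaleR_right cinner_self scaleR_conv_of_real)
    next
      case False
      then show ?thesis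
        using sym[of "w i"] Aort[OF False] ort[OF False]
        by (simp add: ocompl_def cinner.diff_right cinner_scaleR_right)
    qed
    then have "M \<subseteq> ocompl {A (A (w n)) - g *\<^sub>R w n}"
      unfolding M_def by (intro closure_cspan_minimal closed_csubspace_ocompl) auto
    then have "cinner x (A (A (w n)) - g *\<^sub>R w n) = 0" using x(1) by (auto simp: ocompl_def)
    then have "cinner (A x) (A (w n)) = g *\<^sub>R cinner x (w n)"
      by (simp add: sym cinner.diff_right cinner_scaleR_right)
    with 1 have "(\<nu>\<^sup>2 - g) *\<^sub>R cinner x (w n) = 0" by (auto simp: scaleR_diff_left)
    moreover have "g < \<nu>\<^sup>2"
      unfolding g_def using lt[of n] \<open>\<alpha> \<le> \<nu>\<close> by (intro power_strict_mono) auto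
    ultimately show ?thesis by simp
  qed
  then have "x \<in> ocompl M" unfolding M_def ocompl_closure_cspan by (auto simp: ocompl_def)
  then have "cinner x x = 0" using x(1) by (auto simp: ocompl_def)
  then show False using x(2) by simp
qed


text \<open>Here \<open>N\<close> is the part of the space where \<open>A \<le> \<alpha>\<close>. If \<open>\<alpha> - A\<close> had infinite rank on \<open>N\<close>, there would
  be \<open>z n \<in> N\<close> orthonormal with orthogonal images and \<open>|A (z n)| < \<alpha>\<close>; a suitable mixture of \<open>z n\<close>
  with the eigenvector \<open>x n\<close> then has image norm increasing to \<open>\<alpha>\<close> without reaching it.\<close>

lemma attaining_finite_rank_below:
  fixes A :: "'a::complex_hilbert \<Rightarrow> 'a"
  assumes A: "positive_op UNIV A" and AN: "absolutely_norm_attaining A"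
    and x: "\<And>n. corthonormal x {..<n}" and ev: "\<And>n. A (x n) = a n *\<^sub>R x n"
    and \<alpha>: "0 \<le> \<alpha>" "\<And>n. \<alpha> \<le> a n"
    and N: "N = ocompl (range x)" and le: "\<And>y. y \<in> N \<Longrightarrow> norm (A y) \<le> \<alpha> * norm y"
  obtains S where "finite S" "S \<subseteq> N" "\<And>z. z \<in> N \<inter> ocompl S \<Longrightarrow> A z = \<alpha> *\<^sub>R z"
proof -
  note bA = positive_op_bounded[OF A]
  have sN: "csubspace N" unfolding N by (rule csubspace_ocompl)
  have inv: "A y \<in> N" if "y \<in> N" for y
    using eigenvectors_ocompl_invariant[OF A _ _ ev, where I = UNIV] that unfolding N by auto
  have pN: "positive_op N A"
    using A inv by (auto simp: positive_op_def bounded_op_def)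
  have sym: "cinner (A u) v = cinner u (A v)" for u v
    using positive_op_symmetric[OF A] by simp
  \<comment> \<open>A unit vector on which \<open>A\<close> falls short of \<alpha>; orthogonality
    is demanded of the vectors and of their images because \<open>not_attaining_diagonal\<close>
    asks for both.\<close>
  let ?Q = "\<lambda>S z. z \<in> N \<and> norm z = 1 \<and> norm (A z) < \<alpha> \<and> (\<forall>s\<in>S. cinner z s = 0 \<and> cinner (A z) (A s) = 0)"
  have "\<exists>S. finite S \<and> S \<subseteq> N \<and> \<not> (\<exists>z. ?Q S z)"
  proof (rule ccontr)
    assume "\<nexists>S. finite S \<and> S \<subseteq> N \<and> \<not> (\<exists>z. ?Q S z)"
    then have ex: "\<exists>z. ?Q S z" if "finite S" "S \<subseteq> N" for S using that by blast
    have "\<exists>z :: nat \<Rightarrow> 'a. \<forall>n. ?Q (z ` {..<n}) (z n)"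
    proof (rule dependent_wellorder_choice[where P = "\<lambda>f (n::nat) r. ?Q (f ` {..<n}) r"])
      fix r :: 'a and f g :: "nat \<Rightarrow> 'a" and n assume "\<And>y. y < n \<Longrightarrow> f y = g y"
      then have "f ` {..<n} = g ` {..<n}" by (intro image_cong) auto
      then show "?Q (f ` {..<n}) r = ?Q (g ` {..<n}) r" by simp
    next
      fix n and f :: "nat \<Rightarrow> 'a" assume "\<And>y. y < n \<Longrightarrow> ?Q (f ` {..<y}) (f y)"
      then have "f ` {..<n} \<subseteq> N" by auto
      then show "\<exists>r. ?Q (f ` {..<n}) r" by (intro ex) simp_all
    qed
    then obtain z :: "nat \<Rightarrow> 'a" where z: "\<forall>n. ?Q (z ` {..<n}) (z n)" ..
    have zN: "z n \<in> N" and z1: "norm (z n) = 1" and zlt: "norm (A (z n)) < \<alpha>" for n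
      using z by blast+
    have z0: "cinner (z i) (z j) = 0 \<and> cinner (A (z i)) (A (z j)) = 0" if "i \<noteq> j" for i j
    proof (cases "j < i")
      case True
      then show ?thesis using z by blast
    next
      case False
      then have "cinner (z j) (z i) = 0 \<and> cinner (A (z j)) (A (z i)) = 0" using z that by auto
      then show ?thesis using cinner_eq_0_commute by blast
    qed
    have xz: "cinner (x i) (z j) = 0" and Axz: "cinner (A (x i)) (A (z j)) = 0" for i j
      using zN[of j] inv[OF zN, of j] cinner_eq_0_commute[of "x i"]
      by (simp_all add: N ocompl_def ev cinner_scaleR_left)
    have x0: "cinner (x i) (x j) = 0" if "i \<noteq> j" for i j
      using x[of "Suc (max i j)"] that by (auto simp: corthonormal_def)
    have x1: "norm (x i) = 1" for i using corthonormal_norm[OF x[of "Suc i"]] by simp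
    have \<alpha>0: "0 < \<alpha>" using zlt[of 0] by (meson le_less_trans norm_ge_zero)
    define b where "b = (\<lambda>n. norm (A (z n)))"
    have b: "0 \<le> b n" "b n < \<alpha>" for n using zlt by (auto simp: b_def)
    have b2: "(b n)\<^sup>2 < \<alpha>\<^sup>2" "\<alpha>\<^sup>2 \<le> (a n)\<^sup>2" for n
      using b[of n] \<alpha>(2)[of n] \<alpha>(1) by (auto intro: power_strict_mono power_mono)
    \<comment> \<open>The target for the squared image norm of the mixture. The numbers
      \<open>b n\<close> need not tend to \<alpha>, so the target is raised from
      \<open>(b n)\<^sup>2\<close>, staying strictly below \<alpha>^2 and within \<alpha>^2 / (n +
      1) of it.\<close>
    define g where "g = (\<lambda>n. \<alpha>\<^sup>2 - (\<alpha>\<^sup>2 - (b n)\<^sup>2) * inverse (real (Suc n)))"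
    have g: "(b n)\<^sup>2 \<le> g n" "g n < \<alpha>\<^sup>2" "\<bar>g n - \<alpha>\<^sup>2\<bar> \<le> \<alpha>\<^sup>2 * inverse (real (Suc n))" for n
    proof -
      have i: "0 < inverse (real (Suc n))" "inverse (real (Suc n)) \<le> 1" by (simp_all add: inverse_le_1_iff)
      have d: "0 < \<alpha>\<^sup>2 - (b n)\<^sup>2" using b2 by simp
      show "(b n)\<^sup>2 \<le> g n" using mult_left_mono[OF i(2) less_imp_le[OF d]]
        by (simp only: g_def mult_1_right le_diff_eq add.commute)
      show "g n < \<alpha>\<^sup>2" using mult_pos_pos[OF d i(1)] by (simp add: g_def)
      have "(\<alpha>\<^sup>2 - (b n)\<^sup>2) * inverse (real (Suc n)) \<le> \<alpha>\<^sup>2 * inverse (real (Suc n))"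
        using i by (intro mult_right_mono) auto
      then show "\<bar>g n - \<alpha>\<^sup>2\<bar> \<le> \<alpha>\<^sup>2 * inverse (real (Suc n))"
        using mult_pos_pos[OF d i(1)] by (simp add: g_def)
    qed
    \<comment> \<open>The mixing weight that solves (1 - t) a^2 + t b^2 = g; it lies in [0, 1]
      because b^2 <= g < \<alpha>^2 <= a^2.\<close>
    define t where "t = (\<lambda>n. ((a n)\<^sup>2 - g n) / ((a n)\<^sup>2 - (b n)\<^sup>2))"
    have ab: "(a n)\<^sup>2 - (b n)\<^sup>2 > 0" for n using b2[of n] by linarith
    have t: "0 \<le> t n" "t n \<le> 1" "(1 - t n) * (a n)\<^sup>2 + t n * (b n)\<^sup>2 = g n" for n
    proof -
      show "0 \<le> t n" using ab[of n] g(2)[of n] b2(2)[of n] by (simp add: t_def)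
      show "t n \<le> 1" using ab[of n] g(1)[of n] by (simp add: t_def)
      have "t n * ((a n)\<^sup>2 - (b n)\<^sup>2) = (a n)\<^sup>2 - g n" using ab[of n] by (simp add: t_def)
      then show "(1 - t n) * (a n)\<^sup>2 + t n * (b n)\<^sup>2 = g n" by (simp add: algebra_simps)
    qed
    define w where "w = (\<lambda>n. sqrt (1 - t n) *\<^sub>R x n + sqrt (t n) *\<^sub>R z n)"
    have Aw: "A (w n) = sqrt (1 - t n) *\<^sub>R A (x n) + sqrt (t n) *\<^sub>R A (z n)" for n
      by (simp add: w_def bounded_op_add[OF bA] bounded_op_scaleR[OF bA])
    have pyth: "(norm (sqrt (1 - t n) *\<^sub>R u + sqrt (t n) *\<^sub>R v))\<^sup>2 = (1 - t n) * (norm u)\<^sup>2 + t n * (norm v)\<^sup>2"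
      if "cinner u v = 0" for u v :: 'a and n
      using t[of n] that by (simp add: norm_sq_add cinner_scaleR_left cinner_scaleR_right power_mult_distrib)
    have "(norm (w n))\<^sup>2 = 1\<^sup>2" for n unfolding w_def pyth[OF xz] by (simp add: x1 z1)
    then have w1: "norm (w n) = 1" for n by (rule power2_eq_imp_eq) simp_all
    have "(norm (A (w n)))\<^sup>2 = g n" for n
      unfolding Aw pyth[OF Axz] using t(3)[of n] by (simp add: ev x1 b_def)
    then have nAw: "norm (A (w n)) = sqrt (g n)" for n by (metis norm_ge_zero real_sqrt_unique)
    have zx: "cinner (z i) (x j) = 0" and Azx: "cinner (A (z i)) (A (x j)) = 0" for i j
      using xz Axz cinner_eq_0_commute by blast+
    have "\<not> absolutely_norm_attaining A"
    proof (rule not_attaining_diagonal[OF A w1, where \<alpha> = \<alpha>])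
      show "cinner (w i) (w j) = 0" if "i \<noteq> j" for i j
        using x0[OF that] z0[OF that]
        by (simp add: w_def cinner_add_left cinner_add_right cinner_scaleR_left cinner_scaleR_right xz zx)
      show "cinner (A (w i)) (A (w j)) = 0" if "i \<noteq> j" for i j
      proof -
        have "cinner (A (x i)) (A (x j)) = 0"
          using x0[OF that] by (simp add: ev cinner_scaleR_left cinner_scaleR_right)
        then show ?thesis
          using z0[OF that]
          by (simp add: Aw cinner_add_left cinner_add_right cinner_scaleR_left cinner_scaleR_right Axz Azx)
      qed
      show "norm (A (w n)) < \<alpha>" for n
        unfolding nAw using g(2)[of n] \<alpha>0 by (intro real_less_lsqrt) auto
      have "(\<lambda>n. \<alpha>\<^sup>2 * inverse (real (Suc n))) \<longlonglongrightarrow> \<alpha>\<^sup>2 * 0"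
        by (intro tendsto_intros LIMSEQ_inverse_real_of_nat)
      then have "(\<lambda>n. \<alpha>\<^sup>2 * inverse (real (Suc n))) \<longlonglongrightarrow> 0" by simp
      then have "g \<longlonglongrightarrow> \<alpha>\<^sup>2"
        by (rule LIMSEQ_norm_comparison[rotated]) (use g(3) in \<open>simp only: real_norm_def\<close>)
      then have "(\<lambda>n. sqrt (g n)) \<longlonglongrightarrow> sqrt (\<alpha>\<^sup>2)" by (rule tendsto_real_sqrt)
      then show "(\<lambda>n. norm (A (w n))) \<longlonglongrightarrow> \<alpha>" using \<alpha>0 by (simp add: nAw)
    qed
    then show False using AN by contradiction
  qed
  then obtain S where S: "finite S" "S \<subseteq> N" "\<not> (\<exists>z. ?Q S z)" by (elim exE conjE)
  \<comment> \<open>The vectors \<open>A (A s)\<close> encode orthogonality of images, since <A u, A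
    s> = <u, A (A s)>. In the complement of \<open>S'\<close> within \<open>N\<close> no candidate
    is left, so every unit vector there has image norm exactly \<alpha> and is a maximizer on
    \<open>N\<close>.\<close>
  define S' where "S' = S \<union> (\<lambda>s. A (A s)) ` S"
  show ?thesis
  proof (rule that[of S'])
    show "finite S'" using S(1) by (simp add: S'_def)
    show "S' \<subseteq> N" using S(2) inv by (auto simp: S'_def)
    fix y assume y: "y \<in> N \<inter> ocompl S'"
    show "A y = \<alpha> *\<^sub>R y"
    proof (cases "y = 0")
      case True
      then show ?thesis using bounded_op_zero[OF bA] by simp
    next
      case False
      define u where "u = (1 / norm y) *\<^sub>R y"
      have u: "u \<in> N" "norm u = 1" "u \<in> ocompl S'"
        using y False csubspace_scaleR sN csubspace_ocompl unfolding u_def by auto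
      have "\<forall>s\<in>S. cinner u s = 0 \<and> cinner (A u) (A s) = 0"
        using u(3) by (auto simp: S'_def ocompl_def sym)
      then have "\<not> norm (A u) < \<alpha>" using S(3) u by blast
      then have nu: "norm (A u) = \<alpha>" using le[OF u(1)] u(2) by simp
      have "A u = norm (A u) *\<^sub>R u"
        by (rule maximizer_eigenvector[OF sN pN u(1,2)]) (use le nu in simp)
      then have "A u = \<alpha> *\<^sub>R u" using nu by simp
      moreover have y_eq: "y = norm y *\<^sub>R u" using False by (simp add: u_def)
      then have "A y = norm y *\<^sub>R A u" using bounded_op_scaleR[OF bA, of u "norm y"] by simp
      ultimately have "A y = \<alpha> *\<^sub>R (norm y *\<^sub>R u)" by simp
      then show ?thesis using y_eq by simp
    qed
  qed
qed

lemma self_adjoint_opI: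
  assumes "bounded_op UNIV UNIV F" "\<And>x y. cinner (F x) y = cinner x (F y)"
  shows "self_adjoint_op F"
  unfolding self_adjoint_op_def
  using assms adjoint_op_eqI[of UNIV _ F] by (auto simp: fun_eq_iff)

lemma attaining_imp_decomposition:
  fixes A :: "'a::complex_hilbert \<Rightarrow> 'a"
  assumes A: "positive_op UNIV A" and AN: "absolutely_norm_attaining A"
  shows "\<exists>\<alpha>::real. \<exists>K F. \<alpha> \<ge> 0 \<and> positive_op UNIV K \<and> compact_op K \<and>
    self_adjoint_op F \<and> finite_rank_op F \<and> (\<forall>x. A x = \<alpha> *\<^sub>R x + K x + F x)"
proof -
  note bA = positive_op_bounded[OF A]
  have sym: "cinner (A u) v = cinner u (A v)" for u v
    using positive_op_symmetric[OF A] by simp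
  show ?thesis
  \<comment> \<open>In finite dimension the greedy sequence ends, and \<alpha> = 0, K = 0, F = A is
    a decomposition.\<close>
  proof (cases "cfinite_dim (UNIV :: 'a set)")
    case True
    have zero: "bounded_op UNIV UNIV (\<lambda>x::'a. 0::'a)" by (auto simp: bounded_op_def intro: exI[of _ 0])
    then have "positive_op UNIV (\<lambda>x::'a. 0::'a)"
      by (rule positive_opI) (simp_all add: cinner.zero_left cinner.zero_right)
    moreover have "compact_op (\<lambda>x::'a. 0::'a)"
      using zero by (auto simp: compact_op_def image_constant_conv)
    moreover have "self_adjoint_op A" using bA sym by (rule self_adjoint_opI)
    moreover have "finite_rank_op A"
      using bA cfinite_dim_subset[OF True] by (simp add: finite_rank_op_def)
    ultimately show ?thesis by (intro exI[of _ 0] exI[of _ "\<lambda>x. 0"] exI[of _ A]) simp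
  next
    case infin: False
    have "attains_norm (UNIV \<inter> ocompl S) A" if "UNIV \<inter> ocompl S \<noteq> {0}" for S
      using AN[unfolded absolutely_norm_attaining_def, rule_format, of "ocompl S"] that
        closed_csubspace_ocompl by auto
    from greedy_eigenvectors[OF closed_csubspace_UNIV A this] infin obtain x :: "nat \<Rightarrow> 'a"
      where x: "\<And>n. corthonormal x {..<n}" and ev0: "\<And>n j. j < n \<Longrightarrow> A (x j) = norm (A (x j)) *\<^sub>R x j"
        and le0: "\<And>n j y. j < n \<Longrightarrow> y \<in> ocompl (x ` {..<j}) \<Longrightarrow> norm (A y) \<le> norm (A (x j)) * norm y"
      by auto
    define a where "a = (\<lambda>n. norm (A (x n)))"
    have ev: "A (x n) = a n *\<^sub>R x n" for n using ev0[of n "Suc n"] by (simp add: a_def)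
    have le: "norm (A y) \<le> a n * norm y" if "y \<in> ocompl (x ` {..<n})" for n y
      using le0[of n "Suc n" y] that by (simp add: a_def)
    have x1: "norm (x i) = 1" for i using corthonormal_norm[OF x[of "Suc i"]] by simp
    have "a (Suc n) \<le> a n" for n
      using le[of "x (Suc n)" n] corthonormal_ocompl[OF x[of "Suc (Suc n)"], of n "Suc n"] x1
      by (simp add: a_def)
    then have "decseq a" by (rule decseq_SucI)
    moreover have "\<And>n. 0 \<le> a n" by (simp add: a_def)
    ultimately obtain \<alpha> where \<alpha>: "a \<longlonglongrightarrow> \<alpha>" "\<And>n. \<alpha> \<le> a n"
      using decseq_convergent[of a 0] by blast
    have \<alpha>0: "0 \<le> \<alpha>" using LIMSEQ_le_const[OF \<alpha>(1), of 0] by (simp add: a_def)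
    define W where "W = closure (cspan (range x))"
    define N where "N = ocompl (range x)"
    have W: "closed_csubspace W" unfolding W_def by (rule closed_csubspace_closure_cspan)
    have NW: "N = ocompl W" by (simp add: N_def W_def ocompl_closure_cspan)
    have xW: "x n \<in> W" for n
      unfolding W_def using closure_subset cvec.span_base[of "x n" "range x"] by blast
    have leN: "norm (A y) \<le> \<alpha> * norm y" if "y \<in> N" for y
    proof (rule LIMSEQ_le_const)
      show "(\<lambda>n. a n * norm y) \<longlonglongrightarrow> \<alpha> * norm y" by (intro tendsto_intros \<alpha>)
      have "y \<in> ocompl (x ` {..<n})" for n using that by (auto simp: N_def ocompl_def)
      then show "\<exists>N. \<forall>n\<ge>N. norm (A y) \<le> a n * norm y" using le by blast
    qed
    have invN: "A y \<in> N" if "y \<in> N" for y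
      using eigenvectors_ocompl_invariant[OF A _ _ ev, where I = UNIV] that unfolding N_def by auto
    define P where "P = proj_op W"
    have P: "P y \<in> W" "y - P y \<in> N" for y using proj_op[OF W] by (simp_all add: P_def NW)
    have bP: "bounded_op UNIV UNIV P" unfolding P_def by (rule bounded_op_proj_op[OF W])
    define B where "B = (\<lambda>y. A y - \<alpha> *\<^sub>R y)"
    have bB: "bounded_op UNIV UNIV B"
      unfolding B_def by (intro bounded_op_minus bA bounded_op_scaleR_fun bounded_op_id)
    have Bsym: "cinner (B u) v = cinner u (B v)" for u v
      by (simp add: B_def cinner.diff_left cinner.diff_right sym cinner_scaleR_left cinner_scaleR_right)
    have BN: "B y \<in> N" if "y \<in> N" for y
      unfolding B_def N_def using that invN csubspace_ocompl
      by (intro cvec.subspace_diff csubspace_scaleR) (auto simp: N_def)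
    have ortho: "cinner (B w) v = 0" if "w \<in> W" "v \<in> N" for w v
      unfolding Bsym using BN[OF that(2)] that(1) cinner_eq_0_commute[of w "B v"] by (auto simp: NW ocompl_def)
    \<comment> \<open>\<open>B\<close> maps \<open>N\<close> into itself and \<open>W\<close> into
      the complement of \<open>N\<close>, so \<open>K\<close> and \<open>F\<close> are its two
      diagonal blocks; the cross terms vanish by \<open>ortho\<close>.\<close>
    define K where "K = (\<lambda>y. B (P y))"
    define F where "F = (\<lambda>y. B (y - P y))"
    have bK: "bounded_op UNIV UNIV K" unfolding K_def by (rule bounded_op_comp[OF bB bP])
    have bF: "bounded_op UNIV UNIV F"
      unfolding F_def by (rule bounded_op_comp[OF bB bounded_op_minus[OF bounded_op_id bP]])
    have Kform: "cinner (K u) v = cinner (B (P u)) (P v)" for u v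
      using ortho[OF P(1) P(2), of u v] by (simp add: K_def cinner.diff_right)
    have Ksym: "cinner (K u) v = cinner u (K v)" for u v
      using Kform[of u v] Kform[of v u] Bsym[of "P u" "P v"]
      by (metis cinner_commute)
    \<comment> \<open>A lower bound that survives the passage to the closed span: on the span of the
      first \<open>n\<close> eigenvectors the form of \<open>B\<close> has weights a i - \<alpha> >=
      0, and on its complement positivity of \<open>A\<close> leaves at worst - \<alpha> times the
      squared residual, which can be made small for \<open>y\<close> in \<open>W\<close>.\<close>
    have BW: "- \<alpha> * (norm (y - oproj x n y))\<^sup>2 \<le> Re (cinner (B y) y)" for y n
    proof -
      define q where "q = oproj x n y"
      define u where "u = y - q"
      have u: "u \<in> ocompl (x ` {..<n})" unfolding u_def q_def by (rule diff_oproj_ocompl[OF x])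
      have Bq: "B q = (\<Sum>i<n. ((a i - \<alpha>) *\<^sub>R cinner y (x i)) *\<^sub>C x i)"
      proof -
        have "B q = (\<Sum>i<n. B (cinner y (x i) *\<^sub>C x i))"
          unfolding q_def oproj_def by (rule bounded_op_sum[OF bB]) auto
        also have "\<dots> = (\<Sum>i<n. ((a i - \<alpha>) *\<^sub>R cinner y (x i)) *\<^sub>C x i)"
        proof (intro sum.cong refl)
          fix i
          have "B (x i) = (a i - \<alpha>) *\<^sub>R x i" by (simp add: B_def ev scaleR_diff_left)
          then show "B (cinner y (x i) *\<^sub>C x i) = ((a i - \<alpha>) *\<^sub>R cinner y (x i)) *\<^sub>C x i"
            using bounded_op_scaleC[OF bB, of "x i" "cinner y (x i)"]
            by (simp only: UNIV_I scaleC_scaleR scaleC.scaleR_left)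
        qed
        finally show ?thesis .
      qed
      have qi: "cinner (x i) q = cnj (cinner y (x i))" if "i < n" for i
      proof -
        have "cinner (y - q) (x i) = 0" using u that by (auto simp: u_def ocompl_def)
        then have "cinner q (x i) = cinner y (x i)" by (simp add: cinner.diff_left)
        then show ?thesis using cinner_commute[of "x i" q] by simp
      qed
      have "Re (cinner (B q) q) = (\<Sum>i<n. (a i - \<alpha>) * (cmod (cinner y (x i)))\<^sup>2)"
        unfolding Bq cinner.sum_left cinner_scaleC_left Re_sum
        using qi by (intro sum.cong) (auto simp flip: complex_norm_square)
      then have 1: "0 \<le> Re (cinner (B q) q)"
        using \<alpha>(2) by (auto intro!: sum_nonneg mult_nonneg_nonneg)
      have "cinner (B q) u = 0"
        unfolding Bq cinner.sum_left cinner_scaleC_left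
        using u cinner_eq_0_commute[of _ u] by (intro sum.neutral) (auto simp: ocompl_def)
      moreover have "cinner (B u) q = 0" unfolding Bsym using calculation cinner_eq_0_commute by blast
      moreover have "B y = B q + B u" using bounded_op_add[OF bB, of q u] by (simp add: u_def)
      moreover have "y = q + u" by (simp add: u_def)
      ultimately have "cinner (B y) y = cinner (B q) q + cinner (B u) u"
        by (metis (no_types, lifting) add.right_neutral add_0 cinner_add_left cinner_add_right)
      moreover have "- \<alpha> * (norm u)\<^sup>2 \<le> Re (cinner (B u) u)"
        using positive_op_nonneg[OF A, of u]
        by (simp add: B_def cinner.diff_left cinner_scaleR_left Re_cinner_self)
      ultimately show ?thesis using 1 by (simp add: u_def q_def)
    qed
    have BWpos: "0 \<le> Re (cinner (B y) y)" if y: "y \<in> W" for y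
    proof (rule field_le_epsilon)
      fix e :: real assume e: "e > 0"
      \<comment> \<open>Makes the error \<alpha> d^2 at most \<open>e\<close>; the added 1 covers
        \<alpha> = 0.\<close>
      define d where "d = sqrt (e / (\<alpha> + 1))"
      have "d > 0" using e \<alpha>0 by (simp add: d_def)
      then obtain n where n: "norm (y - oproj x n y) < d"
        using oproj_approximates[OF x, of y] y by (auto simp: W_def)
      have "(norm (y - oproj x n y))\<^sup>2 \<le> d\<^sup>2" using n by (intro power_mono) auto
      also have "d\<^sup>2 = e / (\<alpha> + 1)" using e \<alpha>0 by (simp add: d_def)
      finally have "\<alpha> * (norm (y - oproj x n y))\<^sup>2 \<le> \<alpha> * (e / (\<alpha> + 1))" using \<alpha>0 by (rule mult_left_mono)
      also have "\<dots> \<le> e" using e \<alpha>0 by (simp add: pos_divide_le_eq algebra_simps)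
      finally show "0 \<le> Re (cinner (B y) y) + e" using BW[of y n] by simp
    qed
    have Kpos: "positive_op UNIV K"
      by (rule positive_opI[OF bK Ksym]) (use BWpos[OF P(1)] Kform in simp)
    have "compact_op K"
    proof (rule compact_op_limit[OF bK])
      fix e :: real assume e: "e > 0"
      have "(\<lambda>n. (a n)\<^sup>2 - \<alpha>\<^sup>2) \<longlonglongrightarrow> \<alpha>\<^sup>2 - \<alpha>\<^sup>2" by (intro tendsto_intros \<alpha>)
      then have "\<forall>\<^sub>F n in sequentially. (a n)\<^sup>2 - \<alpha>\<^sup>2 < e\<^sup>2" using e by (intro order_tendstoD(2)) auto
      then obtain n where n: "(a n)\<^sup>2 - \<alpha>\<^sup>2 < e\<^sup>2" by (auto simp: eventually_sequentially)
      let ?G = "\<lambda>y. B (oproj x n y)"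
      have "bounded_op UNIV UNIV ?G" by (rule bounded_op_comp[OF bB bounded_op_oproj[OF x]])
      moreover have "cfinite_dim (B ` cspan (x ` {..<n}))"
        by (rule bounded_op_image_cfinite_dim[OF bounded_op_subset[OF bB]])
          (simp_all add: cfinite_dim_cspan)
      then have "cfinite_dim (range ?G)"
        by (rule cfinite_dim_subset) (auto intro: oproj_in_cspan)
      ultimately have "finite_rank_op ?G" by (simp add: finite_rank_op_def)
      moreover have "norm (K y - ?G y) \<le> e * norm y" for y
      proof -
        define v where "v = P y - oproj x n y"
        have "oproj x n (y - P y) = 0" using P(2)[of y] by (intro oproj_ocompl) (auto simp: N_def ocompl_def)
        then have oP: "oproj x n y = oproj x n (P y)" using oproj_add[of x n "y - P y" "P y"] by simp
        have "x ` {..<n} \<subseteq> W" using xW by blast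
        then have "oproj x n y \<in> W"
          using oproj_in_cspan[of x n y] cvec.span_minimal csubspace_closed_csubspace[OF W] by blast
        then have vW: "v \<in> W"
          unfolding v_def using P(1) csubspace_closed_csubspace[OF W] cvec.subspace_diff by blast
        have vn: "v \<in> ocompl (x ` {..<n})" unfolding v_def oP by (rule diff_oproj_ocompl[OF x])
        have "norm v \<le> norm (P y)" unfolding v_def oP by (rule norm_diff_oproj_le[OF x])
        also have "\<dots> \<le> norm y"
        proof -
          have "cinner (y - P y) (P y) = 0" using P[of y] by (auto simp: NW ocompl_def)
          from pythagoras[OF this] have "(norm (P y))\<^sup>2 \<le> (norm y)\<^sup>2" by simp
          then show ?thesis by (rule power2_le_imp_le) simp
        qed
        finally have vy: "norm v \<le> norm y" .
        have "K y - ?G y = B v"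
          unfolding K_def v_def using bounded_op_diff[OF bB, of "P y" "oproj x n y"] by simp
        moreover have "norm (B v) \<le> e * norm v"
        proof (rule power2_le_imp_le)
          \<comment> \<open>Positivity of \<open>B\<close> on \<open>W\<close> controls the mixed
            term of |A v - \<alpha> v|^2 and leaves ((a n)^2 - \<alpha>^2) |v|^2, which is why
            \<open>n\<close> was chosen through squares.\<close>
          have 1: "\<alpha> * (norm v)\<^sup>2 \<le> Re (cinner (A v) v)"
            using BWpos[OF vW] by (simp add: B_def cinner.diff_left cinner_scaleR_left Re_cinner_self)
          have "(norm (B v))\<^sup>2 = (norm (A v))\<^sup>2 + \<alpha>\<^sup>2 * (norm v)\<^sup>2 - 2 * (\<alpha> * Re (cinner (A v) v))"
            by (simp add: B_def norm_sq_diff cinner_scaleR_right power_mult_distrib)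
          also have "\<dots> \<le> (a n)\<^sup>2 * (norm v)\<^sup>2 + \<alpha>\<^sup>2 * (norm v)\<^sup>2 - 2 * (\<alpha> * (\<alpha> * (norm v)\<^sup>2))"
            using power_mono[OF le[OF vn], of 2] mult_left_mono[OF 1 \<alpha>0] by (simp add: power_mult_distrib)
          also have "\<dots> = ((a n)\<^sup>2 - \<alpha>\<^sup>2) * (norm v)\<^sup>2" by (simp add: power2_eq_square algebra_simps)
          also have "\<dots> \<le> e\<^sup>2 * (norm v)\<^sup>2" using n by (intro mult_right_mono) auto
          finally show "(norm (B v))\<^sup>2 \<le> (e * norm v)\<^sup>2" by (simp add: power_mult_distrib)
        qed (use e in simp)
        moreover have "e * norm v \<le> e * norm y" using vy e by (intro mult_left_mono) auto
        ultimately show ?thesis by simp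
      qed
      ultimately show "\<exists>G. finite_rank_op G \<and> (\<forall>y. norm (K y - G y) \<le> e * norm y)" by blast
    qed
    moreover have "finite_rank_op F"
    proof -
      obtain S where S: "finite S" "S \<subseteq> N" "\<And>z. z \<in> N \<inter> ocompl S \<Longrightarrow> A z = \<alpha> *\<^sub>R z"
        using attaining_finite_rank_below[OF A AN x ev \<alpha>0 \<alpha>(2) N_def leN] by blast
      obtain f m where f: "corthonormal f {..<m}" "cspan S = cspan (f ` {..<m})"
        using corthonormal_basis_exists[of "cspan S"] cfinite_dim_cspan[OF S(1)] by auto
      have SN: "cspan S \<subseteq> N" using S(2) unfolding N_def by (intro cvec.span_minimal csubspace_ocompl)
      \<comment> \<open>On the part of \<open>N\<close> orthogonal to \<open>S\<close> the operator
        \<open>B\<close> vanishes, so only the projection of \<open>y - P y\<close> onto the span of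
        \<open>S\<close> contributes.\<close>
      have "F y \<in> B ` cspan S" for y
      proof -
        let ?u = "y - P y"
        let ?q = "oproj f m ?u"
        have q: "?q \<in> cspan S" using oproj_in_cspan f(2) by blast
        have "?u - ?q \<in> N"
          using P(2)[of y] subsetD[OF SN q] unfolding N_def
          by (rule cvec.subspace_diff[OF csubspace_ocompl])
        moreover have "?u - ?q \<in> ocompl S"
          using diff_oproj_ocompl[OF f(1), of ?u] ocompl_cspan f(2) by metis
        ultimately have "B (?u - ?q) = 0" using S(3) by (simp add: B_def)
        then have "F y = B ?q" using bounded_op_diff[OF bB, of ?u ?q] by (simp add: F_def)
        then show ?thesis using q by blast
      qed
      moreover have "cfinite_dim (B ` cspan S)"
        by (rule bounded_op_image_cfinite_dim[OF bounded_op_subset[OF bB]])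
          (simp_all add: cfinite_dim_cspan S(1))
      ultimately show ?thesis
        using bF cfinite_dim_subset[of "B ` cspan S" "range F"] by (auto simp: finite_rank_op_def)
    qed
    moreover have KF: "A y = \<alpha> *\<^sub>R y + K y + F y" for y
    proof -
      have "K y + F y = B y" using bounded_op_add[OF bB, of "P y" "y - P y"] by (simp add: K_def F_def)
      then show ?thesis by (simp add: B_def add.assoc)
    qed
    moreover have "self_adjoint_op F"
    proof (rule self_adjoint_opI[OF bF])
      have "F y = A y - \<alpha> *\<^sub>R y - K y" for y using KF[of y] by simp
      then show "cinner (F u) v = cinner u (F v)" for u v
        by (simp add: cinner.diff_left cinner.diff_right sym Ksym cinner_scaleR_left cinner_scaleR_right)
    qed
    ultimately show ?thesis using Kpos \<alpha>0 by blast
  qed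
qed

theorem theorem8p1:
  fixes T U :: "'a::complex_hilbert \<Rightarrow> 'b::complex_hilbert"
  assumes "bounded_op UNIV UNIV T"
    and "polar_decomposition T U"
  shows "((\<forall>w\<in>weights. \<forall>k\<ge>1. absolutely_norming w k T) \<longleftrightarrow>
          (\<exists>w\<in>weights. \<exists>k\<ge>1. absolutely_norming w k T)) \<and>
         ((\<exists>w\<in>weights. \<exists>k\<ge>1. absolutely_norming w k T) \<longleftrightarrow>
          (\<exists>\<alpha>::real. \<exists>K F. \<alpha> \<ge> 0 \<and>
             positive_op UNIV K \<and> compact_op K \<and>
             self_adjoint_op F \<and> finite_rank_op F \<and>
             (\<forall>x. abs_op UNIV T x = \<alpha> *\<^sub>R x + K x + F x)))"
    (is "(?all \<longleftrightarrow> ?some) \<and> (_ \<longleftrightarrow> ?decomp)")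
proof -
  note T = assms(1)
  have AN_abs: "absolutely_norm_attaining (abs_op UNIV T) \<longleftrightarrow> absolutely_norm_attaining T"
    unfolding absolutely_norm_attaining_def attains_norm_def
    by (simp add: norm_abs_op[OF closed_csubspace_UNIV T])
  \<comment> \<open>Passing from every weight sequence to some needs one to exist.\<close>
  have "(\<lambda>_. 1) \<in> weights" by (simp add: weights_def)
  then have 12: "?all \<Longrightarrow> ?some" by blast
  have 2: "?some \<Longrightarrow> absolutely_norm_attaining T"
    using norming_imp_attains_norm[OF _ _ bounded_op_subset[OF T subset_UNIV]]
    unfolding absolutely_norming_def absolutely_norm_attaining_def by blast
  have 1: "absolutely_norm_attaining T \<Longrightarrow> ?all"
    using attaining_imp_norming[OF T] by (simp add: absolutely_norming_def)
  have 3: "absolutely_norm_attaining T \<Longrightarrow> ?decomp"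
    using attaining_imp_decomposition[OF positive_op_abs_op[OF closed_csubspace_UNIV T]] AN_abs by simp
  have "?decomp \<Longrightarrow> absolutely_norm_attaining T"
    using decomposition_imp_attaining[where A = "abs_op UNIV T"] AN_abs by blast
  with 12 2 1 3 show ?thesis by blast
qed

end
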